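(* Let $n\ge 1$. A functional $Z\colon \mathrm{Conv}_{\rm sc}(\mathbb{R}^n)\to\mathbb{R}$ is a continuous and epi-translation invariant valuation that is epi-homogeneous of degree $n$ if and only if there exists $\zeta\in C_c(\mathbb{R}^n)$ such that $$Z(u)=\int_{\mathrm{dom}(u)}\zeta(\nabla u(x))\,dx$$ for every $u\in\mathrm{Conv}_{\rm sc}(\mathbb{R}^n)$.
   Context: $\mathrm{Conv}(\mathbb{R}^n)$ is the set of convex, lower semicontinuous functions $u\colon\mathbb{R}^n\to\mathbb{R}\cup\{+\infty\}$ with $u\not\equiv+\infty$. $\mathrm{Conv}_{\rm sc}(\mathbb{R}^n)$ is the subset of super-coercive functions, i.e. those $u\in\mathrm{Conv}(\mathbb{R}^n)$ with $\lim_{|x|\to+\infty}u(x)/|x|=+\infty$. Topology: continuity is with respect to epi-convergence. A sequence $u_k$ epi-converges to $u$ if for every $x\in\mathbb{R}^n$: (i) $u(x)\le\liminf_{k\to\infty}u_k(x_k)$ for every sequence $x_k\to x$, and (ii) there is a sequence $x_k\to x$ with $u(x)=\lim_{k\to\infty}u_k(x_k)$. A functional $Z\colon X\to\mathbb{R}$ on a set $X$ of functions is a valuation if $Z(u\vee v)+Z(u\wedge v)=Z(u)+Z(v)$ for all $u,v\in X$ with $u\vee v\in X$ and $u\wedge v\in X$, where $\vee$ and $\wedge$ denote pointwise maximum and minimum. $Z$ is epi-translation invariant if it is translation invariant ($Z(u\circ\tau^{-1})=Z(u)$ for all $u$ and all translations $\tau\colon\mathbb{R}^n\to\mathbb{R}^n$)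 and vertically translation invariant ($Z(u+\alpha)=Z(u)$ for all $u$ and all constants $\alpha\in\mathbb{R}$). For $\lambda>0$, epi-multiplication is $(\lambda\cdot_{\rm epi} u)(x)=\lambda\,u(x/\lambda)$. $Z$ is epi-homogeneous of degree $\alpha\in\mathbb{R}$ if $Z(\lambda\cdot_{\rm epi}u)=\lambda^\alpha Z(u)$ for all $u$ and all $\lambda>0$. $\mathrm{dom}(u)$ is the set of points where $u$ is finite; $\nabla u$ is the gradient of $u$, which exists at almost every point of $\mathrm{dom}(u)$. $C_c(\mathbb{R}^n)$ is the set of continuous real-valued functions on $\mathbb{R}^n$ with compact support. *)

theory Defs
  imports "HOL-Analysis.Analysis"
begin

text \<open>
  Functions with values in the reals extended by plus infinity are modelled as
  \<^typ>\<open>ereal\<close>-valued functions that never take the value minus infinity.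
  A functional on a set \<open>X\<close> of such functions is modelled as a total function of which only
  the values on \<open>X\<close> are ever used.
\<close>

definition eff_dom :: "('a \<Rightarrow> ereal) \<Rightarrow> 'a set" where
  "eff_dom u = {x. \<bar>u x\<bar> \<noteq> \<infinity>}"

text \<open>The value minus infinity is excluded in \<open>Conv\<close> below, so the sum on the right-hand side
  is never of the form \<open>\<infinity> - \<infinity>\<close>.\<close>

definition econvex :: "('a::real_vector \<Rightarrow> ereal) \<Rightarrow> bool" where
  "econvex u \<longleftrightarrow>
     (\<forall>x y. \<forall>t::real. 0 < t \<longrightarrow> t < 1 \<longrightarrow>
        u ((1 - t) *\<^sub>R x + t *\<^sub>R y) \<le> ereal (1 - t) * u x + ereal t * u y)"

definition lower_semicont :: "('a::topological_space \<Rightarrow> ereal) \<Rightarrow> bool" where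
  "lower_semicont u \<longleftrightarrow> (\<forall>x. u x \<le> Liminf (at x) u)"

definition Conv :: "('a::euclidean_space \<Rightarrow> ereal) set" where
  "Conv = {u. (\<forall>x. u x \<noteq> -\<infinity>) \<and> econvex u \<and> lower_semicont u \<and> (\<exists>x. u x \<noteq> \<infinity>)}"

definition super_coercive :: "('a::real_normed_vector \<Rightarrow> ereal) \<Rightarrow> bool" where
  "super_coercive u \<longleftrightarrow> ((\<lambda>x. u x / ereal (norm x)) \<longlongrightarrow> \<infinity>) at_infinity"

definition Conv_sc :: "('a::euclidean_space \<Rightarrow> ereal) set" where
  "Conv_sc = {u \<in> Conv. super_coercive u}"

definition epi_converges ::
  "(nat \<Rightarrow> 'a::topological_space \<Rightarrow> ereal) \<Rightarrow> ('a \<Rightarrow> ereal) \<Rightarrow> bool" where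
  "epi_converges us u \<longleftrightarrow>
     (\<forall>x. (\<forall>s. s \<longlonglongrightarrow> x \<longrightarrow> u x \<le> liminf (\<lambda>k. us k (s k))) \<and>
          (\<exists>s. s \<longlonglongrightarrow> x \<and> (\<lambda>k. us k (s k)) \<longlonglongrightarrow> u x))"

definition epi_continuous_on ::
  "('a::topological_space \<Rightarrow> ereal) set \<Rightarrow> (('a \<Rightarrow> ereal) \<Rightarrow> real) \<Rightarrow> bool" where
  "epi_continuous_on X Z \<longleftrightarrow>
     (\<forall>us. \<forall>u\<in>X. (\<forall>k. us k \<in> X) \<longrightarrow> epi_converges us u \<longrightarrow> (\<lambda>k. Z (us k)) \<longlonglongrightarrow> Z u)"

definition valuation_on :: "('a \<Rightarrow> ereal) set \<Rightarrow> (('a \<Rightarrow> ereal) \<Rightarrow> real) \<Rightarrow> bool" where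
  "valuation_on X Z \<longleftrightarrow>
     (\<forall>u\<in>X. \<forall>v\<in>X. (\<lambda>x. max (u x) (v x)) \<in> X \<longrightarrow> (\<lambda>x. min (u x) (v x)) \<in> X \<longrightarrow>
        Z (\<lambda>x. max (u x) (v x)) + Z (\<lambda>x. min (u x) (v x)) = Z u + Z v)"

definition translation_invariant_on ::
  "('a::ab_group_add \<Rightarrow> ereal) set \<Rightarrow> (('a \<Rightarrow> ereal) \<Rightarrow> real) \<Rightarrow> bool" where
  "translation_invariant_on X Z \<longleftrightarrow> (\<forall>u\<in>X. \<forall>a. Z (\<lambda>x. u (x - a)) = Z u)"

definition vertically_translation_invariant_on ::
  "('a \<Rightarrow> ereal) set \<Rightarrow> (('a \<Rightarrow> ereal) \<Rightarrow> real) \<Rightarrow> bool" where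
  "vertically_translation_invariant_on X Z \<longleftrightarrow>
     (\<forall>u\<in>X. \<forall>c::real. Z (\<lambda>x. u x + ereal c) = Z u)"

definition epi_translation_invariant_on ::
  "('a::ab_group_add \<Rightarrow> ereal) set \<Rightarrow> (('a \<Rightarrow> ereal) \<Rightarrow> real) \<Rightarrow> bool" where
  "epi_translation_invariant_on X Z \<longleftrightarrow>
     translation_invariant_on X Z \<and> vertically_translation_invariant_on X Z"

definition epi_mult :: "real \<Rightarrow> ('a::real_vector \<Rightarrow> ereal) \<Rightarrow> 'a \<Rightarrow> ereal" where
  "epi_mult c u = (\<lambda>x. ereal c * u (x /\<^sub>R c))"

definition epi_homogeneous_on ::
  "real \<Rightarrow> ('a::real_vector \<Rightarrow> ereal) set \<Rightarrow> (('a \<Rightarrow> ereal) \<Rightarrow> real) \<Rightarrow> bool" where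
  "epi_homogeneous_on \<alpha> X Z \<longleftrightarrow> (\<forall>u\<in>X. \<forall>c>0. Z (epi_mult c u) = c powr \<alpha> * Z u)"

text \<open>The conversion \<^const>\<open>real_of_ereal\<close> sends infinity to \<open>0\<close>; this is harmless
  because differentiability is only considered at interior points of the effective domain, near
  which \<open>u\<close> is finite. The constant \<open>egrad u x\<close> is unspecified where \<open>u\<close> is not differentiable,
  which for convex \<open>u\<close> is a null set within the effective domain.\<close>

definition has_egrad :: "('a::real_inner \<Rightarrow> ereal) \<Rightarrow> 'a \<Rightarrow> 'a \<Rightarrow> bool" where
  "has_egrad u x D \<longleftrightarrow>
     x \<in> interior (eff_dom u) \<and> (GDERIV (\<lambda>y. real_of_ereal (u y)) x :> D)"

definition egrad :: "('a::real_inner \<Rightarrow> ereal) \<Rightarrow> 'a \<Rightarrow> 'a" where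
  "egrad u x = (THE D. has_egrad u x D)"

definition Cc :: "('a::topological_space \<Rightarrow> real) set" where
  "Cc = {\<zeta>. continuous_on UNIV \<zeta> \<and> compact (closure {x. \<zeta> x \<noteq> 0})}"

end

theory Submission
  imports Defs "HOL-Complex_Analysis.Great_Picard"
begin

text \<open>
  If \<open>Z\<close> has density \<open>\<zeta>\<close>, the valuation property holds pointwise almost everywhere, since two convex
  functions that touch at a common point of differentiability have the same gradient there.
  Continuity is dominated convergence: on the interior of the domain of an epi-limit the gradients
  converge, outside of the domain they become unbounded and leave the support of \<open>\<zeta>\<close>, and uniform
  coercivity confines the points with gradient in the support to a fixed ball.

  Conversely, restrict a Lipschitz convex function \<open>v\<close> to boxes. Homogeneity of degree \<open>n\<close> makes \<open>Z\<close>
  vanish on degenerate boxes, so \<open>Z\<close> is additive over a grid of mesh \<open>1/N\<close>. By homogeneity and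
  vertical invariance, \<open>N^n\<close> times the value on a cell near \<open>x\<close> is the value on the unit cube of a
  blow-up of \<open>v\<close>, which tends to the linear function with slope \<open>\<nabla>v(x)\<close>. Hence
  dominated convergence gives the representation with \<open>\<zeta>(y)\<close> the value of \<open>Z\<close> at the linear function
  of slope \<open>y\<close> on the unit cube. General functions are epi-limits of Lipschitz functions on cubes.
\<close>

section \<open>Functions in Conv\<close>

text \<open>Lipschitz functions carry the converse because the rescaling
  \<open>v (r z + p) / r\<close> forced by homogeneity preserves the Lipschitz constant. All
  blow-ups on the unit cube therefore lie in one class which, up to additive constants that
  \<open>Z\<close> does not see, is compact by Arzela-Ascoli; continuity of \<open>Z\<close> then
  yields the uniform bound that dominates. The same finiteness lets the argument for degenerate
  boxes contract a supremum over such a class. The functional of a density enters the converse a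
  second time: it agrees with \<open>Z\<close> on cubes, and a general function is reached by
  continuity of both. The continuity proof uses compact support of the density, which is extracted
  from \<open>Z\<close> alone by testing on linear functions. Differentiability almost everywhere
  comes from an integral estimate: the second difference of step \<open>t\<close> along an axis,
  divided by \<open>t\<close>, has integral of order \<open>t\<close> over a box, because it
  telescopes under translation.\<close>

abbreviation rpart :: "('a \<Rightarrow> ereal) \<Rightarrow> 'a \<Rightarrow> real" where
  "rpart u \<equiv> (\<lambda>x. real_of_ereal (u x))"

text \<open>Localisation is expressed by cutting off with \<open>\<infinity>\<close>: the maximum
  and the minimum of two cut-offs of the same \<open>v\<close> are its cut-offs to the intersection
  and to the union, so the valuation property turns into additivity in the set.\<close>

definition inf_ext :: "'a set \<Rightarrow> ('a \<Rightarrow> real) \<Rightarrow> 'a \<Rightarrow> ereal" where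
  "inf_ext B v = (\<lambda>x. if x \<in> B then ereal (v x) else \<infinity>)"

lemma inf_ext_simps [simp]:
  "x \<in> B \<Longrightarrow> inf_ext B v x = ereal (v x)" "x \<notin> B \<Longrightarrow> inf_ext B v x = \<infinity>"
  by (auto simp: inf_ext_def)

lemma eff_dom_ext [simp]: "eff_dom (inf_ext B v) = B"
  by (auto simp: eff_dom_def inf_ext_def)

lemma ConvD:
  assumes "u \<in> Conv"
  shows "u x \<noteq> -\<infinity>" "econvex u" "lower_semicont u" "eff_dom u \<noteq> {}"
    "x \<notin> eff_dom u \<Longrightarrow> u x = \<infinity>" "x \<in> eff_dom u \<Longrightarrow> u x = ereal (rpart u x)"
  using assms by (auto simp: Conv_def eff_dom_def ereal_real)

lemma econvex_ext:
  assumes "convex_on B v"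
  shows "econvex (inf_ext B v)"
  unfolding econvex_def
proof (intro allI impI)
  fix x y and t :: real assume t: "0 < t" "t < 1"
  show "inf_ext B v ((1 - t) *\<^sub>R x + t *\<^sub>R y) \<le> ereal (1 - t) * inf_ext B v x + ereal t * inf_ext B v y"
  proof (cases "x \<in> B \<and> y \<in> B")
    case True
    moreover have "(1 - t) *\<^sub>R x + t *\<^sub>R y \<in> B"
      using True assms t by (auto simp: convex_on_def convex_alt)
    moreover have "v ((1 - t) *\<^sub>R x + t *\<^sub>R y) \<le> (1 - t) * v x + t * v y"
      using True t by (intro convex_onD[OF assms]) auto
    ultimately show ?thesis by simp
  next
    case False
    then have *: "ereal (1 - t) * inf_ext B v x + ereal t * inf_ext B v y = \<infinity>"
      using t by (auto simp: inf_ext_def)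
    show ?thesis unfolding * by simp
  qed
qed

lemma convex_on_rpart:
  assumes "u \<in> Conv"
  shows "convex_on (eff_dom u) (rpart u)"
proof -
  have *: "((1 - t) *\<^sub>R x + t *\<^sub>R y) \<in> eff_dom u \<and>
      rpart u ((1 - t) *\<^sub>R x + t *\<^sub>R y) \<le> (1 - t) * rpart u x + t * rpart u y"
    if "x \<in> eff_dom u" "y \<in> eff_dom u" "0 < t" "t < 1" for x y t
  proof -
    have "u ((1 - t) *\<^sub>R x + t *\<^sub>R y) \<le> ereal (1 - t) * u x + ereal t * u y"
      using ConvD(2)[OF assms] that unfolding econvex_def by blast
    also have "\<dots> = ereal ((1 - t) * rpart u x + t * rpart u y)"
      using ConvD(6)[OF assms that(1)] ConvD(6)[OF assms that(2)]
      by (metis plus_ereal.simps(1) times_ereal.simps(1))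
    finally have le: "u ((1 - t) *\<^sub>R x + t *\<^sub>R y) \<le> ereal ((1 - t) * rpart u x + t * rpart u y)" .
    then have "u ((1 - t) *\<^sub>R x + t *\<^sub>R y) \<noteq> \<infinity>" by auto
    then have "((1 - t) *\<^sub>R x + t *\<^sub>R y) \<in> eff_dom u"
      using ConvD(1)[OF assms] by (auto simp: eff_dom_def)
    with le show ?thesis
      using ConvD(6)[OF assms] by (metis ereal_less_eq(3))
  qed
  have "convex (eff_dom u)"
    unfolding convex_alt
  proof (intro ballI allI impI)
    fix x y t assume "x \<in> eff_dom u" "y \<in> eff_dom u" "0 \<le> (t::real) \<and> t \<le> 1"
    then show "(1 - t) *\<^sub>R x + t *\<^sub>R y \<in> eff_dom u"
      using *[of x y t] by (cases "t = 0"; cases "t = 1") auto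
  qed
  then show ?thesis
    by (intro convex_onI) (use * in auto)
qed

lemmas convex_eff_dom = convex_on_rpart[THEN convex_on_imp_convex]

text \<open>The definition takes the lower limit over punctured neighbourhoods. At \<open>x\<close>
  itself the inequality holds by assumption, so full neighbourhoods give the same condition.\<close>

lemma lower_semicont_iff:
  "lower_semicont u \<longleftrightarrow> (\<forall>x c. c < u x \<longrightarrow> (\<forall>\<^sub>F y in nhds x. c < u y))"
  unfolding lower_semicont_def le_Liminf_iff eventually_nhds_conv_at
  by blast

lemma open_superlevel:
  assumes "lower_semicont u"
  shows "open {x. c < u x}"
  using assms unfolding lower_semicont_iff open_subopen[of "{x. c < u x}"] eventually_nhds
  by (metis mem_Collect_eq subsetI)

lemma borel_measurable_lsc:
  assumes "lower_semicont u"
  shows "u \<in> borel_measurable borel"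
  by (intro borel_measurableI_greater) (use open_superlevel[OF assms] in auto)

lemma borel_measurable_rpart:
  assumes "u \<in> Conv"
  shows "rpart u \<in> borel_measurable borel" "eff_dom u \<in> sets borel"
proof -
  have [measurable]: "u \<in> borel_measurable borel"
    using borel_measurable_lsc ConvD(3)[OF assms] by blast
  show "rpart u \<in> borel_measurable borel" by measurable
  have "eff_dom u = {x \<in> space borel. \<bar>u x\<bar> \<noteq> \<infinity>}" by (auto simp: eff_dom_def)
  also have "\<dots> \<in> sets borel" by measurable
  finally show "eff_dom u \<in> sets borel" .
qed

lemma lower_semicont_ext:
  fixes B :: "'a::t2_space set"
  assumes "compact B" "continuous_on B v"
  shows "lower_semicont (inf_ext B v)"
  unfolding lower_semicont_iff
proof (intro allI impI)
  fix x c assume c: "c < inf_ext B v x"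
  have cl: "closed B" using assms compact_imp_closed by blast
  show "\<forall>\<^sub>F y in nhds x. c < inf_ext B v y"
  proof (cases "x \<in> B")
    case False
    then have "\<forall>\<^sub>F y in nhds x. y \<in> -B"
      using cl by (intro eventually_nhds_in_open) auto
    then show ?thesis by eventually_elim (use c False in \<open>auto simp: inf_ext_def\<close>)
  next
    case True
    have "((\<lambda>y. ereal (v y)) \<longlongrightarrow> ereal (v x)) (at x within B)"
      using assms True by (auto simp: continuous_on_def intro!: tendsto_intros)
    then have "\<forall>\<^sub>F y in at x within B. c < ereal (v y)"
      using c True order_tendstoD(1) by fastforce
    then have "\<forall>\<^sub>F y in nhds x. y \<noteq> x \<longrightarrow> y \<in> B \<longrightarrow> c < ereal (v y)"
      by (simp add: eventually_at_filter)
    then show ?thesis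
      by eventually_elim (use c True in \<open>auto simp: inf_ext_def\<close>)
  qed
qed

lemma super_coercive_ext:
  assumes "bounded B"
  shows "super_coercive (inf_ext B v)"
proof -
  obtain R where R: "\<And>x. x \<in> B \<Longrightarrow> norm x \<le> R" using assms by (auto simp: bounded_iff)
  have "\<forall>\<^sub>F x in at_infinity. inf_ext B v x / ereal (norm x) = \<infinity>"
    unfolding eventually_at_infinity
    by (intro exI[of _ "max 1 (R + 1)"]) (use R in \<open>force simp: inf_ext_def divide_ereal_def\<close>)
  then show ?thesis unfolding super_coercive_def by (rule tendsto_eventually)
qed

lemma inf_ext_Conv_sc:
  fixes B :: "'a::euclidean_space set"
  assumes "compact B" "B \<noteq> {}" "convex_on B v" "continuous_on B v"
  shows "inf_ext B v \<in> Conv_sc"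
  using assms econvex_ext[OF assms(3)] lower_semicont_ext[OF assms(1,4)]
    super_coercive_ext[OF compact_imp_bounded[OF assms(1)]]
  by (auto simp: Conv_sc_def Conv_def inf_ext_def)

lemma Conv_sc_Conv: "u \<in> Conv_sc \<Longrightarrow> u \<in> Conv"
  by (simp add: Conv_sc_def)

text \<open>The form in which super-coercivity is used: outside a ball, \<open>u\<close> lies above
  the cone of any given slope. A radius of at least 1 keeps the norm positive, so the quotient can
  be cleared.\<close>

lemma Conv_sc_superlinear:
  fixes u :: "'a::euclidean_space \<Rightarrow> ereal"
  assumes "u \<in> Conv_sc"
  obtains T where "T > 0" "\<And>x. norm x \<ge> T \<Longrightarrow> ereal (C * norm x) \<le> u x"
proof -
  have "((\<lambda>x. u x / ereal (norm x)) \<longlongrightarrow> \<infinity>) at_infinity"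
    using assms by (simp add: Conv_sc_def super_coercive_def)
  then have "\<forall>\<^sub>F x in at_infinity. ereal C < u x / ereal (norm x)"
    by (auto simp: tendsto_PInfty)
  then obtain T where T: "\<And>x. norm x \<ge> T \<Longrightarrow> ereal C < u x / ereal (norm x)"
    by (auto simp: eventually_at_infinity)
  show ?thesis
  proof
    show "max T 1 > 0" by simp
    fix x :: 'a assume "norm x \<ge> max T 1"
    moreover from this have "x \<noteq> 0" by auto
    ultimately show "ereal (C * norm x) \<le> u x"
      using ConvD(1)[OF Conv_sc_Conv[OF assms], of x] T[of x]
      by (cases "u x") (auto simp: field_simps)
  qed
qed

section \<open>Differentiability criteria for convex functions\<close>

text \<open>The difference quotients \<open>q\<close> of a convex function are monotone, and each
  left quotient lies below each right one. The second difference divided by \<open>t\<close> is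
  exactly the gap \<open>q t - q (-t)\<close>. Hence a single good \<open>t\<close> for each
  \<open>\<epsilon>\<close> suffices: all shorter steps have their quotients trapped in the same
  gap.\<close>

lemma convex_second_difference_imp_deriv:
  fixes f :: "'a::euclidean_space \<Rightarrow> real"
  assumes cv: "convex_on S f" and "open S" "x \<in> S"
    and small: "\<And>\<epsilon>. \<epsilon> > 0 \<Longrightarrow> \<exists>t>0. x + t *\<^sub>R e \<in> S \<and> x - t *\<^sub>R e \<in> S \<and>
        f (x + t *\<^sub>R e) + f (x - t *\<^sub>R e) - 2 * f x < \<epsilon> * t"
  shows "\<exists>d. ((\<lambda>t. f (x + t *\<^sub>R e)) has_real_derivative d) (at 0)"
proof -
  define J where "J = {t. x + t *\<^sub>R e \<in> S}"
  define q where "q t = (f (x + t *\<^sub>R e) - f x) / t" for t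
  have cS: "convex S" using cv by (rule convex_on_imp_convex)
  have conv: "a * f (x + s *\<^sub>R e) + b * f (x + t *\<^sub>R e) \<ge> f (x + r *\<^sub>R e)" and inJ: "r \<in> J"
    if "s \<in> J" "t \<in> J" "a \<ge> 0" "b \<ge> 0" "a + b = 1" "r = a * s + b * t" for a b s t r
  proof -
    have eq: "x + r *\<^sub>R e = a *\<^sub>R (x + s *\<^sub>R e) + b *\<^sub>R (x + t *\<^sub>R e)"
    proof -
      have "a *\<^sub>R (x + s *\<^sub>R e) + b *\<^sub>R (x + t *\<^sub>R e) = (a + b) *\<^sub>R x + (a * s + b * t) *\<^sub>R e"
        by (simp add: algebra_simps)
      then show ?thesis using that by simp
    qed
    show "f (x + r *\<^sub>R e) \<le> a * f (x + s *\<^sub>R e) + b * f (x + t *\<^sub>R e)"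
      unfolding eq using cv that by (simp add: convex_on_def J_def)
    show "r \<in> J" unfolding J_def mem_Collect_eq eq
      by (intro convexD[OF cS]) (use that in \<open>auto simp: J_def\<close>)
  qed
  have zero: "0 \<in> J" using assms by (simp add: J_def)
  have opp: "q (-s) \<le> q t" if "s > 0" "t > 0" "-s \<in> J" "t \<in> J" for s t
  proof -
    have "s + t \<noteq> 0" using that by linarith
    then have "t/(s+t) + s/(s+t) = 1" by (simp add: add_divide_distrib[symmetric] add.commute)
    then have "f (x + 0 *\<^sub>R e) \<le> t/(s+t) * f (x + (-s) *\<^sub>R e) + s/(s+t) * f (x + t *\<^sub>R e)"
      by (intro conv) (use that in auto)
    also have "\<dots> = (t * f (x - s *\<^sub>R e) + s * f (x + t *\<^sub>R e)) / (s + t)"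
      by (simp add: add_divide_distrib)
    finally have "f x \<le> (t * f (x - s *\<^sub>R e) + s * f (x + t *\<^sub>R e)) / (s + t)" by simp
    then have "(s + t) * f x \<le> t * f (x - s *\<^sub>R e) + s * f (x + t *\<^sub>R e)"
      using that by (simp add: pos_le_divide_eq mult.commute)
    then show ?thesis using that by (simp add: q_def field_simps)
  qed
  have mono: "q s \<le> q t" if "0 < s" "s \<le> t" "t \<in> J" for s t
  proof -
    have "f (x + s *\<^sub>R e) \<le> (1 - s/t) * f (x + 0 *\<^sub>R e) + s/t * f (x + t *\<^sub>R e)"
      by (rule conv) (use that zero in \<open>auto simp: field_simps\<close>)
    then show ?thesis using that by (simp add: q_def field_simps)
  qed
  have mono': "q (-t) \<le> q (-s)" if "0 < s" "s \<le> t" "-t \<in> J" for s t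
  proof -
    have "f (x + (-s) *\<^sub>R e) \<le> (1 - s/t) * f (x + 0 *\<^sub>R e) + s/t * f (x + (-t) *\<^sub>R e)"
      by (rule conv) (use that zero in \<open>auto simp: field_simps\<close>)
    then show ?thesis using that by (simp add: q_def field_simps)
  qed
  have ex: "\<exists>t>0. t \<in> J \<and> -t \<in> J \<and> q t - q (-t) < \<epsilon>" if "\<epsilon> > 0" for \<epsilon>
  proof -
    note small[OF that]
    then obtain t where t: "t > 0" "x + t *\<^sub>R e \<in> S" "x - t *\<^sub>R e \<in> S"
        "f (x + t *\<^sub>R e) + f (x - t *\<^sub>R e) - 2 * f x < \<epsilon> * t"
      by blast
    have "q t - q (-t) = (f (x + t *\<^sub>R e) + f (x - t *\<^sub>R e) - 2 * f x) / t"
      using t(1) by (simp add: q_def field_simps)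
    with t show ?thesis
      by (intro exI[of _ t]) (auto simp: J_def pos_divide_less_eq)
  qed
  \<comment> \<open>The right quotients decrease as the step shrinks, so their infimum is the
    candidate derivative; any left quotient bounds them from below.\<close>
  define A where "A = {q t |t. t > 0 \<and> t \<in> J}"
  obtain t1 where t1: "t1 > 0" "t1 \<in> J" "-t1 \<in> J" using ex[of 1] by auto
  have A: "A \<noteq> {}" "bdd_below A"
    using t1 opp[of t1] by (auto simp: A_def bdd_below_def)
  define d where "d = Inf A"
  have d1: "d \<le> q t" if "t > 0" "t \<in> J" for t
    unfolding d_def by (rule cInf_lower) (use A that in \<open>auto simp: A_def\<close>)
  have d2: "q (-t) \<le> d" if "t > 0" "-t \<in> J" for t
    unfolding d_def by (rule cInf_greatest) (use A that opp in \<open>auto simp: A_def\<close>)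
  have "(\<lambda>h. (f (x + (0 + h) *\<^sub>R e) - f (x + 0 *\<^sub>R e)) / h) \<midarrow>0\<rightarrow> d"
  proof (rule LIM_I)
    fix \<epsilon> :: real assume "\<epsilon> > 0"
    then obtain t where t: "t > 0" "t \<in> J" "-t \<in> J" "q t - q (-t) < \<epsilon>" using ex by blast
    have "\<bar>q s - d\<bar> < \<epsilon>" if "s \<noteq> 0" "\<bar>s\<bar> < t" for s
    proof (cases "s > 0")
      case True
      moreover have "s \<in> J" by (rule inJ[of 0 t "1 - s/t" "s/t"]) (use t zero that True in auto)
      ultimately have "d \<le> q s" "q s \<le> q t" "q (-t) \<le> d"
        using t d1 d2 mono[of s t] that by auto
      then show ?thesis using t by auto
    next
      case False
      define r where "r = -s"
      have r: "r > 0" "r < t" using False that by (auto simp: r_def)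
      have "-r \<in> J" by (rule inJ[of 0 "-t" "1 - r/t" "r/t"]) (use t zero r in auto)
      then have "q (-r) \<le> d" "q (-t) \<le> q (-r)" "d \<le> q t"
        using t d1 d2 mono'[of r t] r by auto
      then show ?thesis using t by (auto simp: r_def)
    qed
    then show "\<exists>s>0. \<forall>h. h \<noteq> 0 \<and> norm (h - 0) < s \<longrightarrow>
        norm ((f (x + (0 + h) *\<^sub>R e) - f (x + 0 *\<^sub>R e)) / h - d) < \<epsilon>"
      using t by (auto simp: q_def)
  qed
  then show ?thesis unfolding DERIV_def by blast
qed

text \<open>For convex functions partial derivatives suffice. The point \<open>x + h\<close> is the
  average of the \<open>n\<close> points obtained from \<open>x\<close> by moving \<open>n\<close>
  times the \<open>i\<close>-th coordinate of \<open>h\<close> along axis \<open>i\<close>, so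
  Jensen's inequality bounds \<open>f (x + h)\<close> from above by one-dimensional increments. The
  lower bound is the upper bound at \<open>-h\<close> combined with midpoint convexity.\<close>

lemma convex_partials_imp_gderiv:
  fixes f :: "'a::euclidean_space \<Rightarrow> real"
  assumes cv: "convex_on S f" and "open S" "x \<in> S"
    and d: "\<And>i. i \<in> Basis \<Longrightarrow> ((\<lambda>t. f (x + t *\<^sub>R i)) has_real_derivative d i) (at 0)"
  shows "GDERIV f x :> (\<Sum>i\<in>Basis. d i *\<^sub>R i)"
proof -
  define n where "n = real DIM('a)"
  have n: "n > 0" by (simp add: n_def)
  define D where "D = (\<Sum>i\<in>Basis. d i *\<^sub>R i)"
  have hD: "h \<bullet> D = (\<Sum>i\<in>Basis. (h \<bullet> i) * d i)" for h
    by (simp add: D_def inner_sum_right mult.commute)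
  obtain \<rho> where \<rho>: "\<rho> > 0" "ball x \<rho> \<subseteq> S" using assms open_contains_ball by blast
  have "(f has_derivative (\<lambda>h. h \<bullet> D)) (at x)"
    unfolding has_derivative_at_alt
  proof (intro conjI allI impI)
    show "bounded_linear (\<lambda>h. h \<bullet> D)" by (rule bounded_linear_inner_left)
    fix e :: real assume e: "e > 0"
    have "\<exists>\<delta>>0. \<forall>t. \<bar>t\<bar> < \<delta> \<longrightarrow> \<bar>f (x + t *\<^sub>R i) - f x - t * d i\<bar> \<le> e / n * \<bar>t\<bar>" if "i \<in> Basis" for i
    proof -
      have "((\<lambda>t. f (x + t *\<^sub>R i)) has_derivative (\<lambda>h. h * d i)) (at 0)"
        using d[OF that] by (simp add: has_field_derivative_def mult_commute_abs)
      then have "\<forall>e>0. \<exists>\<delta>>0. \<forall>y. norm (y - 0) < \<delta> \<longrightarrow>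
          norm (f (x + y *\<^sub>R i) - f (x + 0 *\<^sub>R i) - (y - 0) * d i) \<le> e * norm (y - 0)"
        unfolding has_derivative_at_alt by blast
      from this[rule_format, of "e / n"] show ?thesis using e n by simp
    qed
    then obtain \<delta> where \<delta>: "\<And>i. i \<in> Basis \<Longrightarrow> \<delta> i > 0"
      "\<And>i t. i \<in> Basis \<Longrightarrow> \<bar>t\<bar> < \<delta> i \<Longrightarrow> \<bar>f (x + t *\<^sub>R i) - f x - t * d i\<bar> \<le> e / n * \<bar>t\<bar>"
      by metis
    \<comment> \<open>The axis points lie \<open>n\<close> times as far out as the coordinates of
      \<open>h\<close>, hence the division by \<open>n\<close>.\<close>
    define r where "r = Min (insert \<rho> (\<delta> ` Basis)) / n"
    have "r > 0" using \<rho> \<delta> n by (auto simp: r_def)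
    have rn: "n * r \<le> \<rho>" "i \<in> Basis \<Longrightarrow> n * r \<le> \<delta> i" for i
      using n by (auto simp: r_def intro!: Min_le min.coboundedI2)
    have n1: "n \<ge> 1" using DIM_positive[where 'a='a] unfolding n_def by linarith
    have up: "x + h \<in> S \<and> f (x + h) - f x - h \<bullet> D \<le> e * norm h" if h: "norm h < r" for h
    proof -
      have nh: "\<bar>n * (h \<bullet> i)\<bar> < n * r" if "i \<in> Basis" for i
        using Basis_le_norm[OF that, of h] n h by (simp add: abs_mult)
      have S: "x + (n * (h \<bullet> i)) *\<^sub>R i \<in> S" if "i \<in> Basis" for i
        using nh[OF that] rn(1) \<rho>(2) that by (auto simp: dist_norm subset_iff)
      have eq: "x + h = (\<Sum>i\<in>Basis. (1/n) *\<^sub>R (x + (n * (h \<bullet> i)) *\<^sub>R i))"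
      proof -
        have "(\<Sum>i\<in>Basis. (1/n) *\<^sub>R (x + (n * (h \<bullet> i)) *\<^sub>R i))
            = (\<Sum>i\<in>(Basis::'a set). (1/n) *\<^sub>R x) + (\<Sum>i\<in>Basis. (h \<bullet> i) *\<^sub>R i)"
          using n by (simp add: scaleR_add_right sum.distrib)
        also have "(\<Sum>i\<in>(Basis::'a set). (1/n) *\<^sub>R x) = x"
          using n by (simp add: sum_constant_scaleR n_def)
        finally show ?thesis by (simp add: euclidean_representation)
      qed
      have "f (x + h) \<le> (\<Sum>i\<in>Basis. 1/n * f (x + (n * (h \<bullet> i)) *\<^sub>R i))"
        unfolding eq by (rule convex_on_sum) (use cv n S in \<open>auto simp: n_def\<close>)
      also have "\<dots> \<le> (\<Sum>i\<in>Basis. 1/n * (f x + n * (h \<bullet> i) * d i + e / n * \<bar>n * (h \<bullet> i)\<bar>))"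
      proof (rule sum_mono)
        fix i :: 'a assume i: "i \<in> Basis"
        have "\<bar>f (x + (n * (h \<bullet> i)) *\<^sub>R i) - f x - n * (h \<bullet> i) * d i\<bar> \<le> e / n * \<bar>n * (h \<bullet> i)\<bar>"
          by (rule \<delta>(2)[OF i]) (use nh[OF i] rn(2)[OF i] in linarith)
        then show "1/n * f (x + (n * (h \<bullet> i)) *\<^sub>R i)
            \<le> 1/n * (f x + n * (h \<bullet> i) * d i + e / n * \<bar>n * (h \<bullet> i)\<bar>)"
          using n by (intro mult_left_mono) auto
      qed
      also have "\<dots> = f x + h \<bullet> D + (\<Sum>i\<in>Basis. e / n * \<bar>h \<bullet> i\<bar>)"
      proof -
        have "1/n * (f x + n * (h \<bullet> i) * d i + e / n * \<bar>n * (h \<bullet> i)\<bar>)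
            = 1/n * f x + (h \<bullet> i) * d i + e / n * \<bar>h \<bullet> i\<bar>" for i
          using n by (simp add: field_simps abs_mult)
        then show ?thesis using n by (simp add: sum.distrib hD n_def)
      qed
      also have "(\<Sum>i\<in>Basis. e / n * \<bar>h \<bullet> i\<bar>) \<le> (\<Sum>i\<in>(Basis::'a set). e / n * norm h)"
        using e n by (intro sum_mono mult_left_mono) (auto simp: Basis_le_norm)
      also have "\<dots> = e * norm h" using n by (simp add: n_def)
      finally have "f (x + h) - f x - h \<bullet> D \<le> e * norm h" by simp
      moreover have "r \<le> \<rho>" using rn(1) n1 \<open>r > 0\<close> mult_right_mono[of 1 n r] by linarith
      then have "x + h \<in> S" using \<rho>(2) h by (auto simp: dist_norm subset_iff)
      ultimately show ?thesis by simp
    qed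
    have "norm (f y - f x - (y - x) \<bullet> D) \<le> e * norm (y - x)" if "norm (y - x) < r" for y
    proof -
      define h where "h = y - x"
      have y: "y = x + h" and h: "norm h < r" using that by (auto simp: h_def)
      have u1: "f (x + h) - f x - h \<bullet> D \<le> e * norm h" "x + h \<in> S" using up[OF h] by auto
      have u2: "f (x - h) - f x + h \<bullet> D \<le> e * norm h" "x - h \<in> S" using up[of "-h"] h by auto
      have "(1/2) *\<^sub>R (x + h) + (1/2) *\<^sub>R (x - h) = x"
        by (metis add_diff_cancel_left' diff_add_cancel group_cancel.add1 scaleR_half_double scaleR_add_right)
      moreover have "f ((1/2) *\<^sub>R (x + h) + (1/2) *\<^sub>R (x - h)) \<le> 1/2 * f (x + h) + 1/2 * f (x - h)"
        using convex_onD[OF cv, of "1/2" "x + h" "x - h"] u1(2) u2(2) by simp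
      ultimately have "2 * f x \<le> f (x + h) + f (x - h)" by simp
      then show ?thesis using u1 u2 by (simp add: y abs_le_iff)
    qed
    then show "\<exists>\<delta>>0. \<forall>y. norm (y - x) < \<delta> \<longrightarrow>
        norm (f y - f x - (y - x) \<bullet> D) \<le> e * norm (y - x)"
      using \<open>r > 0\<close> by blast
  qed
  then show ?thesis by (simp add: gderiv_def D_def inner_commute)
qed

section \<open>Almost everywhere differentiability of convex functions\<close>

lemma lborel_integral_shift:
  fixes h :: "'a::euclidean_space \<Rightarrow> real"
  assumes [measurable]: "h \<in> borel_measurable borel"
  shows "(\<integral>x. h (c + x) \<partial>lborel) = (\<integral>x. h x \<partial>lborel)"
proof -
  have "(\<integral>x. h x \<partial>lborel) = (\<integral>x. h x \<partial>distr lborel borel ((+) c))"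
    by (simp add: lborel_distr_plus)
  also have "\<dots> = (\<integral>x. h (c + x) \<partial>lborel)"
    by (subst integral_distr) auto
  finally show ?thesis by simp
qed

text \<open>A convex function bounded by \<open>M\<close> has slope at most
  \<open>2 * M / \<rho>\<close> at distance \<open>\<rho>\<close> from the ends of a segment: the
  upper estimate interpolates between \<open>x\<close> and the far end ahead, the lower one writes
  \<open>x\<close> as a combination of \<open>x + t e\<close> and the far end behind.\<close>

lemma convex_increment_bound:
  fixes f :: "'a::real_vector \<Rightarrow> real"
  assumes cv: "convex_on S f" and S: "x \<in> S" "x + \<rho> *\<^sub>R e \<in> S" "x - \<rho> *\<^sub>R e \<in> S"
    and M: "\<bar>f x\<bar> \<le> M" "\<bar>f (x + \<rho> *\<^sub>R e)\<bar> \<le> M" "\<bar>f (x - \<rho> *\<^sub>R e)\<bar> \<le> M"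
    and t: "0 < t" "t \<le> \<rho>"
  shows "\<bar>f (x + t *\<^sub>R e) - f x\<bar> \<le> 2 * M / \<rho> * t"
proof -
  have \<rho>: "\<rho> > 0" using t by simp
  have "x + t *\<^sub>R e = (1 - t/\<rho>) *\<^sub>R x + (t/\<rho>) *\<^sub>R (x + \<rho> *\<^sub>R e)"
    using \<rho> by (simp add: algebra_simps)
  moreover have "f ((1 - t/\<rho>) *\<^sub>R x + (t/\<rho>) *\<^sub>R (x + \<rho> *\<^sub>R e)) \<le> (1 - t/\<rho>) * f x + t/\<rho> * f (x + \<rho> *\<^sub>R e)"
    by (rule convex_onD[OF cv]) (use S t \<rho> in auto)
  moreover have "(1 - t/\<rho>) *\<^sub>R x + (t/\<rho>) *\<^sub>R (x + \<rho> *\<^sub>R e) \<in> S"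
    by (rule convexD[OF convex_on_imp_convex[OF cv]]) (use S t \<rho> in auto)
  ultimately have tS: "x + t *\<^sub>R e \<in> S"
    and le: "f (x + t *\<^sub>R e) \<le> (1 - t/\<rho>) * f x + t/\<rho> * f (x + \<rho> *\<^sub>R e)" by auto
  have "f (x + t *\<^sub>R e) - f x \<le> t/\<rho> * (f (x + \<rho> *\<^sub>R e) - f x)"
    using le by (simp add: algebra_simps)
  also have "\<dots> \<le> t/\<rho> * (2 * M)" using t \<rho> M by (intro mult_left_mono) auto
  finally have up: "f (x + t *\<^sub>R e) - f x \<le> 2 * M / \<rho> * t" by (simp add: mult_ac)
  \<comment> \<open>The weight for which \<open>(1 - a) (x + t e) + a (x - \<rho> e)\<close> equals
    \<open>x\<close>.\<close>
  define a where "a = t / (\<rho> + t)"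
  have a: "0 \<le> a" "a \<le> 1" "(\<rho> + t) * a = t" using t by (auto simp: a_def)
  have a': "(1 - a) * t = a * \<rho>" using a(3) by (simp add: algebra_simps)
  have "(1 - a) *\<^sub>R (x + t *\<^sub>R e) + a *\<^sub>R (x - \<rho> *\<^sub>R e) = x + ((1 - a) * t - a * \<rho>) *\<^sub>R e"
    by (simp add: algebra_simps)
  then have "(1 - a) *\<^sub>R (x + t *\<^sub>R e) + a *\<^sub>R (x - \<rho> *\<^sub>R e) = x" using a' by simp
  moreover have "f ((1 - a) *\<^sub>R (x + t *\<^sub>R e) + a *\<^sub>R (x - \<rho> *\<^sub>R e))
      \<le> (1 - a) * f (x + t *\<^sub>R e) + a * f (x - \<rho> *\<^sub>R e)"
    by (rule convex_onD[OF cv]) (use S a tS in auto)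
  ultimately have "f x \<le> (1 - a) * f (x + t *\<^sub>R e) + a * f (x - \<rho> *\<^sub>R e)" by simp
  then have "(\<rho> + t) * f x \<le> (\<rho> + t) * ((1 - a) * f (x + t *\<^sub>R e) + a * f (x - \<rho> *\<^sub>R e))"
    using t by (intro mult_left_mono) auto
  also have "\<dots> = (\<rho> + t - (\<rho> + t) * a) * f (x + t *\<^sub>R e) + ((\<rho> + t) * a) * f (x - \<rho> *\<^sub>R e)"
    by (simp add: algebra_simps)
  also have "\<dots> = \<rho> * f (x + t *\<^sub>R e) + t * f (x - \<rho> *\<^sub>R e)" unfolding a(3) by simp
  finally have "\<rho> * (f x - f (x + t *\<^sub>R e)) \<le> t * (f (x - \<rho> *\<^sub>R e) - f x)"
    by (simp add: algebra_simps)
  also have "\<dots> \<le> t * (2 * M)" using t M by (intro mult_left_mono) auto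
  finally have "f x - f (x + t *\<^sub>R e) \<le> 2 * M / \<rho> * t"
    using \<rho> by (simp add: pos_le_divide_eq mult_ac)
  with up show ?thesis by linarith
qed

text \<open>The second difference divided by \<open>t\<close> is
  \<open>d t x = q t x - q t (x - t e)\<close>, nonnegative by convexity. Translating the second
  term shows that the integrals of both terms over the box cancel except on two slabs of thickness
  \<open>t\<close>; as the quotients are bounded by \<open>L\<close>, the integral of
  \<open>d t\<close> is of order \<open>t\<close>. A set on which \<open>d t\<close> stays above
  \<open>\<epsilon>\<close> for arbitrarily small \<open>t\<close> is then null by Markov's
  inequality.\<close>

lemma second_difference_AE_small:
  fixes f :: "'a::euclidean_space \<Rightarrow> real"
  assumes [measurable]: "f \<in> borel_measurable borel"
    and cv: "convex_on S f" and "open S" and sub: "cbox a b \<subseteq> S"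
    and ab: "\<And>i. i \<in> Basis \<Longrightarrow> a \<bullet> i < b \<bullet> i" and e: "e \<in> Basis"
  shows "AE x in lborel. x \<in> cbox a b \<longrightarrow> (\<forall>\<epsilon>>0. \<exists>t>0. x + t *\<^sub>R e \<in> S \<and> x - t *\<^sub>R e \<in> S \<and>
        f (x + t *\<^sub>R e) + f (x - t *\<^sub>R e) - 2 * f x < \<epsilon> * t)"
proof -
  obtain r where r: "r > 0" "(\<Union>x\<in>cbox a b. cball x r) \<subseteq> S"
    using compact_subset_open_imp_cball_epsilon_subset[OF compact_cbox \<open>open S\<close> sub] by blast
  \<comment> \<open>A shift by up to \<open>\<rho>\<close> followed by a step of length
    \<open>\<rho>\<close> must stay within distance \<open>r\<close> of the box, hence
    \<open>r / 2\<close>; the second entry keeps the box shortened by \<open>t\<close> along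
    \<open>e\<close> nonempty.\<close>
  define \<rho> where "\<rho> = min (r / 2) (b \<bullet> e - a \<bullet> e)"
  have \<rho>: "\<rho> > 0" "\<rho> \<le> b \<bullet> e - a \<bullet> e" "2 * \<rho> \<le> r"
    using r ab[OF e] by (auto simp: \<rho>_def min_def)
  define K where "K = {x + y |x y. x \<in> cbox a b \<and> y \<in> cball 0 r}"
  have K: "compact K" unfolding K_def by (intro compact_sums) auto
  have KS: "K \<subseteq> S"
  proof
    fix z assume "z \<in> K"
    then obtain x y where "x \<in> cbox a b" "norm y \<le> r" "z = x + y" by (auto simp: K_def)
    then have "x \<in> cbox a b" "z \<in> cball x r" by (auto simp: dist_norm)
    then show "z \<in> S" using r(2) by blast
  qed
  have inK: "x + s *\<^sub>R e \<in> K" if "x \<in> cbox a b" "\<bar>s\<bar> \<le> r" for x s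
    unfolding K_def using that e by (intro CollectI exI[of _ x] exI[of _ "s *\<^sub>R e"]) auto
  have "continuous_on K f"
    using convex_on_continuous[OF \<open>open S\<close> cv] KS continuous_on_subset by blast
  then have "bounded (f ` K)" using K compact_continuous_image compact_imp_bounded by blast
  then obtain M where M: "\<And>x. x \<in> K \<Longrightarrow> \<bar>f x\<bar> \<le> M" by (auto simp: bounded_iff)
  define L where "L = 2 * M / \<rho>"
  define q where "q t x = (f (x + t *\<^sub>R e) - f x) / t" for t x
  define d where "d t x = q t x - q t (x - t *\<^sub>R e)" for t x
  have d_eq: "d t x * t = f (x + t *\<^sub>R e) + f (x - t *\<^sub>R e) - 2 * f x" if "t > 0" for t x
    using that by (simp add: d_def q_def field_simps)
  have [measurable]: "q t \<in> borel_measurable borel" for t unfolding q_def by measurable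
  have [measurable]: "d t \<in> borel_measurable borel" for t unfolding d_def by measurable
  have q_bound: "\<bar>q t (x + s *\<^sub>R e)\<bar> \<le> L" if "x \<in> cbox a b" "0 < t" "t \<le> \<rho>" "\<bar>s\<bar> \<le> \<rho>" for x s t
  proof -
    have mem: "x + s *\<^sub>R e \<in> K" "x + s *\<^sub>R e + \<rho> *\<^sub>R e \<in> K" "x + s *\<^sub>R e - \<rho> *\<^sub>R e \<in> K"
      using inK[OF that(1), of s] inK[OF that(1), of "s + \<rho>"] inK[OF that(1), of "s - \<rho>"] \<rho> that
      by (auto simp: algebra_simps)
    have "\<bar>f (x + s *\<^sub>R e + t *\<^sub>R e) - f (x + s *\<^sub>R e)\<bar> \<le> 2 * M / \<rho> * t"
      by (rule convex_increment_bound[OF cv]) (use mem KS M that in auto)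
    then show ?thesis using that by (simp add: q_def L_def abs_divide pos_divide_le_eq)
  qed
  have d_nonneg: "d t x \<ge> 0" if "x \<in> cbox a b" "0 < t" "t \<le> \<rho>" for x t
  proof -
    have "x + t *\<^sub>R e \<in> S" "x - t *\<^sub>R e \<in> S"
      using inK[OF that(1), of t] inK[OF that(1), of "-t"] KS that \<rho> by auto
    then have "f ((1 - 1/2) *\<^sub>R (x + t *\<^sub>R e) + (1/2) *\<^sub>R (x - t *\<^sub>R e))
        \<le> (1 - 1/2) * f (x + t *\<^sub>R e) + 1/2 * f (x - t *\<^sub>R e)"
      by (intro convex_onD[OF cv]) auto
    moreover have "(1 - 1/2) *\<^sub>R (x + t *\<^sub>R e) + (1/2) *\<^sub>R (x - t *\<^sub>R e) = x"
      by (simp add: algebra_simps flip: scaleR_add_left)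
    ultimately have "0 \<le> d t x * t" unfolding d_eq[OF that(2)] by simp
    then show ?thesis using that by (simp add: zero_le_mult_iff)
  qed
  \<comment> \<open>The area of the cross-section of the box orthogonal to \<open>e\<close>.\<close>
  define R where "R = (\<Prod>i\<in>Basis - {e}. b \<bullet> i - a \<bullet> i)"
  have key: "(\<integral>x. indicator (cbox a b) x * d t x \<partial>lborel) \<le> 2 * L * R * t" if t: "0 < t" "t \<le> \<rho>" for t
  proof -
    define B where "B = cbox a b"
    define B' where "B' = cbox (a - t *\<^sub>R e) (b - t *\<^sub>R e)"
    define C where "C = cbox a (b - t *\<^sub>R e)"
    have B'_iff: "x \<in> B' \<longleftrightarrow> x + t *\<^sub>R e \<in> B" for x
      by (auto simp: B_def B'_def mem_box algebra_simps)
    have C: "C \<subseteq> B \<inter> B'"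
    proof
      fix x assume "x \<in> C"
      then have x: "a \<bullet> i \<le> x \<bullet> i" "x \<bullet> i \<le> b \<bullet> i - (if i = e then t else 0)" if "i \<in> Basis" for i
        using e that by (auto simp: C_def mem_box inner_diff_left inner_Basis)
      have "a \<bullet> i \<le> x \<bullet> i \<and> x \<bullet> i \<le> b \<bullet> i \<and>
          a \<bullet> i - (if i = e then t else 0) \<le> x \<bullet> i" if "i \<in> Basis" for i
        using x[OF that] t by (simp split: if_splits)
      moreover have "a \<bullet> e - t \<le> x \<bullet> e" "x \<bullet> e \<le> b \<bullet> e - t"
        using x[OF e] t by auto
      ultimately show "x \<in> B \<inter> B'"
        using x e by (auto simp: B_def B'_def mem_box inner_diff_left inner_Basis)
    qed
    have [measurable]: "B \<in> sets borel" "B' \<in> sets borel" "C \<in> sets borel"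
      by (auto simp: B_def B'_def C_def)
    have fin: "emeasure lborel B < \<infinity>" "emeasure lborel B' < \<infinity>" "emeasure lborel C < \<infinity>"
      unfolding B_def B'_def C_def by (rule emeasure_lborel_cbox_finite)+
    have qB: "\<bar>q t x\<bar> \<le> L" if "x \<in> B" for x
      using q_bound[of x t 0] that t \<rho> by (auto simp: B_def)
    have qB': "\<bar>q t x\<bar> \<le> L" if "x \<in> B'" for x
      using q_bound[of "x + t *\<^sub>R e" t "-t"] that t by (auto simp: B_def B'_iff)
    have i1: "integrable lborel (\<lambda>x. indicator B x * q t x)"
      by (rule integrableI_bounded_set[where A=B and B=L]) (use fin qB in \<open>auto simp: indicator_def\<close>)
    have i2: "integrable lborel (\<lambda>x. indicator B' x * q t x)"
      by (rule integrableI_bounded_set[where A=B' and B=L]) (use fin qB' in \<open>auto simp: indicator_def\<close>)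
    have i3: "integrable lborel (\<lambda>x. indicator B x * q t (x - t *\<^sub>R e))"
      by (rule integrableI_bounded_set[where A=B and B=L])
        (use fin qB' in \<open>auto simp: indicator_def B'_iff\<close>)
    have shift: "(\<integral>x. indicator B x * q t (x - t *\<^sub>R e) \<partial>lborel) = (\<integral>x. indicator B' x * q t x \<partial>lborel)"
    proof -
      have "(\<integral>x. indicator B x * q t (x - t *\<^sub>R e) \<partial>lborel)
          = (\<integral>x. indicator B (t *\<^sub>R e + x) * q t (t *\<^sub>R e + x - t *\<^sub>R e) \<partial>lborel)"
        by (rule lborel_integral_shift[symmetric]) measurable
      also have "\<dots> = (\<integral>x. indicator B' x * q t x \<partial>lborel)"
        by (intro Bochner_Integration.integral_cong) (auto simp: B'_iff indicator_def add.commute)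
      finally show ?thesis .
    qed
    have "(\<integral>x. indicator B x * d t x \<partial>lborel)
        = (\<integral>x. indicator B x * q t x - indicator B x * q t (x - t *\<^sub>R e) \<partial>lborel)"
      by (simp add: d_def algebra_simps)
    also have "\<dots> = (\<integral>x. indicator B x * q t x - indicator B' x * q t x \<partial>lborel)"
      using i1 i2 i3 by (simp add: shift)
    \<comment> \<open>On \<open>C\<close>, which lies in both boxes, the two terms cancel; elsewhere
      each is at most \<open>L\<close> in absolute value. What remains is the volume of the two
      slabs left uncovered by \<open>C\<close>.\<close>
    also have "\<dots> \<le> (\<integral>x. L * indicator B x + L * indicator B' x - 2 * L * indicator C x \<partial>lborel)"
    proof (rule integral_mono)
      show "integrable lborel (\<lambda>x. indicator B x * q t x - indicator B' x * q t x)"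
        using i1 i2 by auto
      show "integrable lborel (\<lambda>x. L * indicator B x + L * indicator B' x - 2 * L * indicator C x)"
        using fin by (intro Bochner_Integration.integrable_add Bochner_Integration.integrable_diff
            integrable_mult_right integrable_real_indicator) auto
      have "L \<ge> 0" using qB[of a] ab by (force simp: B_def mem_box less_imp_le)
      then show "indicator B x * q t x - indicator B' x * q t x
          \<le> L * indicator B x + L * indicator B' x - 2 * L * indicator C x" for x
        using C qB[of x] qB'[of x] by (auto simp: indicator_def)
    qed
    also have "\<dots> = L * measure lborel B + L * measure lborel B' - 2 * L * measure lborel C"
      using fin by (simp add: less_top)
    also have "\<dots> = 2 * L * R * t"
    proof -
      have "measure lborel B = (\<Prod>i\<in>Basis. b \<bullet> i - a \<bullet> i)"
        using ab unfolding B_def by (intro content_cbox) (auto intro: less_imp_le)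
      moreover have "measure lborel B' = (\<Prod>i\<in>Basis. b \<bullet> i - a \<bullet> i)"
        using ab unfolding B'_def by (subst content_cbox) (auto intro: less_imp_le simp: inner_diff_left)
      moreover have "(\<Prod>i\<in>Basis. b \<bullet> i - a \<bullet> i) = (b \<bullet> e - a \<bullet> e) * R"
        using e by (simp add: R_def prod.remove)
      moreover have "measure lborel C = (b \<bullet> e - t - a \<bullet> e) * R"
      proof -
        have "measure lborel C = (\<Prod>i\<in>Basis. (b - t *\<^sub>R e) \<bullet> i - a \<bullet> i)"
          unfolding C_def using ab e t \<rho>
          by (intro content_cbox) (auto simp: inner_diff_left inner_Basis less_imp_le)
        also have "\<dots> = ((b - t *\<^sub>R e) \<bullet> e - a \<bullet> e) * (\<Prod>i\<in>Basis - {e}. (b - t *\<^sub>R e) \<bullet> i - a \<bullet> i)"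
          using e by (simp add: prod.remove)
        also have "(\<Prod>i\<in>Basis - {e}. (b - t *\<^sub>R e) \<bullet> i - a \<bullet> i) = R"
          unfolding R_def using e by (intro prod.cong) (auto simp: inner_diff_left inner_Basis)
        finally show ?thesis using e by (simp add: inner_diff_left)
      qed
      ultimately have "measure lborel B = (b \<bullet> e - a \<bullet> e) * R" "measure lborel B' = (b \<bullet> e - a \<bullet> e) * R"
        "measure lborel C = (b \<bullet> e - t - a \<bullet> e) * R" by auto
      then show ?thesis by (simp only:) (simp add: algebra_simps)
    qed
    finally show ?thesis by (simp add: B_def)
  qed
  \<comment> \<open>Countably many steps tending to 0 suffice and keep the exceptional sets
    \<open>E\<close> measurable.\<close>
  define t where "t k = \<rho> / real (Suc k)" for k
  have t: "t k > 0" "t k \<le> \<rho>" for k using \<rho> by (auto simp: t_def field_simps)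
  define E where "E \<epsilon> = {x \<in> cbox a b. \<forall>k. d (t k) x \<ge> \<epsilon>}" for \<epsilon>
  have E_null: "E \<epsilon> \<in> null_sets lborel" if "\<epsilon> > 0" for \<epsilon>
  proof -
    have "E \<epsilon> = cbox a b \<inter> {x \<in> space borel. \<forall>k. d (t k) x \<ge> \<epsilon>}" by (auto simp: E_def)
    also have "\<dots> \<in> sets borel" by measurable
    finally have [measurable]: "E \<epsilon> \<in> sets borel" .
    have EB: "E \<epsilon> \<subseteq> cbox a b" by (auto simp: E_def)
    have fin: "emeasure lborel (E \<epsilon>) < \<infinity>"
      using emeasure_mono[OF EB, of lborel] emeasure_lborel_cbox_finite[of a b] by (simp add: order_le_less_trans)
    have "\<epsilon> * measure lborel (E \<epsilon>) \<le> 2 * L * R * t k" for k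
    proof -
      have "\<epsilon> * measure lborel (E \<epsilon>) = (\<integral>x. \<epsilon> * indicator (E \<epsilon>) x \<partial>lborel)"
        using fin by (simp add: less_top)
      also have "\<dots> \<le> (\<integral>x. indicator (cbox a b) x * d (t k) x \<partial>lborel)"
      proof (rule integral_mono)
        show "integrable lborel (\<lambda>x. \<epsilon> * indicator (E \<epsilon>) x)"
          using fin by (intro integrable_mult_right integrable_real_indicator) auto
        have "\<bar>d (t k) x\<bar> \<le> 2 * L" if "x \<in> cbox a b" for x
          using q_bound[of x "t k" 0] q_bound[of x "t k" "- t k"] that t[of k] \<rho>
          by (auto simp: d_def)
        then show "integrable lborel (\<lambda>x. indicator (cbox a b) x * d (t k) x)"
          by (intro integrableI_bounded_set[where A="cbox a b" and B="2 * L"])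
              (auto simp: indicator_def emeasure_lborel_cbox_finite simp flip: infinity_ennreal_def)
        show "\<epsilon> * indicator (E \<epsilon>) x \<le> indicator (cbox a b) x * d (t k) x" for x
          using d_nonneg[of x "t k"] t by (auto simp: indicator_def E_def)
      qed
      also have "\<dots> \<le> 2 * L * R * t k" by (rule key[OF t])
      finally show ?thesis .
    qed
    moreover have "(\<lambda>k. 2 * L * R * t k) \<longlonglongrightarrow> 0"
    proof -
      have "(\<lambda>k. 2 * L * R * (\<rho> * inverse (real (Suc k)))) \<longlonglongrightarrow> 2 * L * R * (\<rho> * 0)"
        by (intro tendsto_intros LIMSEQ_inverse_real_of_nat)
      then show ?thesis by (simp add: t_def divide_inverse)
    qed
    ultimately have "\<epsilon> * measure lborel (E \<epsilon>) \<le> 0"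
      by (intro LIMSEQ_le_const) auto
    then have "measure lborel (E \<epsilon>) = 0"
      using that by (simp add: mult_le_0_iff order_antisym)
    then have "emeasure lborel (E \<epsilon>) = 0"
      using fin by (simp add: emeasure_eq_ennreal_measure less_top)
    then show ?thesis by (auto simp: null_sets_def)
  qed
  have "AE x in lborel. \<forall>m. x \<notin> E (inverse (real (Suc m)))"
    unfolding AE_all_countable by (intro allI AE_not_in E_null) auto
  then show ?thesis
  proof eventually_elim
    fix x assume nE: "\<forall>m. x \<notin> E (inverse (real (Suc m)))"
    show "x \<in> cbox a b \<longrightarrow> (\<forall>\<epsilon>>0. \<exists>t>0. x + t *\<^sub>R e \<in> S \<and> x - t *\<^sub>R e \<in> S \<and>
        f (x + t *\<^sub>R e) + f (x - t *\<^sub>R e) - 2 * f x < \<epsilon> * t)"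
    proof (intro impI allI)
      fix \<epsilon> :: real assume x: "x \<in> cbox a b" and "\<epsilon> > 0"
      then obtain m where m: "inverse (real (Suc m)) < \<epsilon>" using reals_Archimedean by blast
      obtain k where "d (t k) x < inverse (real (Suc m))"
        using nE x by (auto simp: E_def not_le)
      then have "d (t k) x * t k < \<epsilon> * t k" using m t[of k] by (intro mult_strict_right_mono) auto
      then have "f (x + t k *\<^sub>R e) + f (x - t k *\<^sub>R e) - 2 * f x < \<epsilon> * t k"
        using d_eq t by simp
      moreover have "x + t k *\<^sub>R e \<in> S" "x - t k *\<^sub>R e \<in> S"
        using inK[OF x, of "t k"] inK[OF x, of "- t k"] KS t[of k] \<rho> by auto
      ultimately show "\<exists>t>0. x + t *\<^sub>R e \<in> S \<and> x - t *\<^sub>R e \<in> S \<and>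
        f (x + t *\<^sub>R e) + f (x - t *\<^sub>R e) - 2 * f x < \<epsilon> * t"
        using t by blast
    qed
  qed
qed

text \<open>On one box the finitely many axes contribute finitely many null sets, off which all
  partial derivatives exist. By Lindelof, countably many open boxes with closures inside
  \<open>S\<close> cover \<open>S\<close>, so the exceptional set stays null.\<close>

lemma convex_AE_gderiv:
  fixes f :: "'a::euclidean_space \<Rightarrow> real"
  assumes f: "f \<in> borel_measurable borel" and cv: "convex_on S f" and "open S"
  shows "AE x in lborel. x \<in> S \<longrightarrow> (\<exists>D. GDERIV f x :> D)"
proof -
  have box: "AE x in lborel. x \<in> cbox a b \<longrightarrow> (\<exists>D. GDERIV f x :> D)"
    if ab: "cbox a b \<subseteq> S" "\<forall>i\<in>Basis. a \<bullet> i < b \<bullet> i" for a b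
  proof -
    have "AE x in lborel. \<forall>e\<in>Basis. x \<in> cbox a b \<longrightarrow> (\<forall>\<epsilon>>0. \<exists>t>0. x + t *\<^sub>R e \<in> S \<and> x - t *\<^sub>R e \<in> S \<and>
        f (x + t *\<^sub>R e) + f (x - t *\<^sub>R e) - 2 * f x < \<epsilon> * t)"
      by (intro AE_finite_allI second_difference_AE_small assms) (use that in auto)
    then show ?thesis
    proof eventually_elim
      case (elim x)
      show ?case
      proof
        assume x: "x \<in> cbox a b"
        have "\<exists>d. ((\<lambda>t. f (x + t *\<^sub>R e)) has_real_derivative d) (at 0)" if "e \<in> Basis" for e
          by (rule convex_second_difference_imp_deriv[OF cv \<open>open S\<close>]) (use that elim x ab in auto)
        then obtain d where "\<And>e. e \<in> Basis \<Longrightarrow> ((\<lambda>t. f (x + t *\<^sub>R e)) has_real_derivative d e) (at 0)"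
          by metis
        then show "\<exists>D. GDERIV f x :> D"
          using convex_partials_imp_gderiv[OF cv \<open>open S\<close>] ab x by blast
      qed
    qed
  qed
  define \<F> where "\<F> = {box a b |a b. cbox a b \<subseteq> S \<and> (\<forall>i\<in>Basis. a \<bullet> i < b \<bullet> i)}"
  obtain \<G> where \<G>: "\<G> \<subseteq> \<F>" "countable \<G>" "\<Union>\<G> = \<Union>\<F>"
    by (rule Lindelof[of \<F>]) (auto simp: \<F>_def)
  have "AE x in lborel. \<forall>U\<in>\<G>. x \<in> U \<longrightarrow> (\<exists>D. GDERIV f x :> D)"
  proof (rule AE_ball_countable'[OF _ \<G>(2)])
    fix U assume "U \<in> \<G>"
    then obtain a b where ab: "U = box a b" "cbox a b \<subseteq> S" "\<forall>i\<in>Basis. a \<bullet> i < b \<bullet> i"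
      using \<G>(1) by (auto simp: \<F>_def)
    show "AE x in lborel. x \<in> U \<longrightarrow> (\<exists>D. GDERIV f x :> D)"
      using box[OF ab(2,3)] by eventually_elim (use ab(1) box_subset_cbox in auto)
  qed
  then show ?thesis
  proof eventually_elim
    case (elim x)
    show ?case
    proof
      assume "x \<in> S"
      then obtain a b where "cbox a b \<subseteq> S" "x \<in> box a b" "\<forall>i\<in>Basis. a \<bullet> i < b \<bullet> i"
        using open_contains_cbox[OF \<open>open S\<close>] by blast
      then have "x \<in> \<Union>\<F>" by (auto simp: \<F>_def)
      then show "\<exists>D. GDERIV f x :> D" using elim \<G>(3) by blast
    qed
  qed
qed

section \<open>Gradients of extended-valued convex functions\<close>

lemma has_egrad_unique: "has_egrad u x D \<Longrightarrow> has_egrad u x D' \<Longrightarrow> D = D'"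
  unfolding has_egrad_def gderiv_def
  by (metis has_derivative_unique inner_commute vector_eq_ldot)

lemma egrad_eq: "has_egrad u x D \<Longrightarrow> egrad u x = D"
  unfolding egrad_def using has_egrad_unique by blast

lemma AE_notin_frontier_convex:
  fixes S :: "'a::euclidean_space set"
  assumes "convex S"
  shows "AE x in lebesgue. x \<notin> frontier S"
  using negligible_convex_frontier[OF assms] by (intro AE_not_in) (simp add: negligible_iff_null_sets)

text \<open>The frontier of a convex set is null, so almost every point of the domain is interior,
  where differentiability almost everywhere applies. From here on \<open>egrad\<close> denotes a
  genuine gradient at almost every point of the domain.\<close>

lemma AE_has_egrad:
  fixes u :: "'a::euclidean_space \<Rightarrow> ereal"
  assumes "u \<in> Conv"
  shows "AE x in lebesgue. x \<in> eff_dom u \<longrightarrow> has_egrad u x (egrad u x)"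
proof -
  have "convex_on (interior (eff_dom u)) (rpart u)"
    using convex_on_rpart[OF assms] convex_eff_dom[OF assms]
    by (intro convex_on_subset[OF convex_on_rpart[OF assms]]) (auto simp: interior_subset convex_interior)
  then have "AE x in lebesgue. x \<in> interior (eff_dom u) \<longrightarrow> (\<exists>D. GDERIV (rpart u) x :> D)"
    by (intro AE_completion convex_AE_gderiv borel_measurable_rpart assms) auto
  moreover have "AE x in lebesgue. x \<notin> frontier (eff_dom u)"
    by (intro AE_notin_frontier_convex convex_eff_dom assms)
  ultimately show ?thesis
  proof eventually_elim
    case (elim x)
    show ?case
    proof
      assume "x \<in> eff_dom u"
      then have "x \<in> interior (eff_dom u)"
        using elim(2) closure_subset by (auto simp: frontier_def)
      then obtain D where "has_egrad u x D" using elim(1) by (auto simp: has_egrad_def)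
      then show "has_egrad u x (egrad u x)" using egrad_eq by metis
    qed
  qed
qed

lemma has_egrad_directional:
  assumes "has_egrad u x D"
  shows "((\<lambda>t. (rpart u (x + t *\<^sub>R h) - rpart u x) / t) \<longlongrightarrow> D \<bullet> h) (at 0)"
proof -
  have "(rpart u has_derivative (\<lambda>h. h \<bullet> D)) (at (x + 0 *\<^sub>R h))"
    using assms by (simp add: has_egrad_def gderiv_def inner_commute)
  moreover have "((\<lambda>t. x + t *\<^sub>R h) has_derivative (\<lambda>t. t *\<^sub>R h)) (at 0)"
    by (auto intro!: derivative_eq_intros)
  ultimately have "((\<lambda>t. rpart u (x + t *\<^sub>R h)) has_derivative (\<lambda>t. (t *\<^sub>R h) \<bullet> D)) (at 0)"
    by (rule has_derivative_compose[rotated])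
  then have "((\<lambda>t. rpart u (x + t *\<^sub>R h)) has_real_derivative (D \<bullet> h)) (at 0)"
    by (simp add: has_field_derivative_def mult_commute_abs inner_commute)
  then show ?thesis by (simp add: DERIV_def)
qed

lemma has_egrad_directional_right:
  assumes "has_egrad u x D"
  shows "((\<lambda>t. (rpart u (x + t *\<^sub>R h) - rpart u x) / t) \<longlongrightarrow> D \<bullet> h) (at_right 0)"
  using has_egrad_directional[OF assms] by (rule tendsto_mono[rotated]) (simp add: at_within_le_nhds at_le)

text \<open>Convexity bounds the difference quotient towards \<open>y\<close> by the full increment,
  and the quotient tends to the directional derivative. This inequality is the only global
  consequence of differentiability used in the epi-convergence arguments.\<close>

lemma has_egrad_subgradient:
  assumes u: "u \<in> Conv" and D: "has_egrad u x D" and y: "y \<in> eff_dom u"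
  shows "rpart u x + D \<bullet> (y - x) \<le> rpart u y"
proof -
  have x: "x \<in> eff_dom u" using D interior_subset by (auto simp: has_egrad_def)
  have "((\<lambda>t. (rpart u (x + t *\<^sub>R (y - x)) - rpart u x) / t) \<longlongrightarrow> D \<bullet> (y - x)) (at_right 0)"
    by (rule has_egrad_directional_right[OF D])
  moreover have "\<forall>\<^sub>F t in at_right 0. (rpart u (x + t *\<^sub>R (y - x)) - rpart u x) / t \<le> rpart u y - rpart u x"
    unfolding eventually_at_right_field
  proof (intro exI[of _ 1] conjI allI impI)
    fix t :: real assume t: "0 < t" "t < 1"
    have "rpart u ((1 - t) *\<^sub>R x + t *\<^sub>R y) \<le> (1 - t) * rpart u x + t * rpart u y"
      using t x y by (intro convex_onD[OF convex_on_rpart[OF u]]) auto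
    moreover have "(1 - t) *\<^sub>R x + t *\<^sub>R y = x + t *\<^sub>R (y - x)" by (simp add: algebra_simps)
    ultimately have "rpart u (x + t *\<^sub>R (y - x)) - rpart u x \<le> (rpart u y - rpart u x) * t"
      by (simp add: algebra_simps)
    then show "(rpart u (x + t *\<^sub>R (y - x)) - rpart u x) / t \<le> rpart u y - rpart u x"
      using t by (simp add: pos_divide_le_eq)
  qed auto
  ultimately have "D \<bullet> (y - x) \<le> rpart u y - rpart u x"
    by (rule tendsto_upperbound) auto
  then show ?thesis by simp
qed

text \<open>The gradient is, almost everywhere on the domain, the limit of Borel difference
  quotients along the axes. The function given by \<open>lim\<close> is measurable whether or not
  the limit exists, and completeness of \<open>lebesgue\<close> absorbs the null set on which it
  differs.\<close>

lemma borel_measurable_egrad: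
  fixes u :: "'a::euclidean_space \<Rightarrow> ereal" and \<zeta> :: "'a \<Rightarrow> real"
  assumes u: "u \<in> Conv" and z: "continuous_on UNIV \<zeta>"
  shows "(\<lambda>x. indicator (eff_dom u) x * \<zeta> (egrad u x)) \<in> borel_measurable lebesgue"
proof -
  note [measurable] = borel_measurable_rpart[OF u]
  have [measurable]: "\<zeta> \<in> borel_measurable borel"
    using z by (rule borel_measurable_continuous_onI)
  define s where "s k = inverse (real (Suc k))" for k
  define G where "G k x = (\<Sum>i\<in>Basis. ((rpart u (x + s k *\<^sub>R i) - rpart u x) / s k) *\<^sub>R i)" for k x
  define h where "h k x = indicator (eff_dom u) x * \<zeta> (G k x)" for k x
  have [measurable]: "G k \<in> borel_measurable borel" for k unfolding G_def by measurable
  have [measurable]: "h k \<in> borel_measurable borel" for k unfolding h_def by measurable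
  have "(\<lambda>x. lim (\<lambda>k. h k x)) \<in> borel_measurable borel" by measurable
  then have m: "(\<lambda>x. lim (\<lambda>k. h k x)) \<in> borel_measurable lebesgue"
    by (intro measurable_completion) simp
  have s: "filterlim s (at 0) sequentially"
    unfolding filterlim_at s_def using LIMSEQ_inverse_real_of_nat by auto
  have "AE x in lebesgue. lim (\<lambda>k. h k x) = indicator (eff_dom u) x * \<zeta> (egrad u x)"
    using AE_has_egrad[OF u]
  proof eventually_elim
    case (elim x)
    show ?case
    proof (cases "x \<in> eff_dom u")
      case True
      with elim have D: "has_egrad u x (egrad u x)" by simp
      have "(\<lambda>k. (rpart u (x + s k *\<^sub>R i) - rpart u x) / s k) \<longlonglongrightarrow> egrad u x \<bullet> i" for i
        using filterlim_compose[OF has_egrad_directional[OF D] s] by simp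
      then have "(\<lambda>k. G k x) \<longlonglongrightarrow> (\<Sum>i\<in>Basis. (egrad u x \<bullet> i) *\<^sub>R i)"
        unfolding G_def by (intro tendsto_intros) auto
      then have G: "(\<lambda>k. G k x) \<longlonglongrightarrow> egrad u x" by (simp add: euclidean_representation)
      have "isCont \<zeta> (egrad u x)" using z by (simp add: continuous_on_eq_continuous_at)
      then have "(\<lambda>k. \<zeta> (G k x)) \<longlonglongrightarrow> \<zeta> (egrad u x)"
        using G isCont_tendsto_compose by blast
      then have "(\<lambda>k. h k x) \<longlonglongrightarrow> indicator (eff_dom u) x * \<zeta> (egrad u x)"
        unfolding h_def by (intro tendsto_intros)
      then show ?thesis by (rule limI)
    qed (auto simp: h_def)
  qed
  with m show ?thesis by (rule borel_measurable_AE)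
qed

section \<open>Epi-convergence and gradients\<close>

lemma epi_converges_subseq:
  fixes u :: "'a::euclidean_space \<Rightarrow> ereal"
  assumes "epi_converges us u" "strict_mono (r :: nat \<Rightarrow> nat)"
  shows "epi_converges (\<lambda>j. us (r j)) u"
  unfolding epi_converges_def
proof (intro allI conjI impI)
  fix x :: 'a and s assume s: "s \<longlonglongrightarrow> x"
  \<comment> \<open>To test the subsequence with \<open>s\<close>, indices missed by
    \<open>r\<close> are filled with the limit \<open>x\<close>; the full sequence still converges
    to \<open>x\<close>.\<close>
  define w where "w k = (if k \<in> range r then s (inv r k) else x)" for k
  have inj: "inj r" using assms(2) by (rule strict_mono_imp_inj_on)
  have wr: "w (r j) = s j" for j using inj by (simp add: w_def)
  have "w \<longlonglongrightarrow> x"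
  proof (rule topological_tendstoI)
    fix U assume "open U" "x \<in> U"
    then obtain J where J: "\<And>j. j \<ge> J \<Longrightarrow> s j \<in> U"
      using topological_tendstoD[OF s] by (auto simp: eventually_sequentially)
    have "w k \<in> U" if "k \<ge> r J" for k
    proof (cases "k \<in> range r")
      case True
      then obtain j where j: "k = r j" by auto
      then have "j \<ge> J" using that strict_mono_less_eq[OF assms(2)] by simp
      then show ?thesis using J j wr by simp
    qed (use \<open>x \<in> U\<close> in \<open>simp add: w_def\<close>)
    then show "\<forall>\<^sub>F k in sequentially. w k \<in> U" by (auto simp: eventually_sequentially)
  qed
  then have "u x \<le> liminf (\<lambda>k. us k (w k))" using assms(1) by (auto simp: epi_converges_def)
  also have "\<dots> \<le> liminf ((\<lambda>k. us k (w k)) \<circ> r)" by (rule liminf_subseq_mono[OF assms(2)])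
  finally show "u x \<le> liminf (\<lambda>j. us (r j) (s j))" by (simp add: o_def wr)
next
  fix x :: 'a
  obtain s where s: "s \<longlonglongrightarrow> x" "(\<lambda>k. us k (s k)) \<longlonglongrightarrow> u x"
    using assms(1) by (auto simp: epi_converges_def)
  show "\<exists>s. s \<longlonglongrightarrow> x \<and> (\<lambda>k. us (r k) (s k)) \<longlonglongrightarrow> u x"
    using LIMSEQ_subseq_LIMSEQ[OF s(1) assms(2)] LIMSEQ_subseq_LIMSEQ[OF s(2) assms(2)]
    by (intro exI[of _ "s \<circ> r"]) (simp add: o_def)
qed

lemma epi_converges_liminf: "epi_converges us u \<Longrightarrow> s \<longlonglongrightarrow> x \<Longrightarrow> u x \<le> liminf (\<lambda>k. us k (s k))"
  by (auto simp: epi_converges_def)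

lemma epi_converges_const:
  assumes "u \<in> Conv"
  shows "epi_converges (\<lambda>_. u) u"
  unfolding epi_converges_def
proof (intro allI conjI impI)
  fix x and s :: "nat \<Rightarrow> 'a" assume s: "s \<longlonglongrightarrow> x"
  show "u x \<le> liminf (\<lambda>k. u (s k))"
    unfolding le_Liminf_iff
  proof (intro allI impI)
    fix c assume "c < u x"
    then have "\<forall>\<^sub>F y in nhds x. c < u y"
      using ConvD(3)[OF assms] by (auto simp: lower_semicont_iff)
    then show "\<forall>\<^sub>F k in sequentially. c < u (s k)"
      using s unfolding filterlim_iff by blast
  qed
qed (auto intro!: exI[of _ "\<lambda>_. x" for x])

lemma not_eventually_subseq:
  assumes "\<not> (\<forall>\<^sub>F k in sequentially. P k)"
  shows "\<exists>r :: nat \<Rightarrow> nat. strict_mono r \<and> (\<forall>j. \<not> P (r j))"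
proof -
  have inf: "infinite {k. \<not> P k}"
    using assms by (simp add: eventually_sequentially infinite_nat_iff_unbounded_le)
  show ?thesis
    using strict_mono_enumerate[OF inf] enumerate_in_set[OF inf] by auto
qed

lemma eventually_ray_interior:
  fixes x :: "'a::real_normed_vector"
  assumes "x \<in> interior S"
  shows "\<forall>\<^sub>F t in at_right (0::real). x + t *\<^sub>R h \<in> interior S"
proof -
  have "((\<lambda>t. x + t *\<^sub>R h) \<longlongrightarrow> x + 0 *\<^sub>R h) (at_right 0)"
    by (intro tendsto_intros)
  then show ?thesis
    using topological_tendstoD[OF _ open_interior] assms by auto
qed

section \<open>Control of gradients along an epi-convergent sequence\<close>

text \<open>A gradient of norm at most \<open>R\<close> at \<open>x\<close> means that
  \<open>us k\<close> rises with slope at most \<open>R\<close> from \<open>s k\<close> to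
  \<open>x\<close>. Were such \<open>x\<close> to occur beyond distance \<open>T0\<close> for
  infinitely many \<open>k\<close>, convexity would give points of the sphere of radius
  \<open>T0\<close> around \<open>s k\<close> with value at most \<open>us k (s k) + R * T0\<close>,
  and a limit point of these contradicts the faster growth of \<open>u\<close>.\<close>

lemma epi_gradient_bounded:
  fixes u :: "'a::euclidean_space \<Rightarrow> ereal"
  assumes us: "\<And>k. us k \<in> Conv" and u: "u \<in> Conv_sc" and epi: "epi_converges us u" and "R \<ge> 0"
  shows "\<exists>T. \<forall>\<^sub>F k in sequentially. \<forall>x D. has_egrad (us k) x D \<longrightarrow> norm D \<le> R \<longrightarrow> norm x \<le> T"
proof -
  note uC = Conv_sc_Conv[OF u]
  obtain x0 where x0: "x0 \<in> eff_dom u" using ConvD(4)[OF uC] by blast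
  define c0 where "c0 = rpart u x0"
  have ux0: "u x0 = ereal c0" using ConvD(6)[OF uC x0] by (simp add: c0_def)
  obtain T where T: "T > 0" "\<And>x. norm x \<ge> T \<Longrightarrow> ereal ((R + 1) * norm x) \<le> u x"
    using Conv_sc_superlinear[OF u] by blast
  \<comment> \<open>The first entry places the sphere around \<open>x0\<close> in the region where
    \<open>u\<close> exceeds the cone of slope \<open>R + 1\<close>; the second makes that cone
    exceed \<open>c0 + R * T0\<close> there.\<close>
  define T0 where "T0 = max (T + norm x0) (c0 + (R + 1) * norm x0 + 1)"
  have T0: "T0 > 0" "T0 \<ge> T + norm x0" "T0 > c0 + (R + 1) * norm x0"
    using T by (auto simp: T0_def less_max_iff_disj add_pos_nonneg)
  have far: "u z > ereal (c0 + R * T0)" if "norm (z - x0) = T0" for z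
  proof -
    have z: "norm z \<ge> T0 - norm x0" using norm_triangle_ineq4[of z x0] that by simp
    then have "ereal ((R + 1) * norm z) \<le> u z" using T0 by (intro T(2)) simp
    moreover have "(R + 1) * norm z \<ge> (R + 1) * (T0 - norm x0)"
      using z \<open>R \<ge> 0\<close> by (intro mult_left_mono) auto
    moreover have "(R + 1) * (T0 - norm x0) > c0 + R * T0"
      using T0 by (simp add: algebra_simps)
    ultimately have "ereal (c0 + R * T0) < ereal ((R + 1) * norm z)" "ereal ((R + 1) * norm z) \<le> u z"
      by auto
    then show ?thesis by (rule less_le_trans)
  qed
  obtain s where s: "s \<longlonglongrightarrow> x0" "(\<lambda>k. us k (s k)) \<longlonglongrightarrow> u x0"
    using epi by (auto simp: epi_converges_def)
  have ev: "\<forall>\<^sub>F k in sequentially. \<forall>x D. has_egrad (us k) x D \<longrightarrow> norm D \<le> R \<longrightarrow> norm (x - s k) < T0"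
  proof (rule ccontr)
    assume "\<not> ?thesis"
    from not_eventually_subseq[OF this] obtain r :: "nat \<Rightarrow> nat" where r: "strict_mono r"
      "\<And>j. \<not> (\<forall>x D. has_egrad (us (r j)) x D \<longrightarrow> norm D \<le> R \<longrightarrow> norm (x - s (r j)) < T0)"
      by blast
    have "\<exists>x D. has_egrad (us (r j)) x D \<and> norm D \<le> R \<and> norm (x - s (r j)) \<ge> T0" for j
      using r(2)[of j] by (simp add: not_less)
    then obtain x D where xD: "\<And>j. has_egrad (us (r j)) (x j) (D j)" "\<And>j. norm (D j) \<le> R"
      "\<And>j. norm (x j - s (r j)) \<ge> T0"
      by metis
    \<comment> \<open>The point of the segment from \<open>s (r j)\<close> to \<open>x j\<close> at
      distance \<open>T0\<close> from the former.\<close>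
    define z where "z j = s (r j) + (T0 / norm (x j - s (r j))) *\<^sub>R (x j - s (r j))" for j
    have zn: "norm (z j - s (r j)) = T0" for j
      using xD(3)[of j] T0(1) by (auto simp: z_def)
    have sr: "(\<lambda>j. s (r j)) \<longlonglongrightarrow> x0" "(\<lambda>j. us (r j) (s (r j))) \<longlonglongrightarrow> ereal c0"
      using LIMSEQ_subseq_LIMSEQ[OF s(1) r(1)] LIMSEQ_subseq_LIMSEQ[OF s(2) r(1)] ux0 by (auto simp: o_def)
    have "bounded (range (\<lambda>j. s (r j)))" using sr(1) convergent_imp_bounded by blast
    then obtain B where B: "\<And>j. norm (s (r j)) \<le> B" by (auto simp: bounded_iff)
    have "norm (z j) \<le> B + T0" for j
      using norm_triangle_ineq[of "s (r j)" "z j - s (r j)"] B[of j] zn[of j] by simp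
    then have "bounded (range z)" by (auto simp: bounded_iff)
    then obtain z0 q where q: "strict_mono (q :: nat \<Rightarrow> nat)" "(z \<circ> q) \<longlonglongrightarrow> z0"
      using bounded_imp_convergent_subsequence by blast
    have srq: "(\<lambda>j. s (r (q j))) \<longlonglongrightarrow> x0" "(\<lambda>j. us (r (q j)) (s (r (q j)))) \<longlonglongrightarrow> ereal c0"
      using LIMSEQ_subseq_LIMSEQ[OF sr(1) q(1)] LIMSEQ_subseq_LIMSEQ[OF sr(2) q(1)] by (auto simp: o_def)
    have "(\<lambda>j. norm ((z \<circ> q) j - s (r (q j)))) \<longlonglongrightarrow> norm (z0 - x0)"
      by (intro tendsto_intros q srq)
    then have "norm (z0 - x0) = T0" using zn by (simp add: LIMSEQ_const_iff)
    then have big: "ereal (c0 + R * T0) < u z0" by (rule far)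
    have "us (r j) (z j) \<le> us (r j) (s (r j)) + ereal (R * T0)" for j
    proof (cases "s (r j) \<in> eff_dom (us (r j))")
      case False
      then show ?thesis using ConvD(5)[OF us] by auto
    next
      case True
      define f where "f = rpart (us (r j))"
      define l where "l = T0 / norm (x j - s (r j))"
      have l: "0 \<le> l" "l \<le> 1" "l * norm (x j - s (r j)) = T0"
        using xD(3)[of j] T0(1) by (auto simp: l_def divide_le_eq)
      have x: "x j \<in> eff_dom (us (r j))"
        using xD(1)[of j] interior_subset by (auto simp: has_egrad_def)
      have z: "z j = (1 - l) *\<^sub>R s (r j) + l *\<^sub>R x j"
        by (simp add: z_def l_def algebra_simps)
      have zd: "z j \<in> eff_dom (us (r j))"
        unfolding z by (intro convexD[OF convex_eff_dom[OF us]] True x) (use l in auto)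
      have "f (x j) + D j \<bullet> (s (r j) - x j) \<le> f (s (r j))"
        unfolding f_def by (rule has_egrad_subgradient[OF us xD(1) True])
      moreover have "D j \<bullet> (s (r j) - x j) \<ge> - (R * norm (x j - s (r j)))"
        using Cauchy_Schwarz_ineq2[of "D j" "s (r j) - x j"]
          mult_right_mono[OF xD(2)[of j], of "norm (x j - s (r j))"]
        by (simp add: abs_le_iff norm_minus_commute)
      ultimately have fx: "f (x j) \<le> f (s (r j)) + R * norm (x j - s (r j))" by linarith
      have "f (z j) \<le> (1 - l) * f (s (r j)) + l * f (x j)"
        unfolding z f_def using l True x by (intro convex_onD[OF convex_on_rpart[OF us]]) auto
      also have "\<dots> \<le> (1 - l) * f (s (r j)) + l * (f (s (r j)) + R * norm (x j - s (r j)))"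
        using fx l by (intro add_left_mono mult_left_mono) auto
      also have "\<dots> = f (s (r j)) + R * (l * norm (x j - s (r j)))" by (simp add: algebra_simps)
      also have "\<dots> = f (s (r j)) + R * T0" unfolding l(3) ..
      finally have "ereal (f (z j)) \<le> ereal (f (s (r j))) + ereal (R * T0)" by simp
      then show ?thesis
        unfolding f_def ConvD(6)[OF us zd, symmetric] ConvD(6)[OF us True, symmetric] .
    qed
    then have "liminf (\<lambda>j. us (r (q j)) (z (q j))) \<le> liminf (\<lambda>j. us (r (q j)) (s (r (q j))) + ereal (R * T0))"
      by (intro Liminf_mono always_eventually) auto
    moreover have "liminf (\<lambda>j. us (r (q j)) (s (r (q j))) + ereal (R * T0)) = ereal c0 + ereal (R * T0)"
      by (intro lim_imp_Liminf tendsto_add_ereal srq tendsto_const) auto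
    moreover have "u z0 \<le> liminf (\<lambda>j. us (r (q j)) (z (q j)))"
      using epi_converges_liminf[OF epi_converges_subseq[OF epi_converges_subseq[OF epi r(1)] q(1)] q(2)]
      by (simp add: o_def)
    ultimately have "u z0 \<le> ereal (c0 + R * T0)" by simp
    then show False using big by simp
  qed
  have "bounded (range s)" using s(1) convergent_imp_bounded by blast
  then obtain B where B: "\<And>k. norm (s k) \<le> B" by (auto simp: bounded_iff)
  show ?thesis
  proof (intro exI[of _ "B + T0"], use ev in eventually_elim, intro allI impI)
    fix k x D
    assume "\<forall>x D. has_egrad (us k) x D \<longrightarrow> norm D \<le> R \<longrightarrow> norm (x - s k) < T0"
      and "has_egrad (us k) x D" "norm D \<le> R"
    then have "norm (x - s k) < T0" by blast
    then show "norm x \<le> B + T0"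
      using norm_triangle_ineq[of "s k" "x - s k"] B[of k] by simp
  qed
qed

text \<open>Only the upper estimate needs work. If \<open>us k x\<close> exceeded some
  \<open>c'\<close> above \<open>u x\<close> infinitely often, a hyperplane through \<open>x\<close>
  would bound the convex sublevel set of \<open>us k\<close> at height \<open>c'\<close>. A limit
  \<open>a0\<close> of the unit normals points away from \<open>x - t a0\<close>, where
  \<open>u\<close> is still below \<open>c'\<close>; yet a recovery sequence for that point
  eventually lies in the sublevel sets.\<close>

lemma epi_converges_pointwise_interior:
  fixes u :: "'a::euclidean_space \<Rightarrow> ereal"
  assumes us: "\<And>k. us k \<in> Conv" and u: "u \<in> Conv" and epi: "epi_converges us u"
    and x: "x \<in> interior (eff_dom u)"
  shows "(\<lambda>k. us k x) \<longlonglongrightarrow> u x"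
proof (rule order_tendstoI)
  fix a assume "a < u x"
  also have "u x \<le> liminf (\<lambda>k. us k x)" by (rule epi_converges_liminf[OF epi]) simp
  finally show "\<forall>\<^sub>F k in sequentially. a < us k x" by (rule less_LiminfD)
next
  fix c assume c: "u x < c"
  have ux: "u x = ereal (rpart u x)" using x interior_subset by (intro ConvD(6)[OF u]) auto
  obtain c' where c': "u x < ereal c'" "ereal c' < c"
    using c ereal_dense2 by blast
  have "\<forall>\<^sub>F k in sequentially. us k x \<le> ereal c'"
  proof (rule ccontr)
    assume "\<not> ?thesis"
    from not_eventually_subseq[OF this] obtain r :: "nat \<Rightarrow> nat"
      where r: "strict_mono r" "\<And>j. \<not> us (r j) x \<le> ereal c'" by blast
    \<comment> \<open>Normalising to unit length makes a subsequence of the normals converge to a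
      nonzero vector.\<close>
    have "\<exists>a. norm a = 1 \<and> (\<forall>y. us (r j) y \<le> ereal c' \<longrightarrow> 0 \<le> a \<bullet> (y - x))" for j
    proof -
      define S where "S = (\<lambda>y. y - x) ` {y. us (r j) y \<le> ereal c'}"
      have "convex {y. us (r j) y \<le> ereal c'}"
        unfolding convex_alt
      proof (intro ballI allI impI)
        fix y z t assume yz: "y \<in> {y. us (r j) y \<le> ereal c'}" "z \<in> {y. us (r j) y \<le> ereal c'}"
          and t: "0 \<le> (t::real) \<and> t \<le> 1"
        then have d: "y \<in> eff_dom (us (r j))" "z \<in> eff_dom (us (r j))"
          using ConvD(1)[OF us] by (auto simp: eff_dom_def)
        have "rpart (us (r j)) y \<le> c'" "rpart (us (r j)) z \<le> c'"
          using yz ConvD(6)[OF us d(1)] ConvD(6)[OF us d(2)]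
          by (metis ereal_less_eq(3) mem_Collect_eq)+
        moreover have "rpart (us (r j)) ((1 - t) *\<^sub>R y + t *\<^sub>R z)
            \<le> (1 - t) * rpart (us (r j)) y + t * rpart (us (r j)) z"
          using t d by (intro convex_onD[OF convex_on_rpart[OF us]]) auto
        ultimately have "rpart (us (r j)) ((1 - t) *\<^sub>R y + t *\<^sub>R z) \<le> c'"
          using convex_bound_le[of "rpart (us (r j)) y" c' "rpart (us (r j)) z" "1 - t" t] t by auto
        moreover have "(1 - t) *\<^sub>R y + t *\<^sub>R z \<in> eff_dom (us (r j))"
          using t d by (intro convexD[OF convex_eff_dom[OF us]]) auto
        ultimately show "(1 - t) *\<^sub>R y + t *\<^sub>R z \<in> {y. us (r j) y \<le> ereal c'}"
          using ConvD(6)[OF us] by (metis ereal_less_eq(3) mem_Collect_eq)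
      qed
      then have "convex S" unfolding S_def by (rule convex_translation_subtract)
      moreover have "0 \<notin> S" using r(2)[of j] by (auto simp: S_def)
      ultimately obtain a where a: "a \<noteq> 0" "\<forall>y\<in>S. 0 \<le> a \<bullet> y"
        using separating_hyperplane_set_0 by blast
      then have "norm (sgn a) = 1 \<and> (\<forall>y. us (r j) y \<le> ereal c' \<longrightarrow> 0 \<le> sgn a \<bullet> (y - x))"
        by (auto simp: S_def norm_sgn sgn_div_norm)
      then show ?thesis by blast
    qed
    then obtain a where a: "\<And>j. norm (a j) = 1"
      "\<And>j y. us (r j) y \<le> ereal c' \<Longrightarrow> 0 \<le> a j \<bullet> (y - x)" by metis
    have "bounded (range a)" using a(1) by (auto simp: bounded_iff)
    then obtain a0 q where q: "strict_mono (q :: nat \<Rightarrow> nat)" "(a \<circ> q) \<longlonglongrightarrow> a0"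
      using bounded_imp_convergent_subsequence by blast
    have "(\<lambda>j. norm ((a \<circ> q) j)) \<longlonglongrightarrow> norm a0" by (intro tendsto_intros q)
    then have a0: "norm a0 = 1" using a(1) by (simp add: LIMSEQ_const_iff)
    have conv_int: "convex_on (interior (eff_dom u)) (rpart u)"
      using convex_eff_dom[OF u]
      by (intro convex_on_subset[OF convex_on_rpart[OF u]]) (auto simp: interior_subset convex_interior)
    then have "isCont (rpart u) x"
      using convex_on_continuous[OF open_interior conv_int] x
      by (simp add: continuous_on_eq_continuous_at)
    moreover have "((\<lambda>t. x - t *\<^sub>R a0) \<longlongrightarrow> x - 0 *\<^sub>R a0) (at_right 0)"
      by (intro tendsto_intros)
    ultimately have "((\<lambda>t. rpart u (x - t *\<^sub>R a0)) \<longlongrightarrow> rpart u x) (at_right 0)"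
      using isCont_tendsto_compose by force
    then have "\<forall>\<^sub>F t in at_right 0. rpart u (x - t *\<^sub>R a0) < c'"
      by (rule order_tendstoD(2)) (use c'(1) ux in \<open>metis less_ereal.simps(1)\<close>)
    moreover have "\<forall>\<^sub>F t in at_right (0::real). x - t *\<^sub>R a0 \<in> interior (eff_dom u)"
      using eventually_ray_interior[OF x, of "-a0"] by simp
    moreover have "\<forall>\<^sub>F t in at_right (0::real). t > 0" by (simp add: eventually_at_right_less)
    ultimately have "\<forall>\<^sub>F t in at_right (0::real). rpart u (x - t *\<^sub>R a0) < c' \<and>
        x - t *\<^sub>R a0 \<in> interior (eff_dom u) \<and> t > 0" by eventually_elim auto
    then obtain t where t: "rpart u (x - t *\<^sub>R a0) < c'" "x - t *\<^sub>R a0 \<in> interior (eff_dom u)" "t > 0"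
      using eventually_happens trivial_limit_at_right_real by blast
    define y where "y = x - t *\<^sub>R a0"
    have "u y = ereal (rpart u y)"
      using t(2) interior_subset by (intro ConvD(6)[OF u]) (auto simp: y_def)
    then have uy: "u y < ereal c'" using t(1) unfolding y_def by (metis less_ereal.simps(1))
    obtain s where s: "s \<longlonglongrightarrow> y" "(\<lambda>j. us (r (q j)) (s j)) \<longlonglongrightarrow> u y"
      using epi_converges_subseq[OF epi_converges_subseq[OF epi r(1)] q(1)]
      unfolding epi_converges_def by blast
    have "\<forall>\<^sub>F j in sequentially. us (r (q j)) (s j) < ereal c'"
      by (rule order_tendstoD(2)[OF s(2) uy])
    then have "\<forall>\<^sub>F j in sequentially. 0 \<le> a (q j) \<bullet> (s j - x)"
      by eventually_elim (simp add: a(2))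
    moreover have "(\<lambda>j. (a \<circ> q) j \<bullet> (s j - x)) \<longlonglongrightarrow> a0 \<bullet> (y - x)"
      by (intro tendsto_intros q s)
    ultimately have "0 \<le> a0 \<bullet> (y - x)"
      by (intro tendsto_lowerbound[of _ "a0 \<bullet> (y - x)" sequentially]) auto
    then show False using t(3) a0 by (simp add: y_def dot_square_norm)
  qed
  then show "\<forall>\<^sub>F k in sequentially. us k x < c"
    by eventually_elim (use c'(2) in auto)
qed

text \<open>The subgradient inequality bounds \<open>Dk k \<bullet> h\<close> by a difference
  quotient of \<open>us k\<close> with fixed step \<open>t\<close>, which converges to that of
  \<open>u\<close>; a small \<open>t\<close> brings the latter near \<open>D \<bullet> h\<close>.
  The direction \<open>-h\<close> supplies the other inequality.\<close>

lemma epi_converges_egrad: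
  fixes u :: "'a::euclidean_space \<Rightarrow> ereal"
  assumes us: "\<And>k. us k \<in> Conv" and u: "u \<in> Conv" and epi: "epi_converges us u"
    and D: "has_egrad u x D" and Dk: "\<forall>\<^sub>F k in sequentially. has_egrad (us k) x (Dk k)"
  shows "Dk \<longlonglongrightarrow> D"
proof -
  have x: "x \<in> interior (eff_dom u)" using D by (simp add: has_egrad_def)
  have pw: "(\<lambda>k. rpart (us k) y) \<longlonglongrightarrow> rpart u y"
    "\<forall>\<^sub>F k in sequentially. y \<in> eff_dom (us k)" if "y \<in> interior (eff_dom u)" for y
  proof -
    have y: "u y = ereal (rpart u y)" using that interior_subset by (intro ConvD(6)[OF u]) auto
    have lim: "(\<lambda>k. us k y) \<longlonglongrightarrow> ereal (rpart u y)"
      using epi_converges_pointwise_interior[OF us u epi that] y by simp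
    then show "(\<lambda>k. rpart (us k) y) \<longlonglongrightarrow> rpart u y" by (rule lim_real_of_ereal)
    have "\<forall>\<^sub>F k in sequentially. us k y < \<infinity>" using lim by (rule order_tendstoD) simp
    then show "\<forall>\<^sub>F k in sequentially. y \<in> eff_dom (us k)"
      by eventually_elim (use ConvD(1)[OF us] in \<open>auto simp: eff_dom_def\<close>)
  qed
  have upper: "\<forall>\<^sub>F k in sequentially. Dk k \<bullet> h < D \<bullet> h + \<epsilon>" if "\<epsilon> > 0" for h \<epsilon>
  proof -
    have "((\<lambda>t. (rpart u (x + t *\<^sub>R h) - rpart u x) / t) \<longlongrightarrow> D \<bullet> h) (at_right 0)"
      by (rule has_egrad_directional_right[OF D])
    then have "\<forall>\<^sub>F t in at_right 0. (rpart u (x + t *\<^sub>R h) - rpart u x) / t < D \<bullet> h + \<epsilon>"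
      using that by (intro order_tendstoD) auto
    moreover have "\<forall>\<^sub>F t in at_right (0::real). x + t *\<^sub>R h \<in> interior (eff_dom u)"
      by (rule eventually_ray_interior[OF x])
    moreover have "\<forall>\<^sub>F t in at_right (0::real). t > 0" by (simp add: eventually_at_right_less)
    ultimately have "\<forall>\<^sub>F t in at_right (0::real). (rpart u (x + t *\<^sub>R h) - rpart u x) / t < D \<bullet> h + \<epsilon> \<and>
        x + t *\<^sub>R h \<in> interior (eff_dom u) \<and> t > 0" by eventually_elim auto
    then obtain t where t: "(rpart u (x + t *\<^sub>R h) - rpart u x) / t < D \<bullet> h + \<epsilon>"
        "x + t *\<^sub>R h \<in> interior (eff_dom u)" "t > 0"
      using eventually_happens trivial_limit_at_right_real by blast
    have "(\<lambda>k. (rpart (us k) (x + t *\<^sub>R h) - rpart (us k) x) / t) \<longlonglongrightarrow> (rpart u (x + t *\<^sub>R h) - rpart u x) / t"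
      using t by (intro tendsto_intros pw x) auto
    then have "\<forall>\<^sub>F k in sequentially. (rpart (us k) (x + t *\<^sub>R h) - rpart (us k) x) / t < D \<bullet> h + \<epsilon>"
      using t(1) by (rule order_tendstoD)
    then show ?thesis using Dk pw(2)[OF t(2)]
    proof eventually_elim
      case (elim k)
      have "rpart (us k) x + Dk k \<bullet> (x + t *\<^sub>R h - x) \<le> rpart (us k) (x + t *\<^sub>R h)"
        by (rule has_egrad_subgradient[OF us]) (use elim in auto)
      then have "Dk k \<bullet> h \<le> (rpart (us k) (x + t *\<^sub>R h) - rpart (us k) x) / t"
        using t(3) by (simp add: pos_le_divide_eq mult.commute)
      then show ?case using elim by simp
    qed
  qed
  have "(\<lambda>k. Dk k \<bullet> h) \<longlonglongrightarrow> D \<bullet> h" for h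
  proof (rule LIMSEQ_I)
    fix \<epsilon> :: real assume "\<epsilon> > 0"
    from upper[OF this, of h] upper[OF this, of "-h"]
    have "\<forall>\<^sub>F k in sequentially. norm (Dk k \<bullet> h - D \<bullet> h) < \<epsilon>"
      by eventually_elim auto
    then show "\<exists>N. \<forall>k\<ge>N. norm (Dk k \<bullet> h - D \<bullet> h) < \<epsilon>" by (simp add: eventually_sequentially)
  qed
  then show ?thesis by (subst tendsto_componentwise_iff) auto
qed

text \<open>At \<open>x\<close> the values of \<open>us k\<close> tend to infinity, while along a
  recovery sequence for a point of the domain both positions and values stay bounded. A descent of
  unbounded height over bounded distance forces a steep gradient at \<open>x\<close>, if there is
  one.\<close>

lemma epi_converges_egrad_unbounded:
  fixes u :: "'a::euclidean_space \<Rightarrow> ereal"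
  assumes us: "\<And>k. us k \<in> Conv" and u: "u \<in> Conv" and epi: "epi_converges us u"
    and x: "x \<notin> eff_dom u"
  shows "\<forall>\<^sub>F k in sequentially. \<forall>D. has_egrad (us k) x D \<longrightarrow> R < norm D"
proof -
  obtain x0 where x0: "x0 \<in> eff_dom u" using ConvD(4)[OF u] by blast
  obtain s where s: "s \<longlonglongrightarrow> x0" "(\<lambda>k. us k (s k)) \<longlonglongrightarrow> u x0"
    using epi by (auto simp: epi_converges_def)
  define c where "c = rpart u x0 + 1"
  have "ereal (rpart u x0) < ereal c" by (simp add: c_def)
  then have "u x0 < ereal c" using ConvD(6)[OF u x0] by metis
  then have ev1: "\<forall>\<^sub>F k in sequentially. us k (s k) < ereal c" using order_tendstoD(2)[OF s(2)] by simp
  have "bounded (range (\<lambda>k. s k - x))"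
    by (rule convergent_imp_bounded) (auto intro!: tendsto_intros s)
  then obtain B where B: "\<And>k. norm (s k - x) \<le> B" by (auto simp: bounded_iff)
  have "\<infinity> \<le> liminf (\<lambda>k. us k x)"
    using epi_converges_liminf[OF epi tendsto_const, of x] ConvD(5)[OF u x] by simp
  then have ev2: "\<forall>\<^sub>F k in sequentially. ereal (c + \<bar>R\<bar> * B) < us k x"
    by (intro less_LiminfD) auto
  show ?thesis using ev1 ev2
  proof (eventually_elim, intro allI impI)
    fix k D assume a: "us k (s k) < ereal c" "ereal (c + \<bar>R\<bar> * B) < us k x" "has_egrad (us k) x D"
    have sd: "s k \<in> eff_dom (us k)" using a(1) ConvD(1)[OF us] by (auto simp: eff_dom_def)
    have xd: "x \<in> eff_dom (us k)" using a(3) interior_subset by (auto simp: has_egrad_def)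
    have "rpart (us k) x + D \<bullet> (s k - x) \<le> rpart (us k) (s k)"
      by (rule has_egrad_subgradient[OF us a(3) sd])
    moreover have "rpart (us k) (s k) < c"
      using a(1) ConvD(6)[OF us sd] by (metis less_ereal.simps(1))
    moreover have "c + \<bar>R\<bar> * B < rpart (us k) x"
      using a(2) ConvD(6)[OF us xd] by (metis less_ereal.simps(1))
    moreover have "- (D \<bullet> (s k - x)) \<le> norm D * norm (s k - x)"
      using Cauchy_Schwarz_ineq2[of D "s k - x"] by (simp add: abs_le_iff)
    ultimately have 1: "\<bar>R\<bar> * B < norm D * norm (s k - x)" by linarith
    show "R < norm D"
    proof (rule ccontr)
      assume "\<not> R < norm D"
      then have "norm D * norm (s k - x) \<le> \<bar>R\<bar> * B"
        using B[of k] by (intro mult_mono) auto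
      with 1 show False by simp
    qed
  qed
qed

section \<open>The functional given by a density\<close>

definition grad_integral :: "('a::euclidean_space \<Rightarrow> real) \<Rightarrow> ('a \<Rightarrow> ereal) \<Rightarrow> real" where
  "grad_integral \<zeta> u = (LINT x:eff_dom u|lebesgue. \<zeta> (egrad u x))"

lemma grad_integral_eq:
  "grad_integral \<zeta> u = (\<integral>x. indicator (eff_dom u) x * \<zeta> (egrad u x) \<partial>lebesgue)"
  by (simp add: grad_integral_def set_lebesgue_integral_def)

lemma CcE:
  fixes \<zeta> :: "'a::euclidean_space \<Rightarrow> real"
  assumes "\<zeta> \<in> Cc"
  obtains R M where "R \<ge> 0" "\<And>y. norm y > R \<Longrightarrow> \<zeta> y = 0" "\<And>y. \<bar>\<zeta> y\<bar> \<le> M"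
proof -
  define K where "K = closure {x. \<zeta> x \<noteq> 0}"
  have K: "compact K" and c: "continuous_on UNIV \<zeta>" using assms by (auto simp: Cc_def K_def)
  have zK: "\<zeta> y = 0" if "y \<notin> K" for y using that closure_subset[of "{x. \<zeta> x \<noteq> 0}"] by (auto simp: K_def)
  obtain R where R: "\<And>y. y \<in> K \<Longrightarrow> norm y \<le> R"
    using compact_imp_bounded[OF K] by (auto simp: bounded_iff)
  have "bounded (\<zeta> ` K)"
    using compact_continuous_image[OF continuous_on_subset[OF c] K] compact_imp_bounded by auto
  then obtain M where M: "\<And>y. y \<in> K \<Longrightarrow> \<bar>\<zeta> y\<bar> \<le> M" by (auto simp: bounded_iff)
  show ?thesis
  proof (rule that[of "max R 0" "max M 0"])
    show "\<zeta> y = 0" if "norm y > max R 0" for y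
      using that R[of y] zK[of y] by (cases "y \<in> K") auto
    show "\<bar>\<zeta> y\<bar> \<le> max M 0" for y
      using M[of y] zK[of y] by (cases "y \<in> K") auto
  qed auto
qed

lemma integrable_cball: "integrable lebesgue (\<lambda>x::'a::euclidean_space. M * indicator (cball 0 T) x :: real)"
  by (intro integrable_mult_right integrable_real_indicator)
    (auto simp: emeasure_bounded_finite simp flip: infinity_ennreal_def)

lemma grad_integral_tendsto:
  fixes u :: "'a::euclidean_space \<Rightarrow> ereal"
  assumes z: "\<zeta> \<in> Cc" and us: "\<And>k. us k \<in> Conv_sc" and u: "u \<in> Conv_sc" and epi: "epi_converges us u"
  shows "(\<lambda>k. grad_integral \<zeta> (us k)) \<longlonglongrightarrow> grad_integral \<zeta> u"
    and "integrable lebesgue (\<lambda>x. indicator (eff_dom u) x * \<zeta> (egrad u x))"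
proof -
  obtain R M where R: "R \<ge> 0" "\<And>y. norm y > R \<Longrightarrow> \<zeta> y = 0" and M: "\<And>y. \<bar>\<zeta> y\<bar> \<le> M"
    using CcE[OF z] by blast
  have cz: "continuous_on UNIV \<zeta>" using z by (simp add: Cc_def)
  note usC = Conv_sc_Conv[OF us] and uC = Conv_sc_Conv[OF u]
  define F where "F w x = indicator (eff_dom w) x * \<zeta> (egrad w x)" for w x
  have meas: "F w \<in> borel_measurable lebesgue" if "w \<in> Conv" for w
    unfolding F_def by (rule borel_measurable_egrad[OF that cz])
  obtain T K where T: "\<And>k x D. k \<ge> K \<Longrightarrow> has_egrad (us k) x D \<Longrightarrow> norm D \<le> R \<Longrightarrow> norm x \<le> T"
    using epi_gradient_bounded[of us, OF usC u epi R(1)] unfolding eventually_sequentially by metis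
  have ae: "AE x in lebesgue. \<forall>k. x \<in> eff_dom (us k) \<longrightarrow> has_egrad (us k) x (egrad (us k) x)"
    unfolding AE_all_countable
  proof
    fix k show "AE x in lebesgue. x \<in> eff_dom (us k) \<longrightarrow> has_egrad (us k) x (egrad (us k) x)"
      using AE_has_egrad[OF usC] by eventually_elim blast
  qed
  \<comment> \<open>The gradient bound holds only from index \<open>K\<close> on, so the sequence is
    shifted by \<open>K\<close> to be dominated throughout.\<close>
  have bound: "AE x in lebesgue. norm (F (us (k + K)) x) \<le> M * indicator (cball 0 T) x" for k
    using ae
  proof eventually_elim
    case (elim x)
    have M0: "M \<ge> 0" using M[of 0] by simp
    show ?case
    proof (cases "x \<in> eff_dom (us (k + K)) \<and> norm (egrad (us (k + K)) x) \<le> R")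
      case True
      then have "norm x \<le> T" using T[of "k + K"] elim by auto
      then show ?thesis using True M by (simp add: F_def)
    next
      case False
      then have "F (us (k + K)) x = 0" using R(2) by (auto simp: F_def indicator_def)
      then show ?thesis using M0 by (simp add: indicator_def)
    qed
  qed
  have lim: "AE x in lebesgue. (\<lambda>k. F (us (k + K)) x) \<longlonglongrightarrow> F u x"
    using ae AE_has_egrad[OF uC]
  proof eventually_elim
    case (elim x)
    have "(\<lambda>k. F (us k) x) \<longlonglongrightarrow> F u x"
    proof (cases "x \<in> eff_dom u")
      case True
      then have D: "has_egrad u x (egrad u x)" using elim by blast
      then have int: "x \<in> interior (eff_dom u)" by (simp add: has_egrad_def)
      have "u x < \<infinity>" using True by (auto simp: eff_dom_def)
      then have "\<forall>\<^sub>F k in sequentially. us k x < \<infinity>"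
        using order_tendstoD(2)[OF epi_converges_pointwise_interior[of us, OF usC uC epi int]] by blast
      then have ev: "\<forall>\<^sub>F k in sequentially. x \<in> eff_dom (us k)"
        by eventually_elim (use ConvD(1)[OF usC] in \<open>auto simp: eff_dom_def\<close>)
      then have "\<forall>\<^sub>F k in sequentially. has_egrad (us k) x (egrad (us k) x)"
        by eventually_elim (use elim in blast)
      then have "(\<lambda>k. egrad (us k) x) \<longlonglongrightarrow> egrad u x"
        by (rule epi_converges_egrad[of us, OF usC uC epi D])
      moreover have "isCont \<zeta> (egrad u x)" using cz by (simp add: continuous_on_eq_continuous_at)
      ultimately have "(\<lambda>k. \<zeta> (egrad (us k) x)) \<longlonglongrightarrow> \<zeta> (egrad u x)"
        using isCont_tendsto_compose by blast
      moreover have "\<forall>\<^sub>F k in sequentially. F (us k) x = \<zeta> (egrad (us k) x)"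
        using ev by eventually_elim (simp add: F_def)
      ultimately show ?thesis using True by (simp add: F_def[of u] tendsto_cong)
    next
      case False
      have "\<forall>\<^sub>F k in sequentially. \<forall>D. has_egrad (us k) x D \<longrightarrow> R < norm D"
        by (rule epi_converges_egrad_unbounded[of us, OF usC uC epi False])
      then have "\<forall>\<^sub>F k in sequentially. F (us k) x = 0"
        by eventually_elim (use elim R(2) in \<open>auto simp: F_def indicator_def\<close>)
      then show ?thesis using False by (simp add: F_def[of u] tendsto_eventually)
    qed
    then show ?case by (rule LIMSEQ_ignore_initial_segment)
  qed
  note dc = meas[OF uC] meas[OF usC] integrable_cball[of M T] lim bound
  have "(\<lambda>k. \<integral>x. F (us (k + K)) x \<partial>lebesgue) \<longlonglongrightarrow> (\<integral>x. F u x \<partial>lebesgue)"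
    by (rule integral_dominated_convergence[OF dc])
  then show "(\<lambda>k. grad_integral \<zeta> (us k)) \<longlonglongrightarrow> grad_integral \<zeta> u"
    unfolding grad_integral_eq F_def by (rule LIMSEQ_offset)
  show "integrable lebesgue (\<lambda>x. indicator (eff_dom u) x * \<zeta> (egrad u x))"
    using integrable_dominated_convergence[OF dc] by (simp add: F_def)
qed

text \<open>A single function is its own epi-limit, so integrability is the constant-sequence case
  of the domination argument.\<close>

lemma integrable_egrad:
  fixes u :: "'a::euclidean_space \<Rightarrow> ereal"
  assumes "\<zeta> \<in> Cc" "u \<in> Conv_sc"
  shows "integrable lebesgue (\<lambda>x. indicator (eff_dom u) x * \<zeta> (egrad u x))"
  using grad_integral_tendsto(2)[OF assms(1) assms(2) assms(2) epi_converges_const] assms(2)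
  by (auto intro: Conv_sc_Conv)

lemma has_egrad_touching:
  assumes f: "has_egrad f x D" and g: "has_egrad g x E" and le: "\<And>y. f y \<le> g y" and eq: "f x = g x"
  shows "D = E"
proof -
  have "D \<bullet> h \<le> E \<bullet> h" for h
  proof (rule tendsto_le)
    show "((\<lambda>t. (rpart f (x + t *\<^sub>R h) - rpart f x) / t) \<longlongrightarrow> D \<bullet> h) (at_right 0)"
      by (rule has_egrad_directional_right[OF f])
    show "((\<lambda>t. (rpart g (x + t *\<^sub>R h) - rpart g x) / t) \<longlongrightarrow> E \<bullet> h) (at_right 0)"
      by (rule has_egrad_directional_right[OF g])
    have "\<forall>\<^sub>F t in at_right (0::real). x + t *\<^sub>R h \<in> interior (eff_dom f)"
      "\<forall>\<^sub>F t in at_right (0::real). x + t *\<^sub>R h \<in> interior (eff_dom g)"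
      using f g by (auto simp: has_egrad_def intro: eventually_ray_interior)
    moreover have "\<forall>\<^sub>F t in at_right (0::real). t > 0" by (simp add: eventually_at_right_less)
    ultimately show "\<forall>\<^sub>F t in at_right 0. (rpart f (x + t *\<^sub>R h) - rpart f x) / t
        \<le> (rpart g (x + t *\<^sub>R h) - rpart g x) / t"
    proof eventually_elim
      case (elim t)
      then have "x + t *\<^sub>R h \<in> eff_dom f" "x + t *\<^sub>R h \<in> eff_dom g"
        using interior_subset by blast+
      then have "rpart f (x + t *\<^sub>R h) \<le> rpart g (x + t *\<^sub>R h)"
        using le[of "x + t *\<^sub>R h"]
        by (cases "f (x + t *\<^sub>R h)"; cases "g (x + t *\<^sub>R h)") (auto simp: eff_dom_def)
      then show ?case using eq elim by (simp add: divide_right_mono)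
    qed
  qed auto
  \<comment> \<open>Inequality of the directional derivatives in every direction leaves no room: the
    direction \<open>D - E\<close> gives a nonpositive squared norm.\<close>
  from this[of "D - E"] have "(D - E) \<bullet> (D - E) \<le> 0" by (simp add: inner_diff_left)
  then have "(D - E) \<bullet> (D - E) = 0" using inner_ge_zero[of "D - E"] by linarith
  then show ?thesis by simp
qed

lemma grad_integral_valuation:
  fixes \<zeta> :: "'a::euclidean_space \<Rightarrow> real"
  assumes z: "\<zeta> \<in> Cc"
  shows "valuation_on Conv_sc (grad_integral \<zeta>)"
  unfolding valuation_on_def
proof (intro ballI impI)
  fix u v :: "'a \<Rightarrow> ereal"
  define m where "m = (\<lambda>x. max (u x) (v x))"
  define n where "n = (\<lambda>x. min (u x) (v x))"
  assume C: "u \<in> Conv_sc" "v \<in> Conv_sc" "(\<lambda>x. max (u x) (v x)) \<in> Conv_sc" "(\<lambda>x. min (u x) (v x)) \<in> Conv_sc"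
  then have mn: "m \<in> Conv_sc" "n \<in> Conv_sc" by (auto simp: m_def n_def)
  define F where "F w x = indicator (eff_dom w) x * \<zeta> (egrad w x)" for w x
  have int: "integrable lebesgue (F w)" if "w \<in> Conv_sc" for w
    unfolding F_def by (rule integrable_egrad[OF z that])
  have "u x \<noteq> -\<infinity>" "v x \<noteq> -\<infinity>" for x
    using C ConvD(1) Conv_sc_Conv by blast+
  then have doms: "x \<in> eff_dom m \<longleftrightarrow> x \<in> eff_dom u \<and> x \<in> eff_dom v"
      "x \<in> eff_dom n \<longleftrightarrow> x \<in> eff_dom u \<or> x \<in> eff_dom v" for x
    by (auto simp: eff_dom_def m_def n_def max_def min_def)
  have "AE x in lebesgue. F m x + F n x = F u x + F v x"
    using AE_has_egrad[OF Conv_sc_Conv[OF C(1)]] AE_has_egrad[OF Conv_sc_Conv[OF C(2)]]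
      AE_has_egrad[OF Conv_sc_Conv[OF mn(1)]] AE_has_egrad[OF Conv_sc_Conv[OF mn(2)]]
  proof eventually_elim
    case (elim x)
    have mu: "egrad m x = egrad w x" if "x \<in> eff_dom m" "x \<in> eff_dom w" "w = u \<or> w = v" "m x = w x" for w
      by (rule has_egrad_touching[of w x _ m, symmetric]) (use elim that in \<open>auto simp: m_def\<close>)
    have nu: "egrad n x = egrad w x" if "x \<in> eff_dom n" "x \<in> eff_dom w" "w = u \<or> w = v" "n x = w x" for w
      by (rule has_egrad_touching[of n x _ w]) (use elim that in \<open>auto simp: n_def\<close>)
    consider "x \<in> eff_dom u" "x \<in> eff_dom v" | "x \<in> eff_dom u" "x \<notin> eff_dom v"
      | "x \<notin> eff_dom u" "x \<in> eff_dom v" | "x \<notin> eff_dom u" "x \<notin> eff_dom v" by blast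
    then show ?case
    proof cases
      case 1
      then have d: "x \<in> eff_dom m" "x \<in> eff_dom n" using doms by auto
      show ?thesis
      proof (cases "u x \<le> v x")
        case True
        then have "m x = v x" "n x = u x" by (auto simp: m_def n_def)
        then have "egrad m x = egrad v x" "egrad n x = egrad u x"
          using 1 d mu[of v] nu[of u] by auto
        then show ?thesis using 1 d by (simp add: F_def)
      next
        case False
        then have "m x = u x" "n x = v x" by (auto simp: m_def n_def)
        then have "egrad m x = egrad u x" "egrad n x = egrad v x"
          using 1 d mu[of u] nu[of v] by auto
        then show ?thesis using 1 d by (simp add: F_def)
      qed
    next
      case 2
      then have "v x = \<infinity>" using ConvD(5)[OF Conv_sc_Conv[OF C(2)]] by blast
      then have "n x = u x" by (simp add: n_def)
      then have "egrad n x = egrad u x" using 2 doms nu[of u] by auto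
      then show ?thesis using 2 doms by (simp add: F_def)
    next
      case 3
      then have "u x = \<infinity>" using ConvD(5)[OF Conv_sc_Conv[OF C(1)]] by blast
      then have "n x = v x" by (simp add: n_def)
      then have "egrad n x = egrad v x" using 3 doms nu[of v] by auto
      then show ?thesis using 3 doms by (simp add: F_def)
    qed (use doms in \<open>simp add: F_def\<close>)
  qed
  then have "(\<integral>x. F m x + F n x \<partial>lebesgue) = (\<integral>x. F u x + F v x \<partial>lebesgue)"
    using int[OF mn(1)] int[OF mn(2)] int[OF C(1)] int[OF C(2)]
    by (intro integral_cong_AE borel_measurable_add) auto
  then have "(\<integral>x. F m x \<partial>lebesgue) + (\<integral>x. F n x \<partial>lebesgue) = (\<integral>x. F u x \<partial>lebesgue) + (\<integral>x. F v x \<partial>lebesgue)"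
    using int[OF mn(1)] int[OF mn(2)] int[OF C(1)] int[OF C(2)] by simp
  then show "grad_integral \<zeta> (\<lambda>x. max (u x) (v x)) + grad_integral \<zeta> (\<lambda>x. min (u x) (v x))
      = grad_integral \<zeta> u + grad_integral \<zeta> v"
    by (simp add: grad_integral_eq F_def m_def n_def)
qed

section \<open>Scaling, translation and vertical shifts of the gradient integral\<close>

lemma lebesgue_integral_affine:
  fixes f :: "'a::euclidean_space \<Rightarrow> real"
  assumes f: "f \<in> borel_measurable lebesgue" and "c > 0"
  shows "(\<integral>x. f x \<partial>lebesgue) = c ^ DIM('a) * (\<integral>x. f (t + c *\<^sub>R x) \<partial>lebesgue)"
proof -
  have T: "t + (\<Sum>j\<in>Basis. (c * (x \<bullet> j)) *\<^sub>R j) = t + c *\<^sub>R x" for x :: 'a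
    by (simp add: scaleR_sum_right[symmetric] scaleR_scaleR[symmetric] euclidean_representation del: scaleR_scaleR)
  have eq: "lebesgue = density (distr lebesgue lebesgue (\<lambda>x. t + c *\<^sub>R x)) (\<lambda>_. ennreal (c ^ DIM('a)))"
    using lebesgue_affine_euclidean[of "\<lambda>_. c" t] \<open>c > 0\<close> unfolding T
    by (simp add: prod_constant ennreal_power)
  have m: "(\<lambda>x. t + c *\<^sub>R x) \<in> lebesgue \<rightarrow>\<^sub>M lebesgue"
    using lebesgue_affine_measurable[of "\<lambda>_. c" t] \<open>c > 0\<close> unfolding T by simp
  have "(\<integral>x. f x \<partial>lebesgue) = (\<integral>x. f x \<partial>density (distr lebesgue lebesgue (\<lambda>x. t + c *\<^sub>R x)) (\<lambda>_. ennreal (c ^ DIM('a))))"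
    using eq by simp
  also have "\<dots> = (\<integral>x. c ^ DIM('a) *\<^sub>R f x \<partial>distr lebesgue lebesgue (\<lambda>x. t + c *\<^sub>R x))"
    using f \<open>c > 0\<close> by (intro integral_density) auto
  also have "\<dots> = (\<integral>x. c ^ DIM('a) *\<^sub>R f (t + c *\<^sub>R x) \<partial>lebesgue)"
    using f by (intro integral_distr m) auto
  finally show ?thesis by simp
qed

text \<open>Epi-multiplication by \<open>c\<close> followed by translation by \<open>a\<close>, so
  that homogeneity and translation invariance are treated at once. For positive \<open>c\<close>
  these maps have inverses of the same form; hence one implication between gradients yields the
  equivalence.\<close>

definition epi_affine :: "'a::real_vector \<Rightarrow> real \<Rightarrow> ('a \<Rightarrow> ereal) \<Rightarrow> 'a \<Rightarrow> ereal" where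
  "epi_affine a c u = (\<lambda>x. ereal c * u ((x - a) /\<^sub>R c))"

lemma eff_dom_epi_affine:
  "c > 0 \<Longrightarrow> x \<in> eff_dom (epi_affine a c u) \<longleftrightarrow> (x - a) /\<^sub>R c \<in> eff_dom u"
  by (cases "u ((x - a) /\<^sub>R c)") (auto simp: eff_dom_def epi_affine_def)

lemma epi_affine_inverse:
  assumes "c > 0"
  shows "epi_affine (- (a /\<^sub>R c)) (inverse c) (epi_affine a c u) = u"
proof
  fix x
  have "((x + a /\<^sub>R c) /\<^sub>R inverse c - a) /\<^sub>R c = x"
    using assms by (simp add: scaleR_add_right)
  then show "epi_affine (- (a /\<^sub>R c)) (inverse c) (epi_affine a c u) x = u x"
    using assms by (simp add: epi_affine_def mult.assoc[symmetric] flip: one_ereal_def)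
qed

lemma has_egrad_epi_affine_imp:
  fixes u :: "'a::euclidean_space \<Rightarrow> ereal"
  assumes "c > 0" and D: "has_egrad u ((x - a) /\<^sub>R c) D"
  shows "has_egrad (epi_affine a c u) x D"
  unfolding has_egrad_def
proof
  show "x \<in> interior (eff_dom (epi_affine a c u))"
  proof (rule interiorI)
    show "open ((\<lambda>x. (x - a) /\<^sub>R c) -` interior (eff_dom u))"
      by (intro open_vimage open_interior continuous_intros)
    show "x \<in> (\<lambda>x. (x - a) /\<^sub>R c) -` interior (eff_dom u)" using D by (simp add: has_egrad_def)
    show "(\<lambda>x. (x - a) /\<^sub>R c) -` interior (eff_dom u) \<subseteq> eff_dom (epi_affine a c u)"
      using interior_subset eff_dom_epi_affine[OF assms(1)] by blast
  qed
  have "(rpart u has_derivative (\<lambda>h. h \<bullet> D)) (at ((x - a) /\<^sub>R c))"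
    using D by (simp add: has_egrad_def gderiv_def)
  moreover have "((\<lambda>x. (x - a) /\<^sub>R c) has_derivative (\<lambda>h. h /\<^sub>R c)) (at x)"
    by (auto intro!: derivative_eq_intros)
  ultimately have "((\<lambda>x. rpart u ((x - a) /\<^sub>R c)) has_derivative (\<lambda>h. (h /\<^sub>R c) \<bullet> D)) (at x)"
    by (rule has_derivative_compose[rotated])
  then have "((\<lambda>x. c * rpart u ((x - a) /\<^sub>R c)) has_derivative (\<lambda>h. c * ((h /\<^sub>R c) \<bullet> D))) (at x)"
    by (rule has_derivative_mult_right)
  moreover have "(\<lambda>h. c * ((h /\<^sub>R c) \<bullet> D)) = (\<lambda>h. h \<bullet> D)"
    using assms(1) by (simp add: fun_eq_iff)
  ultimately show "GDERIV (rpart (epi_affine a c u)) x :> D"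
    by (simp add: gderiv_def epi_affine_def)
qed

lemma has_egrad_epi_affine:
  fixes u :: "'a::euclidean_space \<Rightarrow> ereal"
  assumes "c > 0"
  shows "has_egrad (epi_affine a c u) x D \<longleftrightarrow> has_egrad u ((x - a) /\<^sub>R c) D"
proof
  assume *: "has_egrad (epi_affine a c u) x D"
  define y where "y = (x - a) /\<^sub>R c"
  have "(y - - (a /\<^sub>R c)) /\<^sub>R inverse c = x"
    using assms by (simp add: y_def algebra_simps flip: scaleR_add_right)
  then show "has_egrad u ((x - a) /\<^sub>R c) D"
    using has_egrad_epi_affine_imp[of "inverse c" "epi_affine a c u" y "- (a /\<^sub>R c)" D] assms *
    by (simp add: epi_affine_inverse y_def)
qed (rule has_egrad_epi_affine_imp[OF assms])

text \<open>The outer factor \<open>c\<close> cancels the inner \<open>1/c\<close>, so gradients are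
  merely relocated; the whole scaling is the Jacobian.\<close>

lemma grad_integral_epi_affine:
  fixes u :: "'a::euclidean_space \<Rightarrow> ereal"
  assumes z: "continuous_on UNIV \<zeta>" and u: "u \<in> Conv" and c: "c > 0"
  shows "grad_integral \<zeta> (epi_affine a c u) = c ^ DIM('a) * grad_integral \<zeta> u"
proof -
  have "indicator (eff_dom (epi_affine a c u)) x * \<zeta> (egrad (epi_affine a c u) x)
      = indicator (eff_dom u) (- (a /\<^sub>R c) + inverse c *\<^sub>R x) * \<zeta> (egrad u (- (a /\<^sub>R c) + inverse c *\<^sub>R x))" for x
  proof -
    have "(x - a) /\<^sub>R c = - (a /\<^sub>R c) + inverse c *\<^sub>R x" by (simp add: algebra_simps)
    then show ?thesis
      using c by (simp add: egrad_def has_egrad_epi_affine eff_dom_epi_affine indicator_def)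
  qed
  then show ?thesis
    unfolding grad_integral_eq
    using lebesgue_integral_affine[OF borel_measurable_egrad[OF u z], of "inverse c" "- (a /\<^sub>R c)"] c
    by (simp add: power_inverse)
qed

lemma has_egrad_vertical_imp:
  assumes "has_egrad u x D"
  shows "has_egrad (\<lambda>x. u x + ereal b) x D"
proof -
  have dom: "eff_dom (\<lambda>x. u x + ereal b) = eff_dom u" by (auto simp: eff_dom_def)
  have x: "x \<in> interior (eff_dom u)" using assms by (simp add: has_egrad_def)
  have "((\<lambda>x. rpart u x + b) has_derivative (\<lambda>h. h \<bullet> D)) (at x)"
    using assms by (auto simp: has_egrad_def gderiv_def intro!: derivative_eq_intros)
  then have "(rpart (\<lambda>x. u x + ereal b) has_derivative (\<lambda>h. h \<bullet> D)) (at x)"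
  proof (rule has_derivative_transform_within_open[OF _ open_interior x])
    fix y assume "y \<in> interior (eff_dom u)"
    then have "y \<in> eff_dom u" using interior_subset by blast
    then show "rpart u y + b = real_of_ereal (u y + ereal b)"
      by (cases "u y") (auto simp: eff_dom_def)
  qed
  then show ?thesis using x dom by (simp add: has_egrad_def gderiv_def)
qed

lemma has_egrad_vertical: "has_egrad (\<lambda>x. u x + ereal b) x D \<longleftrightarrow> has_egrad u x D"
proof
  assume "has_egrad (\<lambda>x. u x + ereal b) x D"
  from has_egrad_vertical_imp[OF this, of "- b"]
  have "has_egrad (\<lambda>x. u x + ereal b + ereal (- b)) x D" .
  moreover have "u x + ereal b + ereal (- b) = u x" for x by (cases "u x") auto
  ultimately show "has_egrad u x D" by simp
qed (rule has_egrad_vertical_imp)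

lemma grad_integral_properties:
  fixes \<zeta> :: "'a::euclidean_space \<Rightarrow> real"
  assumes z: "\<zeta> \<in> Cc"
  shows "epi_continuous_on Conv_sc (grad_integral \<zeta>)"
    and "epi_translation_invariant_on Conv_sc (grad_integral \<zeta>)"
    and "valuation_on Conv_sc (grad_integral \<zeta>)"
    and "epi_homogeneous_on (real DIM('a)) Conv_sc (grad_integral \<zeta>)"
proof -
  have cz: "continuous_on UNIV \<zeta>" using z by (simp add: Cc_def)
  show "epi_continuous_on Conv_sc (grad_integral \<zeta>)"
    using grad_integral_tendsto(1)[OF z] by (auto simp: epi_continuous_on_def)
  show "valuation_on Conv_sc (grad_integral \<zeta>)" by (rule grad_integral_valuation[OF z])
  have "grad_integral \<zeta> (\<lambda>x. u (x - a)) = grad_integral \<zeta> u" if "u \<in> Conv_sc" for u a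
    using grad_integral_epi_affine[OF cz Conv_sc_Conv[OF that], of 1 a]
    by (simp add: epi_affine_def flip: one_ereal_def)
  moreover have "eff_dom (\<lambda>x. u x + ereal b) = eff_dom u" for u :: "'a \<Rightarrow> ereal" and b
    by (auto simp: eff_dom_def)
  then have "grad_integral \<zeta> (\<lambda>x. u x + ereal b) = grad_integral \<zeta> u" for u b
    by (simp add: grad_integral_def egrad_def has_egrad_vertical)
  ultimately show "epi_translation_invariant_on Conv_sc (grad_integral \<zeta>)"
    by (simp add: epi_translation_invariant_on_def translation_invariant_on_def
        vertically_translation_invariant_on_def)
  have "epi_mult c u = epi_affine 0 c u" for c and u :: "'a \<Rightarrow> ereal"
    by (simp add: epi_mult_def epi_affine_def)
  then show "epi_homogeneous_on (real DIM('a)) Conv_sc (grad_integral \<zeta>)"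
    by (simp add: epi_homogeneous_on_def grad_integral_epi_affine[OF cz Conv_sc_Conv] powr_realpow)
qed

section \<open>Valuations on boxes\<close>

text \<open>For points off the closed set \<open>B\<close> a sequence is eventually off
  \<open>B\<close>, where all values are infinite; on \<open>B\<close> uniform convergence and
  continuity of \<open>w\<close> combine. Constant sequences serve for recovery.\<close>

lemma epi_converges_ext:
  fixes w :: "'a::euclidean_space \<Rightarrow> real"
  assumes B: "closed B" and w: "continuous_on B w"
    and unif: "\<And>e. e > 0 \<Longrightarrow> \<forall>\<^sub>F k in sequentially. \<forall>x\<in>B. \<bar>wk k x - w x\<bar> < e"
  shows "epi_converges (\<lambda>k. inf_ext B (wk k)) (inf_ext B w)"
  unfolding epi_converges_def
proof (intro allI conjI impI)
  fix x :: 'a and s assume s: "s \<longlonglongrightarrow> x"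
  show "inf_ext B w x \<le> liminf (\<lambda>k. inf_ext B (wk k) (s k))"
    unfolding le_Liminf_iff
  proof (intro allI impI)
    fix c assume c: "c < inf_ext B w x"
    show "\<forall>\<^sub>F k in sequentially. c < inf_ext B (wk k) (s k)"
    proof (cases "x \<in> B")
      case False
      then have "\<forall>\<^sub>F k in sequentially. s k \<in> - B"
        using topological_tendstoD[OF s, of "- B"] B by auto
      then show ?thesis by eventually_elim (use c False in \<open>auto simp: inf_ext_def\<close>)
    next
      case True
      then obtain c' where c': "c < ereal c'" "c' < w x"
        using c ereal_dense2[of c "ereal (w x)"] by auto
      \<comment> \<open>Half of the gap: one half is spent on replacing \<open>wk k\<close> by
        \<open>w\<close>, the other on moving from \<open>s k\<close> to \<open>x\<close>.\<close>
      define e where "e = (w x - c') / 2"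
      have e: "e > 0" using c' by (simp add: e_def)
      obtain d where d: "d > 0" "\<And>y. y \<in> B \<Longrightarrow> dist y x < d \<Longrightarrow> dist (w y) (w x) < e"
        using w True e unfolding continuous_on_iff by blast
      have "\<forall>\<^sub>F k in sequentially. dist (s k) x < d" using s d(1) by (rule tendstoD)
      then show ?thesis using unif[OF e]
      proof eventually_elim
        case (elim k)
        show ?case
        proof (cases "s k \<in> B")
          case True
          have "\<bar>wk k (s k) - w (s k)\<bar> < e" "\<bar>w (s k) - w x\<bar> < e"
            using elim True d(2)[OF True] by (auto simp: dist_real_def)
          moreover have "c' = w x - 2 * e" by (simp add: e_def field_simps)
          ultimately have "c' < wk k (s k)" by linarith
          then show ?thesis using True c'(1) by (simp add: less_trans[of c "ereal c'"])
        qed (use c'(1) in auto)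
      qed
    qed
  qed
next
  fix x :: 'a
  have "(\<lambda>k. inf_ext B (wk k) x) \<longlonglongrightarrow> inf_ext B w x"
  proof (cases "x \<in> B")
    case True
    have "(\<lambda>k. wk k x) \<longlonglongrightarrow> w x"
      unfolding tendsto_iff dist_real_def
      by (intro allI impI eventually_mono[OF unif]) (use True in auto)
    then show ?thesis using True by simp
  qed simp
  then show "\<exists>s. s \<longlonglongrightarrow> x \<and> (\<lambda>k. inf_ext B (wk k) (s k)) \<longlonglongrightarrow> inf_ext B w x"
    by (intro exI[of _ "\<lambda>_. x"]) auto
qed

lemma convex_on_affine_pullback:
  fixes v :: "'a::real_vector \<Rightarrow> real"
  assumes v: "convex_on S v" and "r > 0" and B: "convex B" "(\<lambda>z. r *\<^sub>R z + p) ` B \<subseteq> S"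
  shows "convex_on B (\<lambda>z. v (r *\<^sub>R z + p) / r)"
proof (rule convex_onI)
  fix t :: real and x y assume t: "0 < t" "t < 1" and xy: "x \<in> B" "y \<in> B"
  have eq: "r *\<^sub>R ((1 - t) *\<^sub>R x + t *\<^sub>R y) + p = (1 - t) *\<^sub>R (r *\<^sub>R x + p) + t *\<^sub>R (r *\<^sub>R y + p)"
    by (simp add: algebra_simps)
  have "v (r *\<^sub>R ((1 - t) *\<^sub>R x + t *\<^sub>R y) + p) \<le> (1 - t) * v (r *\<^sub>R x + p) + t * v (r *\<^sub>R y + p)"
    unfolding eq using t xy B by (intro convex_onD[OF v]) auto
  then show "v (r *\<^sub>R ((1 - t) *\<^sub>R x + t *\<^sub>R y) + p) / r
      \<le> (1 - t) * (v (r *\<^sub>R x + p) / r) + t * (v (r *\<^sub>R y + p) / r)"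
    using \<open>r > 0\<close> by (simp add: divide_right_mono flip: add_divide_distrib)
qed fact

text \<open>The division by \<open>r\<close> compensates the inner scaling, so the constant
  \<open>L\<close> survives. This is what keeps blow-ups of every scale in a single class.\<close>

lemma lipschitz_affine_pullback:
  fixes v :: "'a::real_normed_vector \<Rightarrow> real"
  assumes v: "L-lipschitz_on S v" and "r > 0" and B: "(\<lambda>z. r *\<^sub>R z + p) ` B \<subseteq> S"
  shows "L-lipschitz_on B (\<lambda>z. v (r *\<^sub>R z + p) / r)"
proof (rule lipschitz_onI)
  fix x y assume xy: "x \<in> B" "y \<in> B"
  have "dist (v (r *\<^sub>R x + p)) (v (r *\<^sub>R y + p)) \<le> L * dist (r *\<^sub>R x + p) (r *\<^sub>R y + p)"
    using xy B by (intro lipschitz_onD[OF v]) auto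
  also have "dist (r *\<^sub>R x + p) (r *\<^sub>R y + p) = r * dist x y"
    using \<open>r > 0\<close> by (simp add: dist_norm flip: scaleR_diff_right)
  finally show "dist (v (r *\<^sub>R x + p) / r) (v (r *\<^sub>R y + p) / r) \<le> L * dist x y"
    using \<open>r > 0\<close> by (simp add: dist_real_def pos_divide_le_eq mult_ac flip: diff_divide_distrib)
qed (rule lipschitz_on_nonneg[OF v])

lemma cbox_cut:
  fixes a b :: "'a::euclidean_space"
  assumes i: "i \<in> Basis" and c: "a \<bullet> i \<le> c" "c \<le> b \<bullet> i"
  shows "cbox a b \<inter> {x. x \<bullet> i \<le> c} = cbox a (b + (c - b \<bullet> i) *\<^sub>R i)"
    and "cbox a b \<inter> {x. x \<bullet> i \<ge> c} = cbox (a + (c - a \<bullet> i) *\<^sub>R i) b"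
    and "cbox a b \<inter> {x. x \<bullet> i = c} = cbox (a + (c - a \<bullet> i) *\<^sub>R i) (b + (c - b \<bullet> i) *\<^sub>R i)"
proof -
  have mem: "x \<in> cbox (a + s *\<^sub>R i) (b + t *\<^sub>R i) \<longleftrightarrow> (\<forall>j\<in>Basis.
      a \<bullet> j + (if j = i then s else 0) \<le> x \<bullet> j \<and> x \<bullet> j \<le> b \<bullet> j + (if j = i then t else 0))" for x s t
    using i by (auto simp: mem_box inner_add_left inner_Basis)
  note mem' = mem[of _ 0 0, simplified] mem[of _ 0, simplified] mem[of _ _ 0, simplified] mem
  show "cbox a b \<inter> {x. x \<bullet> i \<le> c} = cbox a (b + (c - b \<bullet> i) *\<^sub>R i)"
    using i c unfolding set_eq_iff Int_iff mem_Collect_eq mem' by (smt (verit, best))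
  show "cbox a b \<inter> {x. x \<bullet> i \<ge> c} = cbox (a + (c - a \<bullet> i) *\<^sub>R i) b"
    using i c unfolding set_eq_iff Int_iff mem_Collect_eq mem' by (smt (verit, best))
  show "cbox a b \<inter> {x. x \<bullet> i = c} = cbox (a + (c - a \<bullet> i) *\<^sub>R i) (b + (c - b \<bullet> i) *\<^sub>R i)"
    using i c unfolding set_eq_iff Int_iff mem_Collect_eq mem' by (smt (verit, best))
qed

section \<open>The valuation on compact pieces: scaling, cutting and boundedness\<close>

locale epi_valuation =
  fixes Z :: "('a::euclidean_space \<Rightarrow> ereal) \<Rightarrow> real"
  assumes cont: "epi_continuous_on Conv_sc Z"
    and inv: "epi_translation_invariant_on Conv_sc Z"
    and val: "valuation_on Conv_sc Z"
    and hom: "epi_homogeneous_on (real DIM('a)) Conv_sc Z"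
begin

lemma Z_tendsto:
  "\<lbrakk>\<And>k. us k \<in> Conv_sc; u \<in> Conv_sc; epi_converges us u\<rbrakk> \<Longrightarrow> (\<lambda>k. Z (us k)) \<longlonglongrightarrow> Z u"
  using cont by (auto simp: epi_continuous_on_def)

lemma Z_add_const:
  assumes "inf_ext B v \<in> Conv_sc"
  shows "Z (inf_ext B (\<lambda>x. v x + c)) = Z (inf_ext B v)"
proof -
  have "inf_ext B (\<lambda>x. v x + c) = (\<lambda>x. inf_ext B v x + ereal c)" by (auto simp: inf_ext_def)
  then show ?thesis
    using inv assms
    by (simp add: epi_translation_invariant_on_def vertically_translation_invariant_on_def)
qed

text \<open>The map is factored into the scaling by \<open>r\<close>, where epi-homogeneity yields
  the power of \<open>r\<close>, and the translation by \<open>p\<close>; \<open>e\<close> is the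
  function in between.\<close>

lemma Z_affine_image:
  assumes B: "compact B" "B \<noteq> {}" "convex B" and r: "r > 0"
    and v: "convex_on ((\<lambda>z. r *\<^sub>R z + p) ` B) v" "continuous_on ((\<lambda>z. r *\<^sub>R z + p) ` B) v"
  shows "Z (inf_ext ((\<lambda>z. r *\<^sub>R z + p) ` B) v) = r ^ DIM('a) * Z (inf_ext B (\<lambda>z. v (r *\<^sub>R z + p) / r))"
proof -
  define w where "w = (\<lambda>z. v (r *\<^sub>R z + p) / r)"
  have "continuous_on B w"
    unfolding w_def using r
    by (intro continuous_intros continuous_on_compose2[OF v(2)]) auto
  then have w: "inf_ext B w \<in> Conv_sc"
    unfolding w_def using convex_on_affine_pullback[OF v(1) r B(3)] B(1,2)
    by (intro inf_ext_Conv_sc) auto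
  \<comment> \<open>The factor and the divisor 1 exhibit \<open>e\<close> as an affine pullback of
    ratio 1, so that its convexity is an instance of the pullback lemma.\<close>
  define e where "e = inf_ext ((*\<^sub>R) r ` B) (\<lambda>x. v (1 *\<^sub>R x + p) / 1)"
  have "continuous_on ((*\<^sub>R) r ` B) (\<lambda>x. v (1 *\<^sub>R x + p) / 1)"
    by (intro continuous_intros continuous_on_compose2[OF v(2)]) auto
  moreover have "convex_on ((*\<^sub>R) r ` B) (\<lambda>x. v (1 *\<^sub>R x + p) / 1)"
    by (rule convex_on_affine_pullback[OF v(1)]) (use B in \<open>auto simp: convex_scaling\<close>)
  ultimately have e: "e \<in> Conv_sc"
    unfolding e_def using B(1,2) by (intro inf_ext_Conv_sc compact_scaling) auto
  have "epi_mult r (inf_ext B w) = e"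
  proof
    fix x show "epi_mult r (inf_ext B w) x = e x"
    proof (cases "x /\<^sub>R r \<in> B")
      case True
      then have "x \<in> (*\<^sub>R) r ` B" using r by (intro image_eqI[of _ _ "x /\<^sub>R r"]) auto
      then show ?thesis using True r by (simp add: epi_mult_def e_def w_def)
    next
      case False
      then have "x \<notin> (*\<^sub>R) r ` B" using r by auto
      then show ?thesis using False r by (simp add: epi_mult_def e_def w_def)
    qed
  qed
  then have 1: "Z e = r ^ DIM('a) * Z (inf_ext B w)"
    using hom w r by (simp add: epi_homogeneous_on_def powr_realpow flip: \<open>epi_mult r (inf_ext B w) = e\<close>)
  have "(\<lambda>x. e (x - p)) = inf_ext ((\<lambda>z. r *\<^sub>R z + p) ` B) v"
  proof
    fix x
    have "x - p \<in> (*\<^sub>R) r ` B \<longleftrightarrow> x \<in> (\<lambda>z. r *\<^sub>R z + p) ` B"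
      by (simp add: image_iff diff_eq_eq)
    then show "e (x - p) = inf_ext ((\<lambda>z. r *\<^sub>R z + p) ` B) v x" by (simp add: e_def inf_ext_def)
  qed
  moreover have "Z (\<lambda>x. e (x - p)) = Z e"
    using inv e by (simp add: epi_translation_invariant_on_def translation_invariant_on_def)
  ultimately show ?thesis using 1 by (simp add: w_def)
qed

text \<open>The two halves overlap in the slice: their maximum is the cut-off of \<open>v\<close> to
  the slice and their minimum the cut-off to \<open>B\<close>.\<close>

lemma Z_cut:
  assumes B: "compact B" and v: "convex_on B v" "continuous_on B v"
    and ne: "B \<inter> {x. x \<bullet> i = c} \<noteq> {}"
  shows "Z (inf_ext B v) + Z (inf_ext (B \<inter> {x. x \<bullet> i = c}) v)
      = Z (inf_ext (B \<inter> {x. x \<bullet> i \<le> c}) v) + Z (inf_ext (B \<inter> {x. x \<bullet> i \<ge> c}) v)"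
proof -
  have cB: "convex B" using v(1) by (rule convex_on_imp_convex)
  have sc: "inf_ext (B \<inter> H) v \<in> Conv_sc" if "closed H" "convex H" "B \<inter> H \<noteq> {}" for H
    using that B cB by (intro inf_ext_Conv_sc convex_on_subset[OF v(1)] continuous_on_subset[OF v(2)])
      (auto intro: convex_Int compact_Int_closed)
  have le: "closed {x. x \<bullet> i \<le> c}" "convex {x. x \<bullet> i \<le> c}"
    and ge: "closed {x. x \<bullet> i \<ge> c}" "convex {x. x \<bullet> i \<ge> c}"
    and eq: "closed {x. x \<bullet> i = c}" "convex {x. x \<bullet> i = c}"
    using closed_halfspace_le[of i c] convex_halfspace_le[of i c] closed_halfspace_ge[of c i]
      convex_halfspace_ge[of c i] closed_hyperplane[of i c] convex_hyperplane[of i c]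
    by (simp_all add: inner_commute)
  have "B \<inter> {x. x \<bullet> i \<le> c} \<noteq> {}" "B \<inter> {x. x \<bullet> i \<ge> c} \<noteq> {}" using ne by auto
  then have mem: "inf_ext (B \<inter> {x. x \<bullet> i \<le> c}) v \<in> Conv_sc" "inf_ext (B \<inter> {x. x \<bullet> i \<ge> c}) v \<in> Conv_sc"
    "inf_ext (B \<inter> {x. x \<bullet> i = c}) v \<in> Conv_sc" "inf_ext B v \<in> Conv_sc"
    using sc[OF le] sc[OF ge] sc[OF eq ne] ne B v by (auto intro: inf_ext_Conv_sc)
  have mx: "(\<lambda>x. max (inf_ext (B \<inter> {x. x \<bullet> i \<le> c}) v x) (inf_ext (B \<inter> {x. x \<bullet> i \<ge> c}) v x))
      = inf_ext (B \<inter> {x. x \<bullet> i = c}) v"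
    by (auto simp: inf_ext_def fun_eq_iff)
  have mn: "(\<lambda>x. min (inf_ext (B \<inter> {x. x \<bullet> i \<le> c}) v x) (inf_ext (B \<inter> {x. x \<bullet> i \<ge> c}) v x)) = inf_ext B v"
    by (auto simp: inf_ext_def fun_eq_iff)
  from val[unfolded valuation_on_def, rule_format, OF mem(1,2)] mem(3,4)
  show ?thesis unfolding mx mn by simp
qed

text \<open>Functions violating every bound may be normalised to vanish at one point, by vertical
  invariance. Arzela-Ascoli then extracts a uniformly convergent subsequence whose limit is again
  convex, and continuity makes the values of \<open>Z\<close> along it converge, hence
  bounded.\<close>

lemma Z_bounded:
  assumes B: "compact B" "B \<noteq> {}"
  shows "\<exists>M. \<forall>v. convex_on B v \<longrightarrow> L-lipschitz_on B v \<longrightarrow> \<bar>Z (inf_ext B v)\<bar> \<le> M"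
proof (rule ccontr)
  assume "\<not> ?thesis"
  then have "\<forall>k::nat. \<exists>v. convex_on B v \<and> L-lipschitz_on B v \<and> \<bar>Z (inf_ext B v)\<bar> > real k"
    by (meson not_le)
  then obtain v where v: "\<And>k. convex_on B (v k)" "\<And>k. L-lipschitz_on B (v k)"
    "\<And>k. \<bar>Z (inf_ext B (v k))\<bar> > real k" by metis
  obtain b where b: "b \<in> B" using B by blast
  define w where "w k x = v k x + - v k b" for k x
  have cvB: "convex B" using v(1) convex_on_imp_convex by blast
  have wc: "convex_on B (w k)" for k
    unfolding w_def by (intro convex_on_add v) (simp add: convex_on_const cvB)
  have lip: "\<bar>w k x - w k y\<bar> \<le> L * dist x y" if "x \<in> B" "y \<in> B" for k x y
    using lipschitz_onD[OF v(2) that, of k] by (simp add: w_def dist_real_def)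
  have L: "L \<ge> 0" using v(2) lipschitz_on_nonneg by blast
  obtain R where R: "\<And>x. x \<in> B \<Longrightarrow> dist x b \<le> R"
    using compact_imp_bounded[OF B(1)] bounded_any_center[of B b] by (auto simp: dist_commute)
  have bnd: "norm (w k x) \<le> L * R" if "x \<in> B" for k x
    using lip[OF that b, of k] mult_left_mono[OF R[OF that] L] by (simp add: w_def)
  have equi: "\<exists>d>0. \<forall>n y. y \<in> B \<and> norm (x - y) < d \<longrightarrow> norm (w n x - w n y) < e"
    if "x \<in> B" "e > 0" for x e
  proof (intro exI conjI allI impI)
    \<comment> \<open>Adding 1 keeps the divisor positive when \<open>L = 0\<close>.\<close>
    show "e / (L + 1) > 0" using that L by simp
    fix n y assume y: "y \<in> B \<and> norm (x - y) < e / (L + 1)"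
    have "\<bar>w n x - w n y\<bar> \<le> L * dist x y" using lip that y by blast
    also have "\<dots> \<le> (L + 1) * dist x y" by (intro mult_right_mono) auto
    also have "\<dots> < e" using y L by (simp add: dist_norm pos_less_divide_eq mult.commute)
    finally show "norm (w n x - w n y) < e" by simp
  qed
  obtain g r where g: "continuous_on B g" and r: "strict_mono (r :: nat \<Rightarrow> nat)"
    and unif: "\<And>e. 0 < e \<Longrightarrow> \<exists>N. \<forall>n x. n \<ge> N \<and> x \<in> B \<longrightarrow> norm (w (r n) x - g x) < e"
    using Arzela_Ascoli[OF B(1) bnd equi] by metis
  have unif': "\<forall>\<^sub>F n in sequentially. \<forall>x\<in>B. \<bar>w (r n) x - g x\<bar> < e" if "e > 0" for e
    using unif[OF that] unfolding eventually_sequentially by auto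
  have pw: "(\<lambda>n. w (r n) x) \<longlonglongrightarrow> g x" if "x \<in> B" for x
    unfolding tendsto_iff dist_real_def
    by (intro allI impI eventually_mono[OF unif']) (use that in auto)
  have gc: "convex_on B g"
  proof (rule convex_onI)
    fix t :: real and x y assume t: "0 < t" "t < 1" and xy: "x \<in> B" "y \<in> B"
    have m: "(1 - t) *\<^sub>R x + t *\<^sub>R y \<in> B" using t xy by (intro convexD[OF cvB]) auto
    show "g ((1 - t) *\<^sub>R x + t *\<^sub>R y) \<le> (1 - t) * g x + t * g y"
    proof (rule LIMSEQ_le[OF pw[OF m]])
      show "(\<lambda>n. (1 - t) * w (r n) x + t * w (r n) y) \<longlonglongrightarrow> (1 - t) * g x + t * g y"
        by (intro tendsto_intros pw xy)
      show "\<exists>N. \<forall>n\<ge>N. w (r n) ((1 - t) *\<^sub>R x + t *\<^sub>R y) \<le> (1 - t) * w (r n) x + t * w (r n) y"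
        using convex_onD[OF wc] t xy by auto
    qed
  qed (rule cvB)
  have cw: "continuous_on B (w k)" for k
    unfolding w_def by (intro continuous_intros lipschitz_on_continuous_on[OF v(2)])
  have "(\<lambda>n. Z (inf_ext B (w (r n)))) \<longlonglongrightarrow> Z (inf_ext B g)"
    using B wc cw gc g unif'
    by (intro Z_tendsto inf_ext_Conv_sc epi_converges_ext compact_imp_closed) auto
  then have "bounded (range (\<lambda>n. Z (inf_ext B (w (r n)))))" using convergent_imp_bounded by blast
  then obtain M where M: "\<And>n. \<bar>Z (inf_ext B (w (r n)))\<bar> \<le> M" by (auto simp: bounded_iff)
  obtain n :: nat where n: "real n > M" using reals_Archimedean2 by blast
  have "inf_ext B (v k) \<in> Conv_sc" for k
    using B v lipschitz_on_continuous_on[OF v(2)] by (intro inf_ext_Conv_sc) auto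
  then have "Z (inf_ext B (w (r n))) = Z (inf_ext B (v (r n)))"
    unfolding w_def by (rule Z_add_const)
  moreover have "real n \<le> real (r n)" using seq_suble[OF r, of n] by simp
  ultimately show False using M[of n] v(3)[of "r n"] n by simp
qed

text \<open>A degenerate box splits into \<open>2^k\<close> translates of its homothetic copy of ratio \<open>1/2\<close>, where
  \<open>k < n\<close> is its dimension, whereas homogeneity scales \<open>Z\<close> by \<open>2^-n\<close>.\<close>

lemma Z_degenerate:
  assumes "cbox a b \<noteq> {}" "\<exists>i\<in>Basis. a \<bullet> i = b \<bullet> i"
    and "convex_on (cbox a b) v" "L-lipschitz_on (cbox a b) v"
  shows "Z (inf_ext (cbox a b) v) = 0"
  using assms
\<comment> \<open>Induction on the number of nondegenerate axes: halving along such an axis creates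
  a slice that is a degenerate box with fewer of them, and the hypothesis makes its contribution
  vanish.\<close>
proof (induction "card {i \<in> Basis. a \<bullet> i < b \<bullet> i}" arbitrary: a b v rule: less_induct)
  case (less a b v)
  define s where "s = b - a"
  define S where "S = {i \<in> Basis. s \<bullet> i > 0}"
  have finS: "finite S" "S \<subseteq> Basis" by (auto simp: S_def)
  have S_card: "S = {i \<in> Basis. a \<bullet> i < b \<bullet> i}" by (auto simp: S_def s_def inner_diff_left)
  have s0: "s \<bullet> i \<ge> 0" if "i \<in> Basis" for i
    using less.prems(1) that by (auto simp: box_ne_empty s_def inner_diff_left)
  obtain i0 where i0: "i0 \<in> Basis" "a \<bullet> i0 = b \<bullet> i0" using less.prems by blast
  then have "i0 \<in> Basis - S" by (auto simp: S_def s_def inner_diff_left)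
  then have "S \<subset> Basis" using finS by blast
  then have kn: "card S < DIM('a)" by (intro psubset_card_mono) auto
  define good where "good a' t v' \<longleftrightarrow> convex_on (cbox a' (a' + t)) v' \<and> L-lipschitz_on (cbox a' (a' + t)) v'"
    for a' t :: 'a and v'
  \<comment> \<open>The side vector after halving along the axes in \<open>T\<close>; it
    interpolates between \<open>s\<close> for empty \<open>T\<close> and \<open>s / 2\<close> for
    \<open>T = S\<close>.\<close>
  define t where "t T = (\<Sum>i\<in>Basis. (if i \<in> T then s \<bullet> i / 2 else s \<bullet> i) *\<^sub>R i)" for T
  have t_inner: "t T \<bullet> i = (if i \<in> T then s \<bullet> i / 2 else s \<bullet> i)" if "i \<in> Basis" for T i
    using that by (simp add: t_def inner_sum_left_Basis)
  have t_nonneg: "t T \<bullet> i \<ge> 0" if "i \<in> Basis" for T i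
    using t_inner[OF that] s0[OF that] by auto
  \<comment> \<open>Each further axis in \<open>T\<close> doubles the number of pieces. The position
    \<open>a'\<close> and the function stay arbitrary because the pieces are translates carrying
    different restrictions.\<close>
  have halve: "\<bar>Z (inf_ext (cbox a' (a' + s)) v')\<bar> \<le> 2 ^ card T * M"
    if "finite T" "T \<subseteq> S" "\<And>a' v'. good a' (t T) v' \<Longrightarrow> \<bar>Z (inf_ext (cbox a' (a' + t T)) v')\<bar> \<le> M"
      "good a' s v'" for T M a' v'
    using that
  proof (induction T arbitrary: M rule: finite_induct)
    case empty
    have "t {} = s" by (simp add: t_def euclidean_representation)
    then show ?case using empty by simp
  next
    case (insert i T)
    have i: "i \<in> Basis" "s \<bullet> i > 0" using insert.prems(1) by (auto simp: S_def)
    have step: "\<bar>Z (inf_ext (cbox a' (a' + t T)) v')\<bar> \<le> 2 * M" if g: "good a' (t T) v'" for a' v'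
    proof -
      define B where "B = cbox a' (a' + t T)"
      define h where "h = s \<bullet> i / 2"
      define c where "c = a' \<bullet> i + h"
      have tTi: "t T \<bullet> i = 2 * h" using t_inner[OF i(1), of T] insert.hyps by (simp add: h_def)
      have tj: "t (insert i T) \<bullet> j = (if j = i then h else t T \<bullet> j)" if "j \<in> Basis" for j
        using t_inner[OF that] by (auto simp: h_def)
      have h: "h > 0" using i by (simp add: h_def)
      have B: "compact B" "convex_on B v'" "L-lipschitz_on B v'"
        using g by (auto simp: B_def good_def)
      define a2 where "a2 = a' + (c - a' \<bullet> i) *\<^sub>R i"
      define b2 where "b2 = a' + t T + (c - (a' + t T) \<bullet> i) *\<^sub>R i"
      have b2: "b2 = a' + t (insert i T)" and a2: "a2 = a' + h *\<^sub>R i"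
        and top: "a' + t T = a' + h *\<^sub>R i + t (insert i T)"
      proof -
        have "b2 \<bullet> j = (a' + t (insert i T)) \<bullet> j" "(a' + t T) \<bullet> j = (a' + h *\<^sub>R i + t (insert i T)) \<bullet> j"
          if j: "j \<in> Basis" for j
          using i(1) j tTi tj[OF j] by (auto simp: b2_def c_def inner_add_left inner_diff_left inner_Basis)
        then show "b2 = a' + t (insert i T)" "a' + t T = a' + h *\<^sub>R i + t (insert i T)"
          by (blast intro: euclidean_eqI)+
      qed (simp add: a2_def c_def)
      have cut: "a' \<bullet> i \<le> c" "c \<le> (a' + t T) \<bullet> i" using h tTi by (auto simp: c_def inner_add_left)
      have B1: "B \<inter> {x. x \<bullet> i \<le> c} = cbox a' (a' + t (insert i T))"
        unfolding b2[symmetric] unfolding B_def b2_def by (rule cbox_cut(1)[OF i(1) cut])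
      have "B \<inter> {x. x \<bullet> i \<ge> c} = cbox a2 (a' + t T)"
        unfolding B_def a2_def by (rule cbox_cut(2)[OF i(1) cut])
      then have B2: "B \<inter> {x. x \<bullet> i \<ge> c} = cbox (a' + h *\<^sub>R i) (a' + h *\<^sub>R i + t (insert i T))"
        by (simp only: a2 top)
      have B3: "B \<inter> {x. x \<bullet> i = c} = cbox a2 b2"
        unfolding B_def a2_def b2_def by (rule cbox_cut(3)[OF i(1) cut])
      have a2b2: "a2 \<bullet> j = (if j = i then c else a' \<bullet> j)" "b2 \<bullet> j = (if j = i then c else a' \<bullet> j + t T \<bullet> j)"
        if "j \<in> Basis" for j
        using i(1) that by (auto simp: a2_def b2_def inner_add_left inner_Basis)
      have ne: "cbox a2 b2 \<noteq> {}"
        unfolding box_ne_empty using a2b2 t_nonneg by auto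
      have "{j \<in> Basis. a2 \<bullet> j < b2 \<bullet> j} \<subseteq> S - {i}"
      proof
        fix j assume "j \<in> {j \<in> Basis. a2 \<bullet> j < b2 \<bullet> j}"
        then have j: "j \<in> Basis" "j \<noteq> i" "t T \<bullet> j > 0" using a2b2[of j] by (auto split: if_splits)
        then show "j \<in> S - {i}" using t_inner[of j T] by (auto simp: S_def split: if_splits)
      qed
      then have "card {j \<in> Basis. a2 \<bullet> j < b2 \<bullet> j} \<le> card (S - {i})"
        using finS by (intro card_mono) auto
      also have "\<dots> < card S"
        using finS insert.prems(1) by (intro psubset_card_mono) auto
      finally have lt: "card {j \<in> Basis. a2 \<bullet> j < b2 \<bullet> j} < card {j \<in> Basis. a \<bullet> j < b \<bullet> j}"
        by (simp add: S_card)
      have sub: "convex_on K v' \<and> L-lipschitz_on K v'" if "K \<subseteq> B" "convex K" for K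
        using B that by (auto intro: convex_on_subset lipschitz_on_subset)
      have Z3: "Z (inf_ext (cbox a2 b2) v') = 0"
      proof (rule less.hyps[OF lt ne])
        show "\<exists>i\<in>Basis. a2 \<bullet> i = b2 \<bullet> i" using i(1) a2b2[OF i(1)] by (intro bexI[of _ i]) auto
        have "cbox a2 b2 \<subseteq> B" using B3 by blast
        then show "convex_on (cbox a2 b2) v'" "L-lipschitz_on (cbox a2 b2) v'"
          using sub[of "cbox a2 b2"] by (auto simp: convex_box)
      qed
      have "Z (inf_ext B v') + Z (inf_ext (B \<inter> {x. x \<bullet> i = c}) v')
          = Z (inf_ext (B \<inter> {x. x \<bullet> i \<le> c}) v') + Z (inf_ext (B \<inter> {x. x \<bullet> i \<ge> c}) v')"
        using B ne B3 by (intro Z_cut) (auto intro: lipschitz_on_continuous_on)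
      moreover have "\<bar>Z (inf_ext (B \<inter> {x. x \<bullet> i \<le> c}) v')\<bar> \<le> M"
        unfolding B1 by (rule insert.prems(2)) (use sub[of "B \<inter> {x. x \<bullet> i \<le> c}"] B1 in \<open>auto simp: good_def convex_box\<close>)
      moreover have "\<bar>Z (inf_ext (B \<inter> {x. x \<bullet> i \<ge> c}) v')\<bar> \<le> M"
        unfolding B2 by (rule insert.prems(2)) (use sub[of "B \<inter> {x. x \<bullet> i \<ge> c}"] B2 in \<open>auto simp: good_def convex_box\<close>)
      ultimately have "\<bar>Z (inf_ext B v')\<bar> \<le> 2 * M" using Z3 B3 by simp
      then show ?thesis by (simp add: B_def)
    qed
    have "\<bar>Z (inf_ext (cbox a' (a' + s)) v')\<bar> \<le> 2 ^ card T * (2 * M)"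
      by (rule insert.IH) (use insert.prems step in auto)
    then show ?case using insert.hyps by simp
  qed
  have ne: "cbox 0 s \<noteq> {}" using s0 by (auto simp: box_ne_empty)
  obtain M where M: "\<And>v. convex_on (cbox 0 s) v \<Longrightarrow> L-lipschitz_on (cbox 0 s) v \<Longrightarrow> \<bar>Z (inf_ext (cbox 0 s) v)\<bar> \<le> M"
    using Z_bounded[OF compact_cbox ne] by blast
  \<comment> \<open>The supremum ranges over all admissible functions on the box at the origin.
    Halving and rescaling return to this same class, which gives
    \<open>Sup A \<le> Sup A / 2\<close> and so \<open>Sup A = 0\<close>.\<close>
  define A where "A = {\<bar>Z (inf_ext (cbox 0 s) v)\<bar> |v. convex_on (cbox 0 s) v \<and> L-lipschitz_on (cbox 0 s) v}"
  have bdd: "bdd_above A" using M by (auto simp: A_def bdd_above_def)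
  have img: "(\<lambda>z. r *\<^sub>R z + a') ` cbox 0 s = cbox a' (a' + r *\<^sub>R s)" if "r > 0" for r a'
    using that ne by (simp add: image_affinity_cbox) (simp add: add.commute)
  have scale: "\<bar>Z (inf_ext (cbox a' (a' + r *\<^sub>R s)) v')\<bar> \<le> r ^ DIM('a) * Sup A"
    if "good a' (r *\<^sub>R s) v'" "r > 0" for a' v' r
  proof -
    have v': "convex_on ((\<lambda>z. r *\<^sub>R z + a') ` cbox 0 s) v'" "L-lipschitz_on ((\<lambda>z. r *\<^sub>R z + a') ` cbox 0 s) v'"
      using that by (auto simp: good_def img)
    define w where "w = (\<lambda>z. v' (r *\<^sub>R z + a') / r)"
    have "convex_on (cbox 0 s) w" "L-lipschitz_on (cbox 0 s) w"
      unfolding w_def by (rule convex_on_affine_pullback[OF v'(1) that(2)] lipschitz_affine_pullback[OF v'(2) that(2)];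
        simp add: convex_box)+
    then have "\<bar>Z (inf_ext (cbox 0 s) w)\<bar> \<le> Sup A"
      by (intro cSup_upper bdd) (auto simp: A_def)
    moreover have "Z (inf_ext (cbox a' (a' + r *\<^sub>R s)) v') = r ^ DIM('a) * Z (inf_ext (cbox 0 s) w)"
      unfolding img[OF that(2), symmetric] w_def
      by (rule Z_affine_image) (use v' ne that in \<open>auto simp: convex_box intro: lipschitz_on_continuous_on\<close>)
    ultimately show ?thesis using that(2) by (simp add: abs_mult)
  qed
  \<comment> \<open>Axes outside \<open>S\<close> have side length 0, so halving along
    \<open>S\<close> already halves the whole box.\<close>
  have "t S = (1/2) *\<^sub>R s"
  proof (rule euclidean_eqI)
    fix i :: 'a assume i: "i \<in> Basis"
    then show "t S \<bullet> i = ((1/2) *\<^sub>R s) \<bullet> i" using t_inner[OF i, of S] s0[OF i] by (auto simp: S_def)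
  qed
  then have bS: "\<bar>Z (inf_ext (cbox a' (a' + s)) v')\<bar> \<le> 2 ^ card S * ((1/2) ^ DIM('a) * Sup A)"
    if "good a' s v'" for a' v'
    using that finS scale[of _ "1/2"] by (intro halve) auto
  have good0: "good a s v" using less.prems(3,4) by (simp add: good_def s_def)
  have "\<bar>Z (inf_ext (cbox a (a + s)) v)\<bar> \<le> Sup A"
    using scale[of a 1 v] good0 by simp
  then have A0: "Sup A \<ge> 0" by linarith
  \<comment> \<open>There are \<open>2 ^ card S\<close> pieces, each scaled by
    \<open>(1/2) ^ DIM('a)\<close>; since \<open>card S < DIM('a)\<close>, a factor 1/2 is
    gained.\<close>
  have half: "2 ^ card S * ((1/2) ^ DIM('a) * Sup A) \<le> Sup A / 2"
  proof -
    have "(2::real) ^ card S * 2 \<le> 2 ^ DIM('a)"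
      using kn power_increasing[of "Suc (card S)" "DIM('a)" "2::real"] by simp
    then have "(2::real) ^ card S * (1/2) ^ DIM('a) \<le> 1 / 2"
      by (simp add: power_divide field_simps)
    from mult_right_mono[OF this A0] show ?thesis by (simp add: mult_ac)
  qed
  have "A \<noteq> {}"
  proof -
    have "(\<lambda>z. 1 *\<^sub>R z + a) ` cbox 0 s \<subseteq> cbox a b" using img[of 1 a] by (simp add: s_def)
    then have "convex_on (cbox 0 s) (\<lambda>z. v (1 *\<^sub>R z + a) / 1)" "L-lipschitz_on (cbox 0 s) (\<lambda>z. v (1 *\<^sub>R z + a) / 1)"
      using convex_on_affine_pullback[OF less.prems(3) zero_less_one convex_box(1)]
        lipschitz_affine_pullback[OF less.prems(4) zero_less_one] by blast+
    then show ?thesis unfolding A_def by blast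
  qed
  then have "Sup A \<le> Sup A / 2"
  proof (rule cSup_least)
    fix x assume "x \<in> A"
    then obtain w where w: "x = \<bar>Z (inf_ext (cbox 0 s) w)\<bar>" "good 0 s w" by (auto simp: A_def good_def)
    then show "x \<le> Sup A / 2" using bS[OF w(2)] half by simp
  qed
  then have "Sup A = 0" using A0 by simp
  then have "\<bar>Z (inf_ext (cbox a (a + s)) v)\<bar> \<le> 0" using scale[of a 1 v] good0 by simp
  then show ?case by (simp add: s_def)
qed

text \<open>The slice common to both halves is a degenerate box and contributes nothing, so the cut
  is additive.\<close>

lemma Z_box_cut:
  assumes i: "i \<in> Basis" and c: "a \<bullet> i \<le> c" "c \<le> b \<bullet> i" and ne: "cbox a b \<noteq> {}"
    and v: "convex_on (cbox a b) v" "L-lipschitz_on (cbox a b) v"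
  shows "Z (inf_ext (cbox a b) v) =
      Z (inf_ext (cbox a b \<inter> {x. x \<bullet> i \<le> c}) v) + Z (inf_ext (cbox a b \<inter> {x. x \<bullet> i \<ge> c}) v)"
proof -
  define a2 where "a2 = a + (c - a \<bullet> i) *\<^sub>R i"
  define b2 where "b2 = b + (c - b \<bullet> i) *\<^sub>R i"
  have sl: "cbox a b \<inter> {x. x \<bullet> i = c} = cbox a2 b2"
    unfolding a2_def b2_def by (rule cbox_cut(3)[OF i c])
  have ab2: "a2 \<bullet> j = (if j = i then c else a \<bullet> j)" "b2 \<bullet> j = (if j = i then c else b \<bullet> j)"
    if "j \<in> Basis" for j
    using i that by (auto simp: a2_def b2_def inner_add_left inner_Basis)
  have ne2: "cbox a2 b2 \<noteq> {}" using ne ab2 by (auto simp: box_ne_empty)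
  have "Z (inf_ext (cbox a2 b2) v) = 0"
  proof (rule Z_degenerate[OF ne2])
    show "\<exists>i\<in>Basis. a2 \<bullet> i = b2 \<bullet> i" using i ab2[OF i] by (intro bexI[of _ i]) auto
    have "cbox a2 b2 \<subseteq> cbox a b" using sl by blast
    then show "convex_on (cbox a2 b2) v" "L-lipschitz_on (cbox a2 b2) v"
      using v by (auto intro: convex_on_subset lipschitz_on_subset simp: convex_box)
  qed
  then show ?thesis
    using Z_cut[OF compact_cbox v(1) lipschitz_on_continuous_on[OF v(2)], of i c] ne2 sl by simp
qed

end

section \<open>Localization on the unit cube\<close>

definition grid_point :: "('a::euclidean_space \<Rightarrow> nat) \<Rightarrow> 'a" where
  "grid_point f = (\<Sum>i\<in>Basis. real (f i) *\<^sub>R i)"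

text \<open>Given as an affine image of the unit cube, the shape to which the scaling law of
  \<open>Z\<close> applies directly.\<close>

definition grid_cell :: "nat \<Rightarrow> ('a::euclidean_space \<Rightarrow> nat) \<Rightarrow> 'a set" where
  "grid_cell N f = (\<lambda>z. inverse (real N) *\<^sub>R z + inverse (real N) *\<^sub>R grid_point f) ` cbox 0 One"

text \<open>Extensional functions make an index determined by its values on \<open>Basis\<close>, so
  distinct indices have distinct cells.\<close>

definition grid_index :: "nat \<Rightarrow> ('a::euclidean_space \<Rightarrow> nat) set" where
  "grid_index N = PiE Basis (\<lambda>_. {..<N})"

lemma grid_point_inner [simp]: "i \<in> Basis \<Longrightarrow> grid_point f \<bullet> i = real (f i)"
  by (simp add: grid_point_def inner_sum_left_Basis)

lemma unit_cube_nonempty [simp]: "cbox (0::'a::euclidean_space) One \<noteq> {}"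
  by (simp add: box_ne_empty)

lemma grid_cell_cbox:
  assumes "N > 0"
  shows "grid_cell N f = cbox (inverse (real N) *\<^sub>R grid_point f) (inverse (real N) *\<^sub>R (grid_point f + One))"
  using assms unfolding grid_cell_def image_affinity_cbox
  by (simp add: scaleR_add_right add.commute)

lemma mem_grid_cell:
  assumes "N > 0"
  shows "x \<in> grid_cell N f \<longleftrightarrow> (\<forall>i\<in>Basis. real (f i) \<le> real N * (x \<bullet> i) \<and> real N * (x \<bullet> i) \<le> real (f i) + 1)"
  using assms by (auto simp: grid_cell_cbox mem_box inner_add_left field_simps)

lemma mem_interior_grid_cell:
  assumes "N > 0"
  shows "x \<in> interior (grid_cell N f) \<longleftrightarrow> (\<forall>i\<in>Basis. real (f i) < real N * (x \<bullet> i) \<and> real N * (x \<bullet> i) < real (f i) + 1)"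
  using assms by (auto simp: grid_cell_cbox interior_cbox mem_box inner_add_left field_simps)

lemma interior_grid_cell_unique:
  assumes N: "N > 0" and f: "f \<in> grid_index N" "f' \<in> grid_index N"
    and x: "x \<in> interior (grid_cell N f)" "x \<in> interior (grid_cell N f')"
  shows "f = f'"
proof (rule PiE_ext)
  show "f \<in> PiE Basis (\<lambda>_. {..<N})" "f' \<in> PiE Basis (\<lambda>_. {..<N})"
    using f by (auto simp: grid_index_def)
  fix i :: 'a assume i: "i \<in> Basis"
  have "real (f i) < real (f' i) + 1" "real (f' i) < real (f i) + 1"
    using x i unfolding mem_interior_grid_cell[OF N] by force+
  then show "f i = f' i" by linarith
qed

lemma interior_grid_cell_nonempty:
  assumes N: "N > 0"
  shows "interior (grid_cell N f) \<noteq> {}"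
proof -
  have "inverse (real N) *\<^sub>R (grid_point f + (1/2) *\<^sub>R One) \<in> interior (grid_cell N f)"
    using N by (auto simp: mem_interior_grid_cell inner_add_left simp flip: mult.assoc)
  then show ?thesis by blast
qed

lemma finite_grid_index: "finite (grid_index N)"
  unfolding grid_index_def by (intro finite_PiE) auto

lemma inj_on_grid_cell:
  assumes "N > 0"
  shows "inj_on (grid_cell N) (grid_index N)"
  using interior_grid_cell_unique[OF assms] interior_grid_cell_nonempty[OF assms]
  by (metis (no_types, lifting) all_not_in_conv inj_onI)

lemma grid_cell_subset:
  assumes N: "N > 0" and f: "f \<in> grid_index N"
  shows "grid_cell N f \<subseteq> cbox 0 One"
proof
  fix x assume "x \<in> grid_cell N f"
  then have x: "real (f i) \<le> real N * (x \<bullet> i)" "real N * (x \<bullet> i) \<le> real (f i) + 1" if "i \<in> Basis" for i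
    using that unfolding mem_grid_cell[OF N] by auto
  have "0 \<le> x \<bullet> i \<and> x \<bullet> i \<le> 1" if i: "i \<in> Basis" for i
  proof
    have "0 \<le> real N * (x \<bullet> i)" using x(1)[OF i] of_nat_0_le_iff order_trans by blast
    then show "0 \<le> x \<bullet> i" using N by (simp add: zero_le_mult_iff)
    have "f i < N" using f i by (auto simp: grid_index_def)
    then have "real N * (x \<bullet> i) \<le> real N * 1" using x(2)[OF i] by linarith
    then show "x \<bullet> i \<le> 1" using N by (simp only: mult_le_cancel_left_pos of_nat_0_less_iff)
  qed
  then show "x \<in> cbox 0 One" by (auto simp: mem_box)
qed

lemma grid_division:
  assumes N: "N > 0"
  shows "grid_cell N ` grid_index N division_of (cbox 0 (One::'a::euclidean_space))"
proof (rule division_ofI)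
  show "finite (grid_cell N ` grid_index N)" using finite_grid_index by blast
next
  fix K :: "'a set" assume "K \<in> grid_cell N ` grid_index N"
  then obtain f where f: "f \<in> grid_index N" "K = grid_cell N f" by blast
  show "K \<noteq> {}" using f interior_grid_cell_nonempty[OF N, of f] interior_subset by blast
  show "\<exists>a b. K = cbox a b" using f grid_cell_cbox[OF N] by blast
  show "K \<subseteq> cbox 0 One" using f grid_cell_subset[OF N] by blast
next
  fix K K' :: "'a set"
  assume "K \<in> grid_cell N ` grid_index N" "K' \<in> grid_cell N ` grid_index N" "K \<noteq> K'"
  then show "interior K \<inter> interior K' = {}" using interior_grid_cell_unique[OF N] by blast
next
  show "\<Union> (grid_cell N ` grid_index N) = cbox 0 (One::'a)"
  proof (intro equalityI subsetI)
    fix x :: 'a assume "x \<in> \<Union> (grid_cell N ` grid_index N)"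
    then show "x \<in> cbox 0 One" using grid_cell_subset[OF N] by blast
  next
    fix x :: 'a assume "x \<in> cbox 0 One"
    then have x: "0 \<le> x \<bullet> i" "x \<bullet> i \<le> 1" if "i \<in> Basis" for i
      using that by (auto simp: mem_box)
    \<comment> \<open>The cap \<open>N - 1\<close> assigns points of the upper faces, where the
      floor would be \<open>N\<close>, to the last cell.\<close>
    define f where "f = restrict (\<lambda>i. min (nat \<lfloor>real N * (x \<bullet> i)\<rfloor>) (N - 1)) Basis"
    have "f \<in> grid_index N" using N by (auto simp: f_def grid_index_def)
    moreover have "x \<in> grid_cell N f"
      unfolding mem_grid_cell[OF N]
    proof
      fix i :: 'a assume i: "i \<in> Basis"
      define y where "y = real N * (x \<bullet> i)"
      have y: "0 \<le> y" "y \<le> real N" using x[OF i] N by (auto simp: y_def mult_left_le)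
      have "real (nat \<lfloor>y\<rfloor>) \<le> y" "y < real (nat \<lfloor>y\<rfloor>) + 1" using y by linarith+
      moreover have "f i = min (nat \<lfloor>y\<rfloor>) (N - 1)" using i by (simp add: f_def y_def)
      moreover have "real (N - 1) = real N - 1" using N by simp
      ultimately have "real (f i) \<le> y \<and> y \<le> real (f i) + 1"
      proof (cases "nat \<lfloor>y\<rfloor> \<le> N - 1")
        case True
        then have "f i = nat \<lfloor>y\<rfloor>" using \<open>f i = _\<close> by simp
        then show ?thesis using \<open>real (nat \<lfloor>y\<rfloor>) \<le> y\<close> \<open>y < real (nat \<lfloor>y\<rfloor>) + 1\<close> by simp
      next
        case False
        then have "f i = N - 1" "N \<le> nat \<lfloor>y\<rfloor>" using \<open>f i = _\<close> by auto
        then have "real N \<le> real (nat \<lfloor>y\<rfloor>)" "real (f i) = real N - 1"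
          using \<open>real (N - 1) = real N - 1\<close> by auto
        then show ?thesis using y \<open>real (nat \<lfloor>y\<rfloor>) \<le> y\<close> by linarith
      qed
      then show "real (f i) \<le> real N * (x \<bullet> i) \<and> real N * (x \<bullet> i) \<le> real (f i) + 1"
        by (simp add: y_def)
    qed
    ultimately show "x \<in> \<Union> (grid_cell N ` grid_index N)" by blast
  qed
qed

lemma measure_interior_grid_cell:
  fixes f :: "'a::euclidean_space \<Rightarrow> nat"
  assumes N: "N > 0"
  shows "measure lebesgue (interior (grid_cell N f)) = inverse (real N) ^ DIM('a)"
proof -
  have "measure lebesgue (interior (grid_cell N f)) = measure lborel (interior (grid_cell N f))"
    by simp
  also have "\<dots> = (\<Prod>i\<in>(Basis::'a set). inverse (real N))"
    unfolding grid_cell_cbox[OF N] interior_cbox using N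
    by (subst measure_lborel_box) (auto simp: inner_add_left inner_diff_left algebra_simps intro!: prod.cong)
  finally have "measure lebesgue (interior (grid_cell N f)) = (\<Prod>i\<in>(Basis::'a set). inverse (real N))" .
  then show ?thesis by simp
qed

lemma convex_on_inner: "convex S \<Longrightarrow> convex_on S (\<lambda>z. y \<bullet> z)"
  by (intro convex_onI) (auto simp: inner_add_right)

lemma lipschitz_on_inner: "(norm y)-lipschitz_on S (\<lambda>z. y \<bullet> z)"
proof (rule lipschitz_onI)
  fix x z show "dist (y \<bullet> x) (y \<bullet> z) \<le> norm y * dist x z"
    using Cauchy_Schwarz_ineq2[of y "x - z"] by (simp add: dist_norm inner_diff_right)
qed simp

section \<open>The density and its recovery by blowing up\<close>

context epi_valuation
begin

definition zeta :: "'a \<Rightarrow> real" where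
  "zeta y = Z (inf_ext (cbox 0 One) (\<lambda>z. y \<bullet> z))"

lemma inf_ext_inner_Conv_sc: "inf_ext (cbox 0 One) (\<lambda>z. y \<bullet> z) \<in> Conv_sc"
  by (intro inf_ext_Conv_sc convex_on_inner continuous_intros) (auto simp: convex_box)

lemma continuous_on_zeta: "continuous_on UNIV zeta"
  unfolding continuous_on_sequentially
proof (intro ballI allI impI, elim conjE)
  fix D :: 'a and Dk assume Dk: "Dk \<longlonglongrightarrow> D"
  obtain K where K: "\<And>z::'a. z \<in> cbox 0 One \<Longrightarrow> norm z \<le> K"
    using bounded_cbox[of "0::'a" One] by (auto simp: bounded_iff)
  have "(\<lambda>k. norm (Dk k - D) * K) \<longlonglongrightarrow> norm (D - D) * K"
    by (intro tendsto_intros Dk)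
  then have lim: "(\<lambda>k. norm (Dk k - D) * K) \<longlonglongrightarrow> 0" by simp
  have "epi_converges (\<lambda>k. inf_ext (cbox 0 One) (\<lambda>z. Dk k \<bullet> z)) (inf_ext (cbox 0 One) (\<lambda>z. D \<bullet> z))"
  proof (rule epi_converges_ext)
    fix e :: real assume "e > 0"
    then have "\<forall>\<^sub>F k in sequentially. norm (Dk k - D) * K < e"
      using order_tendstoD(2)[OF lim] by blast
    then show "\<forall>\<^sub>F k in sequentially. \<forall>z\<in>cbox 0 One. \<bar>Dk k \<bullet> z - D \<bullet> z\<bar> < e"
    proof (eventually_elim, intro ballI)
      fix k and z :: 'a assume k: "norm (Dk k - D) * K < e" and z: "z \<in> cbox 0 One"
      have "\<bar>Dk k \<bullet> z - D \<bullet> z\<bar> \<le> norm (Dk k - D) * norm z"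
        using Cauchy_Schwarz_ineq2[of "Dk k - D" z] by (simp add: inner_diff_left)
      also have "\<dots> \<le> norm (Dk k - D) * K" using K[OF z] by (intro mult_left_mono) auto
      finally show "\<bar>Dk k \<bullet> z - D \<bullet> z\<bar> < e" using k by simp
    qed
  qed (auto intro!: continuous_intros)
  then show "(zeta \<circ> Dk) \<longlonglongrightarrow> zeta D"
    unfolding zeta_def o_def by (intro Z_tendsto inf_ext_inner_Conv_sc)
qed

text \<open>An \<open>operative\<close> set function is additive over every division of a box; what
  has to be checked is vanishing on boxes with empty interior and additivity under one hyperplane
  cut. The value at the empty set is prescribed as 0, since \<open>inf_ext {} v\<close> is
  identically infinite and lies outside \<open>Conv_sc\<close>.\<close>

lemma operative_Z:
  assumes v: "convex_on UNIV v" "L-lipschitz_on UNIV v"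
  shows "operative (+) 0 (\<lambda>K. if K = {} then 0 else Z (inf_ext K v))"
proof
  have sub: "convex_on K v \<and> L-lipschitz_on K v \<and> continuous_on K v" if "convex K" for K
    using v that convex_on_subset[OF v(1)] lipschitz_on_subset[OF v(2)] lipschitz_on_continuous_on by blast
  fix a b :: 'a
  show "(if cbox a b = {} then 0 else Z (inf_ext (cbox a b) v)) = 0" if e: "box a b = {}"
  proof (cases "cbox a b = {}")
    case False
    obtain i where i: "i \<in> Basis" "b \<bullet> i \<le> a \<bullet> i" using e by (auto simp: box_eq_empty)
    moreover have "a \<bullet> i \<le> b \<bullet> i" using False i by (auto simp: box_ne_empty)
    ultimately have "a \<bullet> i = b \<bullet> i" by simp
    then have "Z (inf_ext (cbox a b) v) = 0"
      using Z_degenerate[OF False _ conjunct1[OF sub] conjunct1[OF conjunct2[OF sub]]] i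
      by (auto simp: convex_box)
    then show ?thesis by simp
  qed simp
  fix c and i :: 'a assume i: "i \<in> Basis"
  define B where "B = cbox a b"
  define g where "g K = (if K = {} then 0 else Z (inf_ext K v))" for K :: "'a set"
  have "g B = g (B \<inter> {x. x \<bullet> i \<le> c}) + g (B \<inter> {x. x \<bullet> i \<ge> c})"
  proof (cases "B \<inter> {x. x \<bullet> i \<le> c} = {} \<or> B \<inter> {x. x \<bullet> i \<ge> c} = {}")
    case True
    then have "(B \<inter> {x. x \<bullet> i \<le> c} = {} \<and> B \<inter> {x. x \<bullet> i \<ge> c} = B) \<or>
      (B \<inter> {x. x \<bullet> i \<ge> c} = {} \<and> B \<inter> {x. x \<bullet> i \<le> c} = B)" by force
    then show ?thesis by (auto simp: g_def)
  next
    case False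
    then obtain x y where xy: "x \<in> B" "x \<bullet> i \<le> c" "y \<in> B" "c \<le> y \<bullet> i" by blast
    then have c: "a \<bullet> i \<le> c" "c \<le> b \<bullet> i"
      using i by (auto simp: B_def mem_box intro: order_trans)
    have "Z (inf_ext B v) = Z (inf_ext (B \<inter> {x. x \<bullet> i \<le> c}) v) + Z (inf_ext (B \<inter> {x. x \<bullet> i \<ge> c}) v)"
      unfolding B_def by (rule Z_box_cut[OF i c]) (use sub[of B] xy in \<open>auto simp: B_def convex_box\<close>)
    moreover have "B \<noteq> {}" using xy by blast
    ultimately show ?thesis using False by (auto simp: g_def)
  qed
  then show "(if cbox a b = {} then 0 else Z (inf_ext (cbox a b) v))
      = (if cbox a b \<inter> {x. x \<bullet> i \<le> c} = {} then 0 else Z (inf_ext (cbox a b \<inter> {x. x \<bullet> i \<le> c}) v))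
      + (if cbox a b \<inter> {x. c \<le> x \<bullet> i} = {} then 0 else Z (inf_ext (cbox a b \<inter> {x. c \<le> x \<bullet> i}) v))"
    by (simp only: g_def B_def)
qed

lemma Z_grid_sum:
  assumes v: "convex_on UNIV v" "L-lipschitz_on UNIV v" and N: "N > 0"
  shows "Z (inf_ext (cbox 0 One) v) = (\<Sum>f\<in>grid_index N. Z (inf_ext (grid_cell N f) v))"
proof -
  interpret operative "(+)" 0 "\<lambda>K. if K = {} then 0 else Z (inf_ext K v)"
    by (rule operative_Z[OF v])
  have "sum (\<lambda>K. if K = {} then 0 else Z (inf_ext K v)) (grid_cell N ` grid_index N)
      = (if cbox 0 (One::'a) = {} then 0 else Z (inf_ext (cbox 0 One) v))"
    using division[OF grid_division[OF N]] by (simp add: sum_def)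
  moreover have "grid_cell N f \<noteq> {}" for f :: "'a \<Rightarrow> nat"
    by (simp add: grid_cell_def)
  ultimately show ?thesis by (simp add: sum.reindex[OF inj_on_grid_cell[OF N]])
qed

text \<open>After multiplication by the number of cells, the value on a cell is \<open>Z\<close> at
  a function on the unit cube from the same \<open>L\<close>-Lipschitz class, hence bounded
  independently of \<open>N\<close> and of the cell.\<close>

lemma Z_grid_cell:
  assumes v: "convex_on UNIV v" "L-lipschitz_on UNIV v" and N: "N > 0"
  defines "w \<equiv> \<lambda>f z. v (inverse (real N) *\<^sub>R z + inverse (real N) *\<^sub>R grid_point f) / inverse (real N)"
  shows "real N ^ DIM('a) * Z (inf_ext (grid_cell N f) v) = Z (inf_ext (cbox 0 One) (w f))"
    and "convex_on (cbox 0 One) (w f)" "L-lipschitz_on (cbox 0 One) (w f)"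
proof -
  have sub: "convex_on (grid_cell N f) v" "L-lipschitz_on (grid_cell N f) v"
    using v N by (auto intro: convex_on_subset lipschitz_on_subset simp: grid_cell_cbox convex_box)
  have "Z (inf_ext (grid_cell N f) v) = inverse (real N) ^ DIM('a) * Z (inf_ext (cbox 0 One) (w f))"
    unfolding grid_cell_def w_def
    by (rule Z_affine_image)
      (use N sub in \<open>auto simp: convex_box grid_cell_def intro: lipschitz_on_continuous_on\<close>)
  then show "real N ^ DIM('a) * Z (inf_ext (grid_cell N f) v) = Z (inf_ext (cbox 0 One) (w f))"
    using N by (simp add: power_inverse field_simps)
  show "convex_on (cbox 0 One) (w f)" "L-lipschitz_on (cbox 0 One) (w f)"
    unfolding w_def using N
    by (auto intro!: convex_on_affine_pullback[OF v(1)] lipschitz_affine_pullback[OF v(2)] simp: convex_box)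
qed

text \<open>Blowing up the cell around a point of differentiability turns \<open>v\<close> into its linear part.\<close>

lemma Z_grid_cell_tendsto:
  assumes v: "convex_on UNIV v" "L-lipschitz_on UNIV v" and D: "GDERIV v x :> D"
    and f: "\<And>N. N > 0 \<Longrightarrow> x \<in> grid_cell N (f N)"
  shows "(\<lambda>N. real (Suc N) ^ DIM('a) * Z (inf_ext (grid_cell (Suc N) (f (Suc N))) v)) \<longlonglongrightarrow> zeta D"
proof -
  define r where "r N = inverse (real (Suc N))" for N
  define q where "q N = grid_point (f (Suc N))" for N
  \<comment> \<open>The position of \<open>x\<close> inside its cell, in units of the cell. It need
    not converge as \<open>N\<close> grows, and the constant in \<open>w'\<close> compensates for
    it.\<close>
  define \<theta> where "\<theta> N = real (Suc N) *\<^sub>R x - q N" for N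
  define w where "w N z = v (r N *\<^sub>R z + r N *\<^sub>R q N) / r N" for N z
  \<comment> \<open>The added constant is chosen so that \<open>w' N z - D \<bullet> z\<close> is
    the first-order remainder of \<open>v\<close> at \<open>x\<close> divided by \<open>r N\<close>;
    \<open>Z\<close> does not notice it.\<close>
  define w' where "w' N z = w N z + (D \<bullet> \<theta> N - v x / r N)" for N z
  have r: "r N > 0" for N by (simp add: r_def)
  have xq: "x = r N *\<^sub>R (\<theta> N + q N)" for N by (simp add: \<theta>_def r_def)
  obtain K where K: "\<And>z::'a. z \<in> cbox 0 One \<Longrightarrow> norm z \<le> K"
    using bounded_cbox[of "0::'a" One] by (auto simp: bounded_iff)
  have K0: "K \<ge> 0" using K[of 0] by (simp add: mem_box)
  have \<theta>: "\<theta> N \<in> cbox 0 One" for N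
    using f[of "Suc N"] unfolding mem_grid_cell[OF zero_less_Suc]
    by (auto simp: mem_box \<theta>_def q_def inner_diff_left)
  have wc: "convex_on (cbox 0 One) (w N)" "L-lipschitz_on (cbox 0 One) (w N)"
    and wZ: "real (Suc N) ^ DIM('a) * Z (inf_ext (grid_cell (Suc N) (f (Suc N))) v) = Z (inf_ext (cbox 0 One) (w N))" for N
    using Z_grid_cell[OF v, of "Suc N" "f (Suc N)"] by (auto simp: w_def[abs_def] r_def q_def)
  have wsc: "inf_ext (cbox 0 One) (w N) \<in> Conv_sc" for N
    by (intro inf_ext_Conv_sc wc lipschitz_on_continuous_on[OF wc(2)]) auto
  have w'sc: "inf_ext (cbox 0 One) (w' N) \<in> Conv_sc" for N
    unfolding w'_def
    by (intro inf_ext_Conv_sc convex_on_add wc continuous_intros lipschitz_on_continuous_on[OF wc(2)])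
      (auto simp: convex_on_const convex_box)
  have "Z (inf_ext (cbox 0 One) (w' N)) = Z (inf_ext (cbox 0 One) (w N))" for N
    unfolding w'_def by (rule Z_add_const[OF wsc])
  moreover have "(\<lambda>N. Z (inf_ext (cbox 0 One) (w' N))) \<longlonglongrightarrow> zeta D"
    unfolding zeta_def
  proof (intro Z_tendsto w'sc inf_ext_inner_Conv_sc epi_converges_ext)
    fix e :: real assume e: "e > 0"
    \<comment> \<open>Two points of the cube are at distance at most \<open>2 * K\<close>; the 1
      keeps the divisor in \<open>\<epsilon>\<close> positive.\<close>
    define K' where "K' = 2 * K + 1"
    have K': "K' > 0" using K0 by (simp add: K'_def)
    define \<epsilon> where "\<epsilon> = e / K' / 2"
    have \<epsilon>: "\<epsilon> > 0" using e K' by (simp add: \<epsilon>_def)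
    obtain \<delta> where \<delta>: "\<delta> > 0"
      "\<And>y. norm (y - x) < \<delta> \<Longrightarrow> \<bar>v y - v x - (y - x) \<bullet> D\<bar> \<le> \<epsilon> * norm (y - x)"
      using D \<epsilon> unfolding gderiv_def has_derivative_at_alt by (metis real_norm_def)
    have "(\<lambda>N. r N * (2 * K)) \<longlonglongrightarrow> 0 * (2 * K)"
      unfolding r_def by (intro tendsto_intros LIMSEQ_inverse_real_of_nat)
    then have "\<forall>\<^sub>F N in sequentially. r N * (2 * K) < \<delta>"
      using order_tendstoD(2)[of _ 0 sequentially \<delta>] \<delta>(1) by simp
    then show "\<forall>\<^sub>F N in sequentially. \<forall>z\<in>cbox 0 One. \<bar>w' N z - D \<bullet> z\<bar> < e"
    proof (eventually_elim, intro ballI)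
      fix N and z :: 'a assume N: "r N * (2 * K) < \<delta>" and z: "z \<in> cbox 0 One"
      define h where "h = r N *\<^sub>R (z - \<theta> N)"
      have "norm (z - \<theta> N) \<le> 2 * K"
        using norm_triangle_ineq4[of z "\<theta> N"] K[OF z] K[OF \<theta>[of N]] by linarith
      then have h: "norm h \<le> r N * (2 * K)" using r[of N] by (simp add: h_def)
      have y: "r N *\<^sub>R z + r N *\<^sub>R q N = x + h"
      proof -
        have "r N *\<^sub>R z + r N *\<^sub>R q N = r N *\<^sub>R (\<theta> N + q N) + r N *\<^sub>R (z - \<theta> N)"
          by (simp add: algebra_simps)
        then show ?thesis using xq[of N] by (simp add: h_def)
      qed
      have hD: "h \<bullet> D = r N * (D \<bullet> z - D \<bullet> \<theta> N)"
        by (simp add: h_def inner_diff_right inner_commute)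
      have "r N * (w' N z - D \<bullet> z) = v (x + h) - v x - h \<bullet> D"
        unfolding w'_def w_def y hD using r[of N] by (simp add: field_simps)
      then have "r N * \<bar>w' N z - D \<bullet> z\<bar> = \<bar>v (x + h) - v x - h \<bullet> D\<bar>"
        using r[of N] by (metis abs_mult abs_of_pos)
      also have "\<dots> \<le> \<epsilon> * norm h" using \<delta>(2)[of "x + h"] h N by simp
      also have "\<dots> \<le> \<epsilon> * (r N * (2 * K))" using h \<epsilon> by (intro mult_left_mono) auto
      also have "\<dots> = r N * (\<epsilon> * (2 * K))" by simp
      finally have "\<bar>w' N z - D \<bullet> z\<bar> \<le> \<epsilon> * (2 * K)" using r[of N] by simp
      also have "\<dots> \<le> \<epsilon> * K'" using \<epsilon> by (simp add: K'_def)
      also have "\<dots> = e / 2" using K' by (simp add: \<epsilon>_def)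
      also have "\<dots> < e" using e by simp
      finally show "\<bar>w' N z - D \<bullet> z\<bar> < e" .
    qed
  qed (auto intro!: continuous_intros)
  ultimately show ?thesis unfolding wZ by simp
qed

text \<open>The step function \<open>T N\<close>, equal to the rescaled value of \<open>Z\<close> on
  the interior of each cell, has integral exactly \<open>Z (inf_ext Q v)\<close> for every
  \<open>N\<close>. Its dominated pointwise limit must therefore have the same integral. Since
  \<open>v\<close> is Lipschitz, a constant multiple of the indicator of the cube dominates.\<close>

lemma Z_unit_cube:
  assumes v: "convex_on UNIV v" "L-lipschitz_on UNIV v"
  shows "Z (inf_ext (cbox 0 One) v) = grad_integral zeta (inf_ext (cbox 0 One) v)"
proof -
  define Q where "Q = cbox (0::'a) One"
  define T where "T N x = (\<Sum>f\<in>grid_index (Suc N). real (Suc N) ^ DIM('a) * Z (inf_ext (grid_cell (Suc N) f) v)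
      * indicator (interior (grid_cell (Suc N) f)) x)" for N x
  have cQ: "continuous_on Q v" and vQ: "convex_on Q v"
    using lipschitz_on_continuous_on[OF v(2)] v(1)
    by (auto intro: continuous_on_subset convex_on_subset simp: Q_def convex_box)
  then have uC: "inf_ext Q v \<in> Conv" unfolding Q_def by (intro Conv_sc_Conv inf_ext_Conv_sc) auto
  obtain M where M: "\<And>w. convex_on Q w \<Longrightarrow> L-lipschitz_on Q w \<Longrightarrow> \<bar>Z (inf_ext Q w)\<bar> \<le> M"
    using Z_bounded[of Q L] by (auto simp: Q_def)
  have "L-lipschitz_on Q v" by (rule lipschitz_on_subset[OF v(2)]) simp
  then have M0: "M \<ge> 0" using M[OF vQ] by linarith
  have T_in: "T N x = real (Suc N) ^ DIM('a) * Z (inf_ext (grid_cell (Suc N) f) v)"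
    if "f \<in> grid_index (Suc N)" "x \<in> interior (grid_cell (Suc N) f)" for N x f
  proof -
    have "T N x = (\<Sum>g\<in>grid_index (Suc N). if g = f then real (Suc N) ^ DIM('a) * Z (inf_ext (grid_cell (Suc N) g) v) else 0)"
      unfolding T_def
    proof (intro sum.cong refl)
      fix g :: "'a \<Rightarrow> nat" assume g: "g \<in> grid_index (Suc N)"
      show "real (Suc N) ^ DIM('a) * Z (inf_ext (grid_cell (Suc N) g) v) * indicator (interior (grid_cell (Suc N) g)) x
          = (if g = f then real (Suc N) ^ DIM('a) * Z (inf_ext (grid_cell (Suc N) g) v) else 0)"
      proof (cases "g = f")
        case False
        then have "x \<notin> interior (grid_cell (Suc N) g)"
          using interior_grid_cell_unique[OF zero_less_Suc g that(1) _ that(2)] by blast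
        then show ?thesis using False by simp
      qed (use that(2) in simp)
    qed
    then show ?thesis using that(1) by (simp add: finite_grid_index)
  qed
  have T_out: "T N x = 0" if "\<And>f. f \<in> grid_index (Suc N) \<Longrightarrow> x \<notin> interior (grid_cell (Suc N) f)" for N x
    unfolding T_def using that by (intro sum.neutral) auto
  have cell_sub: "grid_cell (Suc N) f \<subseteq> Q" if "f \<in> grid_index (Suc N)" for N f
    using grid_cell_subset[OF zero_less_Suc that] by (simp add: Q_def)
  have T_bound: "norm (T N x) \<le> M * indicator Q x" for N x
  proof (cases "\<exists>f\<in>grid_index (Suc N). x \<in> interior (grid_cell (Suc N) f)")
    case True
    then obtain f where f: "f \<in> grid_index (Suc N)" "x \<in> interior (grid_cell (Suc N) f)" by blast
    then have "x \<in> Q" using cell_sub interior_subset by blast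
    moreover have "\<bar>T N x\<bar> \<le> M"
      unfolding T_in[OF f] Z_grid_cell(1)[OF v zero_less_Suc]
      using Z_grid_cell(2,3)[OF v zero_less_Suc] M unfolding Q_def by blast
    ultimately show ?thesis by simp
  next
    case False
    then show ?thesis using T_out[of N x] M0 by (auto simp: indicator_def)
  qed
  have fin: "emeasure lebesgue (interior (grid_cell (Suc N) f)) < \<infinity>" for N and f :: "'a \<Rightarrow> nat"
    by (simp add: grid_cell_cbox interior_cbox emeasure_lborel_box_finite del: infinity_ennreal_def)
  have int_ind: "integrable lebesgue (\<lambda>x. indicator (interior (grid_cell (Suc N) f)) x :: real)" for N and f :: "'a \<Rightarrow> nat"
    by (intro integrable_real_indicator) (use fin[of N f] in auto)
  have T_int: "(\<integral>x. T N x \<partial>lebesgue) = Z (inf_ext Q v)" for N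
  proof -
    have "(\<integral>x. T N x \<partial>lebesgue) = (\<Sum>f\<in>grid_index (Suc N). real (Suc N) ^ DIM('a) * Z (inf_ext (grid_cell (Suc N) f) v)
        * measure lebesgue (interior (grid_cell (Suc N) f)))"
      unfolding T_def using int_ind[of N]
      by (subst Bochner_Integration.integral_sum) (auto intro!: integrable_mult_right sum.cong)
    also have "\<dots> = (\<Sum>f\<in>grid_index (Suc N). Z (inf_ext (grid_cell (Suc N) f) v))"
    proof (intro sum.cong refl)
      fix f :: "'a \<Rightarrow> nat"
      have "real (Suc N) ^ DIM('a) * inverse (real (Suc N)) ^ DIM('a) = 1"
        by (simp flip: power_mult_distrib)
      then show "real (Suc N) ^ DIM('a) * Z (inf_ext (grid_cell (Suc N) f) v)
        * measure lebesgue (interior (grid_cell (Suc N) f)) = Z (inf_ext (grid_cell (Suc N) f) v)"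
        unfolding measure_interior_grid_cell[OF zero_less_Suc] by (simp add: mult.commute mult.left_commute del: of_nat_Suc)
    qed
    finally show ?thesis unfolding Q_def using Z_grid_sum[OF v zero_less_Suc] by simp
  qed
  have T_meas: "T N \<in> borel_measurable lebesgue" for N
  proof -
    have [measurable]: "interior S \<in> sets borel" for S :: "'a set" by (rule borel_open) simp
    have "T N \<in> borel_measurable lborel" unfolding T_def[abs_def] by measurable
    then show ?thesis by (rule measurable_completion)
  qed
  \<comment> \<open>Cell walls have rational coordinates, so off this one null set a point of the
    cube is interior to a cell of every grid.\<close>
  have irr: "AE x::'a in lebesgue. \<forall>i\<in>Basis. x \<bullet> i \<notin> \<rat>"
  proof (rule AE_finite_allI)
    fix i :: 'a assume i: "i \<in> Basis"
    have "AE x::'a in lebesgue. \<forall>c\<in>\<rat>. x \<notin> {x. x \<bullet> i = c}"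
    proof (rule AE_ball_countable'[OF _ countable_rat])
      fix c :: real
      show "AE x::'a in lebesgue. x \<notin> {x. x \<bullet> i = c}"
        using negligible_standard_hyperplane[OF i, of c]
        by (intro AE_not_in) (simp add: negligible_iff_null_sets)
    qed
    then show "AE x::'a in lebesgue. x \<bullet> i \<notin> \<rat>" by eventually_elim auto
  qed simp
  have lim: "AE x in lebesgue. (\<lambda>N. T N x) \<longlonglongrightarrow> indicator (eff_dom (inf_ext Q v)) x * zeta (egrad (inf_ext Q v) x)"
    using irr AE_has_egrad[OF uC]
  proof eventually_elim
    case (elim x)
    show ?case
    proof (cases "x \<in> Q")
      case False
      then have "T N x = 0" for N using cell_sub interior_subset by (intro T_out) blast
      then show ?thesis using False by simp
    next
      case True
      then have eg: "has_egrad (inf_ext Q v) x (egrad (inf_ext Q v) x)" using elim by simp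
      have "GDERIV v x :> egrad (inf_ext Q v) x"
      proof -
        have "(rpart (inf_ext Q v) has_derivative (\<lambda>h. h \<bullet> egrad (inf_ext Q v) x)) (at x)" "x \<in> interior Q"
          using eg by (auto simp: has_egrad_def gderiv_def)
        then have "(v has_derivative (\<lambda>h. h \<bullet> egrad (inf_ext Q v) x)) (at x)"
          by (rule has_derivative_transform_within_open[OF _ open_interior])
            (use interior_subset in \<open>auto simp: inf_ext_def\<close>)
        then show ?thesis by (simp add: gderiv_def)
      qed
      \<comment> \<open>The index of the cell containing \<open>x\<close>. Irrational coordinates
        put \<open>x\<close> strictly between consecutive grid planes.\<close>
      define f where "f N = restrict (\<lambda>i. nat \<lfloor>real N * (x \<bullet> i)\<rfloor>) Basis" for N
      have f: "f N \<in> grid_index N" "x \<in> interior (grid_cell N (f N))" if N: "N > 0" for N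
      proof -
        have i: "0 < real N * (x \<bullet> i)" "real N * (x \<bullet> i) < real N" "real N * (x \<bullet> i) \<notin> \<int>" if "i \<in> Basis" for i
        proof -
          have "0 \<le> x \<bullet> i" "x \<bullet> i \<le> 1" "x \<bullet> i \<notin> \<rat>"
            using True that elim(1) by (auto simp: Q_def mem_box)
          moreover from this have "x \<bullet> i \<noteq> 0" "x \<bullet> i \<noteq> 1" by auto
          ultimately show "0 < real N * (x \<bullet> i)" "real N * (x \<bullet> i) < real N" using N by auto
          show "real N * (x \<bullet> i) \<notin> \<int>"
          proof
            assume "real N * (x \<bullet> i) \<in> \<int>"
            then have "real N * (x \<bullet> i) / real N \<in> \<rat>" by (intro Rats_divide) (auto simp: Ints_subset_Rats[THEN subsetD])
            then show False using N \<open>x \<bullet> i \<notin> \<rat>\<close> by simp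
          qed
        qed
        show "f N \<in> grid_index N"
          unfolding grid_index_def f_def
        proof (rule restrict_PiE_iff[THEN iffD2], intro ballI)
          fix j :: 'a assume "j \<in> Basis"
          then show "nat \<lfloor>real N * (x \<bullet> j)\<rfloor> \<in> {..<N}" using i[of j] by (simp add: nat_less_iff floor_less_iff)
        qed
        show "x \<in> interior (grid_cell N (f N))"
          unfolding mem_interior_grid_cell[OF N]
        proof
          fix j :: 'a assume j: "j \<in> Basis"
          define y where "y = real N * (x \<bullet> j)"
          have y: "0 < y" "y \<notin> \<int>" using i[OF j] by (auto simp: y_def)
          have "of_int \<lfloor>y\<rfloor> \<noteq> y" using y(2) Ints_of_int by metis
          then have "of_int \<lfloor>y\<rfloor> < y" "y < of_int \<lfloor>y\<rfloor> + 1" using of_int_floor_le[of y] by linarith+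
          moreover have "real (f N j) = of_int \<lfloor>y\<rfloor>" using y(1) j by (simp add: f_def y_def)
          ultimately show "real (f N j) < real N * (x \<bullet> j) \<and> real N * (x \<bullet> j) < real (f N j) + 1"
            by (simp add: y_def)
        qed
      qed
      have "T N x = real (Suc N) ^ DIM('a) * Z (inf_ext (grid_cell (Suc N) (f (Suc N))) v)" for N
        using f by (intro T_in) auto
      moreover have "(\<lambda>N. real (Suc N) ^ DIM('a) * Z (inf_ext (grid_cell (Suc N) (f (Suc N))) v))
          \<longlonglongrightarrow> zeta (egrad (inf_ext Q v) x)"
        using f interior_subset
        by (intro Z_grid_cell_tendsto[OF v \<open>GDERIV v x :> egrad (inf_ext Q v) x\<close>]) blast
      ultimately show ?thesis using True by simp
    qed
  qed
  have "(\<lambda>N. \<integral>x. T N x \<partial>lebesgue) \<longlonglongrightarrow> (\<integral>x. indicator (eff_dom (inf_ext Q v)) x * zeta (egrad (inf_ext Q v) x) \<partial>lebesgue)"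
  proof (rule integral_dominated_convergence[OF _ T_meas _ lim])
    show "(\<lambda>x. indicator (eff_dom (inf_ext Q v)) x * zeta (egrad (inf_ext Q v) x)) \<in> borel_measurable lebesgue"
      by (rule borel_measurable_egrad[OF uC continuous_on_zeta])
    show "integrable lebesgue (\<lambda>x. M * indicator Q x)"
      by (intro integrable_mult_right integrable_real_indicator)
        (auto simp: Q_def)
    show "AE x in lebesgue. norm (T N x) \<le> M * indicator Q x" for N
      using T_bound by simp
  qed
  then show ?thesis
    unfolding T_int by (simp add: LIMSEQ_const_iff grad_integral_eq Q_def)
qed

end

section \<open>Approximation by Lipschitz functions\<close>

lemma super_coerciveI:
  fixes u :: "'a::euclidean_space \<Rightarrow> ereal"
  assumes "\<And>C. C \<ge> 0 \<Longrightarrow> \<exists>T. \<forall>x. norm x \<ge> T \<longrightarrow> ereal (C * norm x) \<le> u x"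
  shows "super_coercive u"
  unfolding super_coercive_def tendsto_PInfty
proof
  fix r :: real
  obtain T where T: "\<And>x. norm x \<ge> T \<Longrightarrow> ereal ((\<bar>r\<bar> + 1) * norm x) \<le> u x"
    using assms[of "\<bar>r\<bar> + 1"] by auto
  have "ereal r < u x / ereal (norm x)" if "norm x \<ge> max T 1" for x
  proof -
    have x: "norm x > 0" using that by linarith
    have *: "r * norm x < (\<bar>r\<bar> + 1) * norm x" using x by (intro mult_strict_right_mono) auto
    show ?thesis
    proof (cases "u x")
      case (real s)
      then have "(\<bar>r\<bar> + 1) * norm x \<le> s" using T[of x] that by simp
      then have "r * norm x < s" using * by linarith
      then show ?thesis using x real by (simp add: pos_less_divide_eq)
    qed (use T[of x] that x in auto)
  qed
  then show "\<forall>\<^sub>F x in at_infinity. ereal r < u x / ereal (norm x)"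
    unfolding eventually_at_infinity by blast
qed

text \<open>Closure of \<open>Conv_sc\<close> under the transformations is needed for the forward
  transfer: \<open>Z\<close> and its integral representation agree only on \<open>Conv_sc\<close>,
  so transformed functions must stay there.\<close>

lemma Conv_sc_add_const:
  fixes u :: "'a::euclidean_space \<Rightarrow> ereal"
  assumes u: "u \<in> Conv_sc"
  shows "(\<lambda>x. u x + ereal b) \<in> Conv_sc"
proof -
  note uC = Conv_sc_Conv[OF u]
  have "u x + ereal b \<noteq> -\<infinity>" for x using ConvD(1)[OF uC, of x] by (cases "u x") auto
  moreover have "econvex (\<lambda>x. u x + ereal b)"
    unfolding econvex_def
  proof (intro allI impI)
    fix x y and t :: real assume t: "0 < t" "t < 1"
    have "u ((1 - t) *\<^sub>R x + t *\<^sub>R y) + ereal b \<le> ereal (1 - t) * u x + ereal t * u y + ereal b"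
      using ConvD(2)[OF uC] t by (intro add_right_mono) (auto simp: econvex_def)
    also have "\<dots> = ereal (1 - t) * (u x + ereal b) + ereal t * (u y + ereal b)"
      using t ConvD(1)[OF uC, of x] ConvD(1)[OF uC, of y]
      by (cases "u x"; cases "u y") (auto simp: algebra_simps)
    finally show "u ((1 - t) *\<^sub>R x + t *\<^sub>R y) + ereal b
        \<le> ereal (1 - t) * (u x + ereal b) + ereal t * (u y + ereal b)" .
  qed
  moreover have "lower_semicont (\<lambda>x. u x + ereal b)"
    unfolding lower_semicont_iff
  proof (intro allI impI)
    have *: "c < y + ereal b \<longleftrightarrow> c - ereal b < y" for c y
      by (cases c; cases y) auto
    fix x c assume "c < u x + ereal b"
    then have "\<forall>\<^sub>F y in nhds x. c - ereal b < u y"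
      using ConvD(3)[OF uC] by (simp add: lower_semicont_iff *)
    then show "\<forall>\<^sub>F y in nhds x. c < u y + ereal b" by (simp add: *)
  qed
  moreover have "\<exists>x. u x + ereal b \<noteq> \<infinity>" using u by (auto simp: Conv_sc_def Conv_def)
  moreover have "super_coercive (\<lambda>x. u x + ereal b)"
  proof (rule super_coerciveI)
    fix C :: real assume C: "C \<ge> 0"
    \<comment> \<open>The extra unit of slope absorbs the constant \<open>b\<close> once the norm
      exceeds \<open>\<bar>b\<bar>\<close>.\<close>
    obtain T where T: "\<And>x. norm x \<ge> T \<Longrightarrow> ereal ((C + 1) * norm x) \<le> u x"
      using Conv_sc_superlinear[OF u] by blast
    have "ereal (C * norm x) \<le> u x + ereal b" if "norm x \<ge> max T \<bar>b\<bar>" for x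
      using T[of x] that by (cases "u x") (auto simp: algebra_simps)
    then show "\<exists>T. \<forall>x. norm x \<ge> T \<longrightarrow> ereal (C * norm x) \<le> u x + ereal b" by blast
  qed
  ultimately show ?thesis by (auto simp: Conv_sc_def Conv_def)
qed

lemma Conv_sc_epi_affine:
  fixes u :: "'a::euclidean_space \<Rightarrow> ereal"
  assumes u: "u \<in> Conv_sc" and c: "c > 0"
  shows "epi_affine a c u \<in> Conv_sc"
proof -
  note uC = Conv_sc_Conv[OF u]
  define g where "g x = (x - a) /\<^sub>R c" for x
  have ea: "epi_affine a c u x = ereal c * u (g x)" for x by (simp add: epi_affine_def g_def)
  have "epi_affine a c u x \<noteq> -\<infinity>" for x
    using ConvD(1)[OF uC, of "g x"] c by (cases "u (g x)") (auto simp: ea)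
  moreover have "econvex (epi_affine a c u)"
    unfolding econvex_def
  proof (intro allI impI)
    fix x y and t :: real assume t: "0 < t" "t < 1"
    have "g ((1 - t) *\<^sub>R x + t *\<^sub>R y) = (1 - t) *\<^sub>R g x + t *\<^sub>R g y"
      by (simp add: g_def algebra_simps)
    then have "epi_affine a c u ((1 - t) *\<^sub>R x + t *\<^sub>R y) = ereal c * u ((1 - t) *\<^sub>R g x + t *\<^sub>R g y)"
      by (simp add: ea)
    also have "\<dots> \<le> ereal c * (ereal (1 - t) * u (g x) + ereal t * u (g y))"
      using ConvD(2)[OF uC] c t by (intro ereal_mult_left_mono) (auto simp: econvex_def)
    also have "\<dots> = ereal (1 - t) * (ereal c * u (g x)) + ereal t * (ereal c * u (g y))"
      using c t ConvD(1)[OF uC, of "g x"] ConvD(1)[OF uC, of "g y"]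
      by (cases "u (g x)"; cases "u (g y)") (auto simp: algebra_simps)
    finally show "epi_affine a c u ((1 - t) *\<^sub>R x + t *\<^sub>R y)
        \<le> ereal (1 - t) * epi_affine a c u x + ereal t * epi_affine a c u y" by (simp add: ea)
  qed
  moreover have "lower_semicont (epi_affine a c u)"
    unfolding lower_semicont_iff
  proof (intro allI impI)
    have *: "d < ereal c * y \<longleftrightarrow> d / ereal c < y" for d y
      using c by (cases d; cases y) (auto simp: pos_divide_less_eq mult.commute)
    fix x d assume "d < epi_affine a c u x"
    then have "\<forall>\<^sub>F y in nhds (g x). d / ereal c < u y"
      using ConvD(3)[OF uC] by (simp add: lower_semicont_iff * ea)
    moreover have "isCont g x" unfolding g_def by (intro continuous_intros)
    then have "filterlim g (nhds (g x)) (nhds x)" by (simp add: isCont_def tendsto_at_iff_tendsto_nhds)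
    ultimately have "\<forall>\<^sub>F y in nhds x. d / ereal c < u (g y)" unfolding filterlim_iff by blast
    then show "\<forall>\<^sub>F y in nhds x. d < epi_affine a c u y" by (simp add: * ea)
  qed
  moreover have "\<exists>x. epi_affine a c u x \<noteq> \<infinity>"
  proof -
    obtain w where "u w \<noteq> \<infinity>" using u by (auto simp: Conv_sc_def Conv_def)
    moreover have "g (a + c *\<^sub>R w) = w" using c by (simp add: g_def)
    ultimately show ?thesis using c ConvD(1)[OF uC, of w]
      by (intro exI[of _ "a + c *\<^sub>R w"]) (cases "u w"; simp add: ea)
  qed
  moreover have "super_coercive (epi_affine a c u)"
  proof (rule super_coerciveI)
    fix C :: real assume C: "C \<ge> 0"
    \<comment> \<open>Far from the origin \<open>norm x\<close> is at most twice
      \<open>c * norm (g x)\<close>, which the slope \<open>2 * C\<close> makes up for.\<close>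
    obtain T where T: "\<And>x. norm x \<ge> T \<Longrightarrow> ereal (2 * C * norm x) \<le> u x"
      using Conv_sc_superlinear[OF u] by blast
    have "ereal (C * norm x) \<le> epi_affine a c u x" if x: "norm x \<ge> max (c * \<bar>T\<bar> + norm a) (2 * norm a)" for x
    proof -
      have cg: "c * norm (g x) = norm (x - a)" using c by (simp add: g_def)
      have "norm (x - a) \<ge> norm x - norm a" by (rule norm_triangle_ineq2)
      then have n: "c * norm (g x) \<ge> c * \<bar>T\<bar>" "2 * (c * norm (g x)) \<ge> norm x"
        using x unfolding cg by auto
      then have "norm (g x) \<ge> T" using c by simp
      then have "ereal c * ereal (2 * C * norm (g x)) \<le> ereal c * u (g x)"
        using c T by (intro ereal_mult_left_mono) auto
      moreover have "C * norm x \<le> C * (2 * (c * norm (g x)))" using C n(2) by (rule mult_left_mono[rotated])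
      then have "ereal (C * norm x) \<le> ereal c * ereal (2 * C * norm (g x))" by (simp add: mult_ac)
      ultimately show ?thesis unfolding ea by (rule order_trans[rotated])
    qed
    then show "\<exists>T. \<forall>x. norm x \<ge> T \<longrightarrow> ereal (C * norm x) \<le> epi_affine a c u x" by blast
  qed
  ultimately show ?thesis by (auto simp: Conv_sc_def Conv_def)
qed

text \<open>Points with values below \<open>-k\<close> stay in a ball by super-coercivity and so
  accumulate somewhere; lower semicontinuity at the accumulation point would force the value minus
  infinity.\<close>

lemma Conv_sc_bounded_below:
  fixes u :: "'a::euclidean_space \<Rightarrow> ereal"
  assumes u: "u \<in> Conv_sc"
  shows "\<exists>m. \<forall>y\<in>eff_dom u. m \<le> rpart u y"
proof (rule ccontr)
  note uC = Conv_sc_Conv[OF u]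
  assume "\<not> ?thesis"
  then have "\<forall>k::nat. \<exists>y\<in>eff_dom u. rpart u y < - real k" by (meson not_le)
  then obtain y where y: "\<And>k. y k \<in> eff_dom u" "\<And>k. rpart u (y k) < - real k" by metis
  obtain T where T: "\<And>x. norm x \<ge> T \<Longrightarrow> ereal (1 * norm x) \<le> u x"
    using Conv_sc_superlinear[OF u] by blast
  have "norm (y k) \<le> T" for k
  proof (rule ccontr)
    assume "\<not> norm (y k) \<le> T"
    then have "ereal (norm (y k)) \<le> ereal (rpart u (y k))"
      using T[of "y k"] ConvD(6)[OF uC y(1)] by simp
    then have "0 \<le> rpart u (y k)" using norm_ge_zero[of "y k"] by (simp del: norm_ge_zero)
    then show False using y(2)[of k] by simp
  qed
  then have "bounded (range y)" by (auto simp: bounded_iff)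
  then obtain x q where q: "strict_mono (q :: nat \<Rightarrow> nat)" "(y \<circ> q) \<longlonglongrightarrow> x"
    using bounded_imp_convergent_subsequence by blast
  have "-\<infinity> < u x" using ConvD(1)[OF uC, of x] by simp
  then obtain c where c: "ereal c < u x" using ereal_dense2 by blast
  \<comment> \<open>Epi-convergence of the constant sequence is used as sequential lower
    semicontinuity.\<close>
  have "u x \<le> liminf (\<lambda>j. u ((y \<circ> q) j))"
    by (rule epi_converges_liminf[OF epi_converges_const[OF uC] q(2)])
  then have "\<forall>\<^sub>F j in sequentially. ereal c < u ((y \<circ> q) j)"
    using c less_LiminfD[of "ereal c"] order_less_le_trans by blast
  moreover have "\<forall>\<^sub>F j in sequentially. real j > - c"
    using filterlim_real_sequentially by (simp add: filterlim_at_top_dense)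
  ultimately have "\<forall>\<^sub>F j::nat in sequentially. False"
  proof eventually_elim
    case (elim j)
    have "c < rpart u (y (q j))" using elim(1) ConvD(6)[OF uC y(1), of "q j"] by (metis comp_apply less_ereal.simps(1))
    moreover have "real j \<le> real (q j)" using seq_suble[OF q(1), of j] by simp
    ultimately show False using y(2)[of "q j"] elim(2) by linarith
  qed
  then show False by simp
qed

text \<open>The Pasch--Hausdorff envelope of \<open>u\<close>: the largest \<open>K\<close>-Lipschitz minorant.\<close>

definition lip_envelope :: "real \<Rightarrow> ('a::euclidean_space \<Rightarrow> ereal) \<Rightarrow> 'a \<Rightarrow> real" where
  "lip_envelope K u x = (INF y\<in>eff_dom u. rpart u y + K * norm (x - y))"

text \<open>A lower bound of \<open>u\<close> makes the infimum finite. Each competitor is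
  \<open>K\<close>-Lipschitz in \<open>x\<close>, hence so is the infimum; convexity holds because
  the competitors are jointly convex in \<open>x\<close> and \<open>y\<close>.\<close>

lemma lip_envelope:
  fixes u :: "'a::euclidean_space \<Rightarrow> ereal"
  assumes u: "u \<in> Conv_sc" and K: "K \<ge> 0"
  shows lip_envelope_le: "y \<in> eff_dom u \<Longrightarrow> lip_envelope K u x \<le> rpart u y + K * norm (x - y)"
    and lip_envelope_ge: "(\<And>y. y \<in> eff_dom u \<Longrightarrow> c \<le> rpart u y + K * norm (x - y)) \<Longrightarrow> c \<le> lip_envelope K u x"
    and convex_on_lip_envelope: "convex_on UNIV (lip_envelope K u)"
    and lipschitz_lip_envelope: "K-lipschitz_on UNIV (lip_envelope K u)"
proof -
  note uC = Conv_sc_Conv[OF u]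
  obtain m where m: "\<And>y. y \<in> eff_dom u \<Longrightarrow> m \<le> rpart u y"
    using Conv_sc_bounded_below[OF u] by blast
  have "m \<le> rpart u y + K * norm (x - y)" if "y \<in> eff_dom u" for x y
    using m[OF that] K by (simp add: add_increasing2)
  then have bdd: "bdd_below ((\<lambda>y. rpart u y + K * norm (x - y)) ` eff_dom u)" for x
    by (auto simp: bdd_below_def)
  show le: "lip_envelope K u x \<le> rpart u y + K * norm (x - y)" if "y \<in> eff_dom u" for x y
    unfolding lip_envelope_def by (rule cINF_lower[OF bdd that])
  show ge: "c \<le> lip_envelope K u x" if "\<And>y. y \<in> eff_dom u \<Longrightarrow> c \<le> rpart u y + K * norm (x - y)" for c x
    unfolding lip_envelope_def by (rule cINF_greatest) (use ConvD(4)[OF uC] that in auto)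
  have lip: "lip_envelope K u x \<le> lip_envelope K u x' + K * dist x x'" for x x'
  proof -
    have "lip_envelope K u x - K * dist x x' \<le> lip_envelope K u x'"
    proof (rule ge)
      fix y assume "y \<in> eff_dom u"
      then have "lip_envelope K u x \<le> rpart u y + K * norm (x - y)" by (rule le)
      also have "norm (x - y) \<le> dist x x' + norm (x' - y)"
        unfolding dist_norm using norm_triangle_ineq[of "x - x'" "x' - y"] by simp
      then have "K * norm (x - y) \<le> K * (dist x x' + norm (x' - y))" using K by (rule mult_left_mono)
      finally show "lip_envelope K u x - K * dist x x' \<le> rpart u y + K * norm (x' - y)"
        by (simp add: algebra_simps)
    qed
    then show ?thesis by simp
  qed
  show "K-lipschitz_on UNIV (lip_envelope K u)"
  proof (rule lipschitz_onI)
    fix x y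
    show "dist (lip_envelope K u x) (lip_envelope K u y) \<le> K * dist x y"
      using lip[of x y] lip[of y x] by (simp add: dist_real_def dist_commute abs_le_iff)
  qed (rule K)
  show "convex_on UNIV (lip_envelope K u)"
  proof (rule convex_onI)
    fix t :: real and x x' assume t: "0 < t" "t < 1"
    let ?v = "lip_envelope K u"
    define w where "w = ?v ((1 - t) *\<^sub>R x + t *\<^sub>R x')"
    have two: "w \<le> (1 - t) * (rpart u y + K * norm (x - y)) + t * (rpart u y' + K * norm (x' - y'))"
      if y: "y \<in> eff_dom u" "y' \<in> eff_dom u" for y y'
    proof -
      have mem: "(1 - t) *\<^sub>R y + t *\<^sub>R y' \<in> eff_dom u"
        using t y by (intro convexD[OF convex_eff_dom[OF uC]]) auto
      have "w \<le> rpart u ((1 - t) *\<^sub>R y + t *\<^sub>R y') + K * norm ((1 - t) *\<^sub>R x + t *\<^sub>R x' - ((1 - t) *\<^sub>R y + t *\<^sub>R y'))"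
        unfolding w_def by (rule le[OF mem])
      also have "(1 - t) *\<^sub>R x + t *\<^sub>R x' - ((1 - t) *\<^sub>R y + t *\<^sub>R y') = (1 - t) *\<^sub>R (x - y) + t *\<^sub>R (x' - y')"
        by (simp add: algebra_simps)
      also have "K * norm ((1 - t) *\<^sub>R (x - y) + t *\<^sub>R (x' - y')) \<le> K * ((1 - t) * norm (x - y) + t * norm (x' - y'))"
        using norm_triangle_ineq[of "(1 - t) *\<^sub>R (x - y)" "t *\<^sub>R (x' - y')"] t K
        by (intro mult_left_mono) auto
      also have "rpart u ((1 - t) *\<^sub>R y + t *\<^sub>R y') \<le> (1 - t) * rpart u y + t * rpart u y'"
        using t y by (intro convex_onD[OF convex_on_rpart[OF uC]]) auto
      finally show ?thesis by (simp add: algebra_simps)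
    qed
    \<comment> \<open>The two infima are taken one after the other: first over \<open>y\<close> with
      \<open>y'\<close> fixed, then over \<open>y'\<close>.\<close>
    have one: "w \<le> (1 - t) * ?v x + t * (rpart u y' + K * norm (x' - y'))" if y': "y' \<in> eff_dom u" for y'
    proof -
      have "(w - t * (rpart u y' + K * norm (x' - y'))) / (1 - t) \<le> ?v x"
        using two[OF _ y'] t by (intro ge) (simp add: pos_divide_le_eq algebra_simps)
      then show ?thesis using t by (simp add: pos_divide_le_eq algebra_simps)
    qed
    have "(w - (1 - t) * ?v x) / t \<le> ?v x'"
      using one t by (intro ge) (simp add: pos_divide_le_eq algebra_simps)
    then have "w - (1 - t) * ?v x \<le> t * ?v x'" using t by (simp add: pos_divide_le_eq mult.commute)
    then show "?v ((1 - t) *\<^sub>R x + t *\<^sub>R x') \<le> (1 - t) * ?v x + t * ?v x'"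
      unfolding w_def by linarith
  qed simp
qed

text \<open>The envelope lies below \<open>u\<close> on the domain, so constant sequences give the
  upper estimate. For the lower one, competitors near \<open>x\<close> are controlled by lower
  semicontinuity, and distant ones by the penalty, which grows with \<open>k\<close> while
  \<open>u\<close> is bounded below.\<close>

lemma epi_converges_lip_envelope:
  fixes u :: "'a::euclidean_space \<Rightarrow> ereal"
  assumes u: "u \<in> Conv_sc"
  shows "epi_converges (\<lambda>k. inf_ext (cbox (- real (Suc k) *\<^sub>R One) (real (Suc k) *\<^sub>R One)) (lip_envelope (real (Suc k)) u)) u"
proof -
  note uC = Conv_sc_Conv[OF u]
  define C where "C k = cbox (- real (Suc k) *\<^sub>R One) (real (Suc k) *\<^sub>R One :: 'a)" for k
  define v where "v k = lip_envelope (real (Suc k)) u" for k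
  obtain m where m: "\<And>y. y \<in> eff_dom u \<Longrightarrow> m \<le> rpart u y"
    using Conv_sc_bounded_below[OF u] by blast
  have low: "\<forall>\<^sub>F k in sequentially. c < inf_ext (C k) (v k) (s k)" if s: "s \<longlonglongrightarrow> x" and c: "c < u x" for s x c
  proof -
    obtain c' where c': "c < ereal c'" "ereal c' < u x" using ereal_dense2[OF c] by blast
    have "\<forall>\<^sub>F y in nhds x. ereal c' < u y"
      using ConvD(3)[OF uC] c'(2) by (auto simp: lower_semicont_iff)
    then obtain \<delta> where \<delta>: "\<delta> > 0" "\<And>y. dist y x < \<delta> \<Longrightarrow> ereal c' < u y"
      by (auto simp: eventually_nhds_metric)
    have "\<forall>\<^sub>F k in sequentially. dist (s k) x < \<delta> / 2" using s \<delta>(1) by (intro tendstoD) auto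
    moreover have "\<forall>\<^sub>F k in sequentially. real k > 2 * (c' - m) / \<delta>"
      using filterlim_real_sequentially by (simp add: filterlim_at_top_dense)
    ultimately show ?thesis
    proof eventually_elim
      case (elim k)
      have "c' \<le> v k (s k)"
        unfolding v_def
      proof (rule lip_envelope_ge[OF u])
        fix y assume y: "y \<in> eff_dom u"
        show "c' \<le> rpart u y + real (Suc k) * norm (s k - y)"
        proof (cases "dist y x < \<delta>")
          case True
          have "ereal c' < ereal (rpart u y)" using \<delta>(2)[OF True] ConvD(6)[OF uC y] by simp
          then show ?thesis by (simp add: add_increasing2)
        next
          case False
          then have "norm (s k - y) \<ge> \<delta> / 2"
            using elim(1) dist_triangle[of y x "s k"] by (simp add: dist_norm norm_minus_commute)
          then have "real (Suc k) * (\<delta> / 2) \<le> real (Suc k) * norm (s k - y)" by (intro mult_left_mono) auto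
          moreover have "c' - m \<le> real (Suc k) * (\<delta> / 2)"
          proof -
            have "2 * (c' - m) < real k * \<delta>" using elim(2) \<delta>(1) by (simp add: pos_divide_less_eq)
            also have "\<dots> \<le> real (Suc k) * \<delta>" using \<delta>(1) by (intro mult_right_mono) auto
            finally show ?thesis by simp
          qed
          ultimately show ?thesis using m[OF y] by linarith
        qed
      qed simp
      then have "ereal c' \<le> inf_ext (C k) (v k) (s k)" by (simp add: inf_ext_def)
      then show ?case using c'(1) by (rule less_le_trans[rotated])
    qed
  qed
  have "(\<lambda>k. inf_ext (C k) (v k) x) \<longlonglongrightarrow> u x" for x
  proof (rule order_tendstoI)
    fix c assume "c < u x" then show "\<forall>\<^sub>F k in sequentially. c < inf_ext (C k) (v k) x"
      by (rule low[OF tendsto_const])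
  next
    fix c assume c: "u x < c"
    then have x: "x \<in> eff_dom u" using ConvD(1)[OF uC, of x] by (auto simp: eff_dom_def)
    have "\<forall>\<^sub>F k in sequentially. real k > norm x"
      using filterlim_real_sequentially by (simp add: filterlim_at_top_dense)
    then show "\<forall>\<^sub>F k in sequentially. inf_ext (C k) (v k) x < c"
    proof eventually_elim
      case (elim k)
      have "- real (Suc k) \<le> x \<bullet> i" "x \<bullet> i \<le> real (Suc k)" if "i \<in> Basis" for i
        using Basis_le_norm[OF that, of x] elim by auto
      then have "x \<in> C k" by (auto simp: C_def mem_box)
      moreover have "v k x \<le> rpart u x" using lip_envelope_le[OF u _ x, of "real (Suc k)" x] by (simp add: v_def)
      ultimately have "inf_ext (C k) (v k) x \<le> ereal (rpart u x)" by simp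
      also have "\<dots> = u x" using ConvD(6)[OF uC x] by simp
      finally show ?case using c by (rule le_less_trans)
    qed
  qed
  then show ?thesis
    unfolding epi_converges_def C_def[symmetric] v_def[symmetric] le_Liminf_iff
    using low by (intro allI conjI impI exI[of _ "\<lambda>_. x" for x]) auto
qed

section \<open>Compact support of the density and passage to general functions\<close>

context epi_valuation
begin

text \<open>The box is a stack of \<open>m + 1\<close> unit cubes along axis \<open>i\<close>, and
  translating a linear function from one cube to the next changes it by a constant only. Long boxes
  thus amplify any nonzero value of \<open>zeta\<close>.\<close>

lemma Z_stack:
  assumes i: "i \<in> Basis"
  shows "Z (inf_ext (cbox 0 (One + real m *\<^sub>R i)) (\<lambda>z. y \<bullet> z)) = real (Suc m) * zeta y"
proof (induction m)
  case 0
  then show ?case by (simp add: zeta_def)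
next
  case (Suc m)
  define c where "c = real (Suc m)"
  define B where "B = cbox 0 (One + c *\<^sub>R i)"
  have c: "c > 0" by (simp add: c_def)
  have img: "(\<lambda>z. 1 *\<^sub>R z + c *\<^sub>R i) ` cbox 0 One = cbox (c *\<^sub>R i) (One + c *\<^sub>R i)"
    unfolding image_affinity_cbox by simp
  have "One + c *\<^sub>R i + (c - (One + c *\<^sub>R i) \<bullet> i) *\<^sub>R i = One + real m *\<^sub>R i"
    using i by (simp add: c_def inner_add_left algebra_simps)
  moreover have cut: "0 \<bullet> i \<le> c" "c \<le> (One + c *\<^sub>R i) \<bullet> i" using i c by (auto simp: inner_add_left)
  ultimately have B1: "B \<inter> {x. x \<bullet> i \<le> c} = cbox 0 (One + real m *\<^sub>R i)"
    using cbox_cut(1)[OF i cut] by (simp only: B_def)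
  have B2: "B \<inter> {x. x \<bullet> i \<ge> c} = (\<lambda>z. 1 *\<^sub>R z + c *\<^sub>R i) ` cbox 0 One"
    unfolding B_def cbox_cut(2)[OF i cut] img by simp
  have "Z (inf_ext B (\<lambda>z. y \<bullet> z))
      = Z (inf_ext (B \<inter> {x. x \<bullet> i \<le> c}) (\<lambda>z. y \<bullet> z)) + Z (inf_ext (B \<inter> {x. x \<bullet> i \<ge> c}) (\<lambda>z. y \<bullet> z))"
    unfolding B_def
    by (rule Z_box_cut[OF i cut _ convex_on_inner lipschitz_on_inner])
      (use i c in \<open>auto simp: convex_box box_ne_empty inner_add_left inner_Basis\<close>)
  moreover have "Z (inf_ext (B \<inter> {x. x \<bullet> i \<ge> c}) (\<lambda>z. y \<bullet> z)) = zeta y"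
  proof -
    have "Z (inf_ext ((\<lambda>z. 1 *\<^sub>R z + c *\<^sub>R i) ` cbox 0 One) (\<lambda>z. y \<bullet> z))
        = 1 ^ DIM('a) * Z (inf_ext (cbox 0 One) (\<lambda>z. y \<bullet> (1 *\<^sub>R z + c *\<^sub>R i) / 1))"
      by (intro Z_affine_image convex_on_inner continuous_intros)
        (auto simp: convex_box img simp del: scaleR_one)
    also have "\<dots> = Z (inf_ext (cbox 0 One) (\<lambda>z. y \<bullet> z + c * (y \<bullet> i)))" by (simp add: inner_add_right)
    also have "\<dots> = zeta y" unfolding zeta_def by (rule Z_add_const[OF inf_ext_inner_Conv_sc])
    finally show ?thesis unfolding B2 .
  qed
  ultimately have "Z (inf_ext B (\<lambda>z. y \<bullet> z)) = real (Suc m) * zeta y + zeta y"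
    using Suc.IH B1 by simp
  then show ?case by (simp add: B_def c_def algebra_simps)
qed

text \<open>Were \<open>zeta\<close> not compactly supported, one could choose linear functions of unbounded slope in
  direction \<open>i\<close> on boxes that are thin in all other directions, but so long in direction \<open>i\<close> that
  \<open>Z\<close> is at least \<open>1\<close> in absolute value; but they epi-converge to the indicator function of a point.\<close>

lemma zeta_Cc: "zeta \<in> Cc"
proof -
  have "bounded {y. zeta y \<noteq> 0}"
  proof (rule ccontr)
    assume "\<not> ?thesis"
    \<comment> \<open>An unbounded set of slopes is unbounded in some coordinate; that axis becomes
      the long direction of the boxes.\<close>
    have "\<exists>i\<in>Basis. \<forall>k::nat. \<exists>y. zeta y \<noteq> 0 \<and> \<bar>y \<bullet> i\<bar> > real k"
    proof (rule ccontr)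
      assume "\<not> ?thesis"
      then have "\<forall>i\<in>Basis. \<exists>k::nat. \<forall>y. zeta y \<noteq> 0 \<longrightarrow> \<bar>y \<bullet> i\<bar> \<le> real k" by (meson not_le)
      then obtain k :: "'a \<Rightarrow> nat" where k: "\<And>i y. i \<in> Basis \<Longrightarrow> zeta y \<noteq> 0 \<Longrightarrow> \<bar>y \<bullet> i\<bar> \<le> real (k i)"
        by metis
      have "norm y \<le> (\<Sum>i\<in>Basis. real (k i))" if "zeta y \<noteq> 0" for y
        using norm_le_l1[of y] sum_mono[of Basis "\<lambda>i. \<bar>y \<bullet> i\<bar>" "\<lambda>i. real (k i)"] k that by fastforce
      then have "bounded {y. zeta y \<noteq> 0}" by (auto simp: bounded_iff)
      with \<open>\<not> bounded {y. zeta y \<noteq> 0}\<close> show False ..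
    qed
    then obtain i where i: "i \<in> Basis" and "\<forall>k::nat. \<exists>y. zeta y \<noteq> 0 \<and> \<bar>y \<bullet> i\<bar> > real k" by blast
    then obtain y where y: "\<And>k. zeta (y k) \<noteq> 0" "\<And>k. \<bar>y k \<bullet> i\<bar> > real k" by metis
    define n where "n = DIM('a)"
    define r where "r k = inverse (real (Suc k))" for k
    have r: "r k > 0" for k by (simp add: r_def)
    \<comment> \<open>The length \<open>N k\<close> outweighs both the shrinking factor
      \<open>r k ^ n\<close> and a possibly tiny value of \<open>zeta (y k)\<close>.\<close>
    have "\<exists>N::nat. 1 / (r k ^ n * \<bar>zeta (y k)\<bar>) < real N" for k using reals_Archimedean2 by blast
    then obtain N where N: "\<And>k. 1 / (r k ^ n * \<bar>zeta (y k)\<bar>) < real (N k)" by metis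
    define side where "side k j = (if j = i then real (Suc (N k)) else 1)" for k j
    \<comment> \<open>The box is placed with a vertex at the origin, in the orthant where every
      coordinate of \<open>x\<close> agrees in sign with that of \<open>y k\<close>. The linear
      function is then nonnegative on the box and vanishes at 0.\<close>
    define p where "p k = (\<Sum>j\<in>Basis. (if y k \<bullet> j \<ge> 0 then 0 else - (r k * side k j)) *\<^sub>R j)" for k
    have p: "p k \<bullet> j = (if y k \<bullet> j \<ge> 0 then 0 else - (r k * side k j))" if "j \<in> Basis" for k j
      using that by (simp add: p_def inner_sum_left_Basis)
    have side: "z \<in> cbox 0 (One + real (N k) *\<^sub>R i) \<longleftrightarrow> (\<forall>j\<in>Basis. 0 \<le> z \<bullet> j \<and> z \<bullet> j \<le> side k j)" for z k
      using i by (auto simp: side_def mem_box inner_add_left inner_Basis)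
    define B where "B k = (\<lambda>z. r k *\<^sub>R z + p k) ` cbox 0 (One + real (N k) *\<^sub>R i)" for k
    define U where "U k = inf_ext (B k) (\<lambda>z. y k \<bullet> z)" for k
    have ne: "cbox 0 (One + real m *\<^sub>R i) \<noteq> {}" for m :: nat
      using i by (auto simp: box_ne_empty inner_add_left inner_Basis)
    have Bbox: "\<exists>a b. B k = cbox a b" for k
      using r[of k] ne unfolding B_def image_affinity_cbox by (auto simp: less_imp_le)
    then have cB: "compact (B k)" "convex (B k)" for k
      by (metis compact_cbox) (metis Bbox convex_box(1))
    have B0: "B k \<noteq> {}" for k using ne by (simp add: B_def)
    have Usc: "U k \<in> Conv_sc" for k
      unfolding U_def by (intro inf_ext_Conv_sc convex_on_inner continuous_intros cB B0)
    have Z_ge: "\<bar>Z (U k)\<bar> \<ge> 1" for k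
    proof -
      have sc: "inf_ext (cbox 0 (One + real (N k) *\<^sub>R i)) (\<lambda>z. y k \<bullet> z) \<in> Conv_sc"
        by (intro inf_ext_Conv_sc convex_on_inner continuous_intros ne) (auto simp: convex_box)
      have "Z (U k) = r k ^ n * Z (inf_ext (cbox 0 (One + real (N k) *\<^sub>R i)) (\<lambda>z. y k \<bullet> (r k *\<^sub>R z + p k) / r k))"
        unfolding U_def B_def n_def
        by (intro Z_affine_image convex_on_inner continuous_intros ne r)
          (use cB(2)[of k] in \<open>auto simp: convex_box B_def\<close>)
      also have "(\<lambda>z. y k \<bullet> (r k *\<^sub>R z + p k) / r k) = (\<lambda>z. y k \<bullet> z + (y k \<bullet> p k) / r k)"
        using r[of k] by (simp add: inner_add_right add_divide_distrib)
      also have "Z (inf_ext (cbox 0 (One + real (N k) *\<^sub>R i)) \<dots>) = real (Suc (N k)) * zeta (y k)"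
        unfolding Z_add_const[OF sc] by (rule Z_stack[OF i])
      finally have "\<bar>Z (U k)\<bar> = r k ^ n * \<bar>zeta (y k)\<bar> * real (Suc (N k))"
        using r[of k] by (simp add: abs_mult mult_ac)
      moreover have "1 < r k ^ n * \<bar>zeta (y k)\<bar> * real (N k)"
        using N[of k] r[of k] y(1)[of k] by (simp add: pos_divide_less_eq mult_ac)
      moreover have "r k ^ n * \<bar>zeta (y k)\<bar> * real (N k) \<le> r k ^ n * \<bar>zeta (y k)\<bar> * real (Suc (N k))"
        using r[of k] by (intro mult_left_mono) auto
      ultimately show ?thesis by linarith
    qed
    have zero: "U k 0 = 0" for k
    proof -
      define z where "z = (\<Sum>j\<in>Basis. (if y k \<bullet> j \<ge> 0 then 0 else side k j) *\<^sub>R j)"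
      have z: "z \<bullet> j = (if y k \<bullet> j \<ge> 0 then 0 else side k j)" if "j \<in> Basis" for j
        using that by (simp add: z_def inner_sum_left_Basis)
      have "0 = r k *\<^sub>R z + p k"
        by (rule euclidean_eqI) (simp add: inner_add_left z p)
      moreover have "z \<in> cbox 0 (One + real (N k) *\<^sub>R i)" by (simp add: side z) (simp add: side_def)
      ultimately have "0 \<in> B k" unfolding B_def by (rule image_eqI)
      then show ?thesis by (simp add: U_def)
    qed
    have coord: "\<bar>x \<bullet> j\<bar> \<le> r k * side k j \<and> (y k \<bullet> j) * (x \<bullet> j) = \<bar>y k \<bullet> j\<bar> * \<bar>x \<bullet> j\<bar>"
      if x: "x \<in> B k" and j: "j \<in> Basis" for x j k
    proof -
      obtain z where z: "x = r k *\<^sub>R z + p k" "z \<in> cbox 0 (One + real (N k) *\<^sub>R i)"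
        using x by (auto simp: B_def)
      define d where "d = r k * (z \<bullet> j)"
      have d: "0 \<le> d" "d \<le> r k * side k j"
        using z(2) j r[of k] by (auto simp: d_def side)
      have "x \<bullet> j = d + p k \<bullet> j" unfolding z(1) d_def by (simp add: inner_add_left)
      then show ?thesis using d p[OF j, of k] by (cases "y k \<bullet> j \<ge> 0") (auto simp: algebra_simps)
    qed
    have steep: "y k \<bullet> x \<ge> real k * \<bar>x \<bullet> i\<bar>" if x: "x \<in> B k" for x k
    proof -
      have "real k * \<bar>x \<bullet> i\<bar> \<le> \<bar>y k \<bullet> i\<bar> * \<bar>x \<bullet> i\<bar>"
        using y(2)[of k] by (intro mult_right_mono) auto
      also have "\<dots> \<le> (\<Sum>j\<in>Basis. \<bar>y k \<bullet> j\<bar> * \<bar>x \<bullet> j\<bar>)" using i by (intro member_le_sum) auto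
      also have "\<dots> = y k \<bullet> x" using coord[OF x] by (simp add: euclidean_inner[of "y k" x])
      finally show ?thesis .
    qed
    \<comment> \<open>A limit point off the origin has a nonzero coordinate. In a short direction
      the points eventually leave the box, whose thickness is \<open>r k\<close>; in direction
      \<open>i\<close> the growing slope drives the values to infinity, however long the box
      is.\<close>
    have far: "\<forall>\<^sub>F k in sequentially. ereal c < U k (s k)" if s: "s \<longlonglongrightarrow> x" and x: "x \<noteq> 0" for s x c
    proof -
      obtain j where j: "j \<in> Basis" "x \<bullet> j \<noteq> 0" using x by (metis euclidean_all_zero_iff)
      define h where "h = \<bar>x \<bullet> j\<bar> / 2"
      have h: "h > 0" using j by (simp add: h_def)
      have "(\<lambda>k. \<bar>s k \<bullet> j\<bar>) \<longlonglongrightarrow> \<bar>x \<bullet> j\<bar>" by (intro tendsto_intros s)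
      then have ev1: "\<forall>\<^sub>F k in sequentially. h < \<bar>s k \<bullet> j\<bar>"
        by (rule order_tendstoD) (use h in \<open>simp add: h_def\<close>)
      show ?thesis
      proof (cases "j = i")
        case False
        have "\<forall>\<^sub>F k in sequentially. r k < h"
          unfolding r_def using order_tendstoD(2)[OF LIMSEQ_inverse_real_of_nat h] .
        with ev1 show ?thesis
        proof eventually_elim
          case (elim k)
          have "s k \<notin> B k" using coord[OF _ j(1), of "s k" k] False elim by (auto simp: side_def)
          then show ?case by (simp add: U_def)
        qed
      next
        case True
        have "\<forall>\<^sub>F k in sequentially. real k > c / h"
          using filterlim_real_sequentially by (simp add: filterlim_at_top_dense)
        with ev1 show ?thesis
        proof eventually_elim
          case (elim k)
          show ?case
          proof (cases "s k \<in> B k")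
            case in_B: True
            have "c < real k * h" using elim(2) h by (simp add: pos_divide_less_eq)
            also have "\<dots> \<le> real k * \<bar>s k \<bullet> i\<bar>" using elim(1) True by (intro mult_left_mono) auto
            also have "\<dots> \<le> y k \<bullet> s k" by (rule steep[OF in_B])
            finally have "c < y k \<bullet> s k" .
            then show ?thesis using in_B by (simp add: U_def)
          qed (simp add: U_def)
        qed
      qed
    qed
    have nonneg: "0 \<le> U k x" for k x
    proof (cases "x \<in> B k")
      case True
      have "0 \<le> real k * \<bar>x \<bullet> i\<bar>" by simp
      also have "\<dots> \<le> y k \<bullet> x" by (rule steep[OF True])
      finally show ?thesis using True by (simp add: U_def)
    qed (simp add: U_def)
    have "epi_converges U (inf_ext {0} (\<lambda>_. 0))"
      unfolding epi_converges_def le_Liminf_iff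
    proof (intro allI conjI impI)
      fix x s c assume s: "s \<longlonglongrightarrow> x" and c: "c < inf_ext {0::'a} (\<lambda>_. 0) x"
      show "\<forall>\<^sub>F k in sequentially. c < U k (s k)"
      proof (cases "x = 0")
        case True
        then have "c < 0" using c by (simp add: zero_ereal_def)
        then show ?thesis using nonneg by (intro always_eventually allI) (rule less_le_trans)
      next
        case False
        then obtain c' where "c < ereal c'" using c ereal_dense2 by (metis inf_ext_simps(2) singletonD)
        then show ?thesis
          using far[OF s False, of c'] by (auto elim!: eventually_mono intro: less_trans)
      qed
    next
      fix x :: 'a
      show "\<exists>s. s \<longlonglongrightarrow> x \<and> (\<lambda>k. U k (s k)) \<longlonglongrightarrow> inf_ext {0} (\<lambda>_. 0) x"
      proof (cases "x = 0")
        case True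
        then show ?thesis
          by (intro exI[of _ "\<lambda>_. 0"]) (simp add: zero flip: zero_ereal_def)
      next
        case False
        then have "(\<lambda>k. U k x) \<longlonglongrightarrow> \<infinity>"
          unfolding tendsto_PInfty using far[OF tendsto_const] by blast
        then show ?thesis using False by (intro exI[of _ "\<lambda>_. x"]) simp
      qed
    qed
    moreover have "inf_ext {0::'a} (\<lambda>_. 0) \<in> Conv_sc"
      by (intro inf_ext_Conv_sc) (auto simp: convex_on_const)
    ultimately have "(\<lambda>k. Z (U k)) \<longlonglongrightarrow> Z (inf_ext {0} (\<lambda>_. 0))"
      by (intro Z_tendsto Usc)
    \<comment> \<open>A point is a degenerate box, so the limit has value 0, against
      \<open>\<bar>Z (U k)\<bar> \<ge> 1\<close>.\<close>
    moreover have "Z (inf_ext (cbox 0 0) (\<lambda>_. 0)) = 0"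
    proof (rule Z_degenerate)
      show "\<exists>i\<in>Basis. (0::'a) \<bullet> i = 0 \<bullet> i" using i by (intro bexI[of _ i]) auto
      show "0-lipschitz_on (cbox 0 0) (\<lambda>_::'a. 0::real)" by (simp add: lipschitz_on_def)
    qed (auto simp: convex_on_const)
    then have "Z (inf_ext {0} (\<lambda>_. 0)) = 0" by simp
    ultimately have "(\<lambda>k. \<bar>Z (U k)\<bar>) \<longlonglongrightarrow> \<bar>0\<bar>" by (intro tendsto_intros) simp
    then have "(1::real) \<le> \<bar>0\<bar>" by (rule LIMSEQ_le_const) (use Z_ge in auto)
    then show False by simp
  qed
  then show ?thesis
    using continuous_on_zeta by (simp add: Cc_def compact_closure)
qed

text \<open>Both functionals obey the same scaling law, so agreement on the unit cube passes to
  every cube: the pulled-back function is again convex and \<open>L\<close>-Lipschitz.\<close>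

lemma Z_cube:
  assumes v: "convex_on UNIV v" "L-lipschitz_on UNIV v" and r: "r > 0"
    and W: "epi_valuation W" and eq: "\<And>w. convex_on UNIV w \<Longrightarrow> L-lipschitz_on UNIV w \<Longrightarrow>
      Z (inf_ext (cbox 0 One) w) = W (inf_ext (cbox 0 One) w)"
  shows "Z (inf_ext ((\<lambda>z. r *\<^sub>R z + p) ` cbox 0 One) v) = W (inf_ext ((\<lambda>z. r *\<^sub>R z + p) ` cbox 0 One) v)"
proof -
  define w where "w = (\<lambda>z. v (r *\<^sub>R z + p) / r)"
  have "convex_on UNIV w" "L-lipschitz_on UNIV w"
    unfolding w_def by (rule convex_on_affine_pullback[OF v(1) r] lipschitz_affine_pullback[OF v(2) r]; simp)+
  then have 1: "Z (inf_ext (cbox 0 One) w) = W (inf_ext (cbox 0 One) w)" by (rule eq)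
  have "convex ((\<lambda>z. r *\<^sub>R z + p) ` cbox 0 (One::'a))"
    using r by (simp add: image_affinity_cbox convex_box)
  then have c: "convex_on ((\<lambda>z. r *\<^sub>R z + p) ` cbox 0 One) v" "continuous_on ((\<lambda>z. r *\<^sub>R z + p) ` cbox 0 One) v"
    using v lipschitz_on_continuous_on[OF v(2)]
    by (auto intro: convex_on_subset continuous_on_subset)
  show ?thesis
    using Z_affine_image[OF compact_cbox _ _ r c] epi_valuation.Z_affine_image[OF W compact_cbox _ _ r c] 1
    by (simp add: w_def convex_box)
qed

text \<open>Both sides are epi-continuous and agree on the Lipschitz envelopes restricted to growing
  cubes, which epi-converge to \<open>u\<close>. Continuity of the integral is taken from the first
  implication, through \<open>zeta_Cc\<close>.\<close>

lemma Z_eq_grad_integral: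
  assumes u: "u \<in> Conv_sc"
  shows "Z u = grad_integral zeta u"
proof -
  have G: "epi_valuation (grad_integral zeta)"
    by unfold_locales (rule grad_integral_properties[OF zeta_Cc])+
  define U where "U k = inf_ext (cbox (- real (Suc k) *\<^sub>R One) (real (Suc k) *\<^sub>R One)) (lip_envelope (real (Suc k)) u)" for k
  have eq: "Z (U k) = grad_integral zeta (U k)" and sc: "U k \<in> Conv_sc" for k
  proof -
    define r where "r = real (Suc k)"
    have r: "r > 0" by (simp add: r_def)
    have v: "convex_on UNIV (lip_envelope r u)" "r-lipschitz_on UNIV (lip_envelope r u)"
      using convex_on_lip_envelope[OF u] lipschitz_lip_envelope[OF u] r by auto
    \<comment> \<open>The centred cube of half-side \<open>r\<close> is the unit cube scaled by
      \<open>2 * r\<close> and moved to the corner with all coordinates \<open>-r\<close>.\<close>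
    have "(2 * r) *\<^sub>R One + - r *\<^sub>R One = (2 * r + - r) *\<^sub>R (One::'a)" by (simp only: scaleR_add_left)
    then have "(2 * r) *\<^sub>R One + - r *\<^sub>R One = r *\<^sub>R (One::'a)" by simp
    then have box: "(\<lambda>z. (2 * r) *\<^sub>R z + - r *\<^sub>R One) ` cbox 0 One = cbox (- r *\<^sub>R One) (r *\<^sub>R (One::'a))"
      using r unfolding image_affinity_cbox by simp
    show "Z (U k) = grad_integral zeta (U k)"
      unfolding U_def r_def[symmetric] box[symmetric]
      by (rule Z_cube[OF v _ G Z_unit_cube]) (use r in auto)
    have "cbox (- r *\<^sub>R One) (r *\<^sub>R (One::'a)) \<noteq> {}" unfolding box[symmetric] by simp
    then show "U k \<in> Conv_sc"
      unfolding U_def r_def[symmetric] using v lipschitz_on_continuous_on[OF v(2)]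
      by (intro inf_ext_Conv_sc) (auto intro: convex_on_subset continuous_on_subset simp: convex_box)
  qed
  have epi: "epi_converges U u" unfolding U_def by (rule epi_converges_lip_envelope[OF u])
  have "(\<lambda>k. Z (U k)) \<longlonglongrightarrow> Z u" by (rule Z_tendsto[OF sc u epi])
  moreover have "(\<lambda>k. Z (U k)) \<longlonglongrightarrow> grad_integral zeta u"
    unfolding eq by (rule epi_valuation.Z_tendsto[OF G sc u epi])
  ultimately show ?thesis by (rule LIMSEQ_unique)
qed

end

section \<open>Transfer of the properties to the given functional, and the equivalence\<close>

lemma epi_valuation_cong:
  fixes Z :: "('a::euclidean_space \<Rightarrow> ereal) \<Rightarrow> real"
  assumes W: "epi_valuation W" and eq: "\<And>u. u \<in> Conv_sc \<Longrightarrow> Z u = W u"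
  shows "epi_valuation Z"
proof
  interpret epi_valuation W by (rule W)
  show "epi_continuous_on Conv_sc Z"
    using cont eq by (simp add: epi_continuous_on_def)
  show "valuation_on Conv_sc Z"
    using val eq by (simp add: valuation_on_def)
  have tr: "(\<lambda>x. u (x - a)) \<in> Conv_sc" if "u \<in> Conv_sc" for u :: "'a \<Rightarrow> ereal" and a
    using Conv_sc_epi_affine[OF that zero_less_one, of a] by (simp add: epi_affine_def flip: one_ereal_def)
  show "epi_translation_invariant_on Conv_sc Z"
    using inv eq[OF tr] eq[OF Conv_sc_add_const] eq
    by (simp add: epi_translation_invariant_on_def translation_invariant_on_def
        vertically_translation_invariant_on_def)
  have "epi_mult c u \<in> Conv_sc" if "u \<in> Conv_sc" "c > 0" for c and u :: "'a \<Rightarrow> ereal"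
    using Conv_sc_epi_affine[OF that, of 0] by (simp add: epi_affine_def epi_mult_def)
  then show "epi_homogeneous_on (real DIM('a)) Conv_sc Z"
    using hom eq by (simp add: epi_homogeneous_on_def)
qed

theorem theorem2:
  fixes Z :: "(real ^ 'n \<Rightarrow> ereal) \<Rightarrow> real"
  shows "(epi_continuous_on Conv_sc Z \<and> epi_translation_invariant_on Conv_sc Z \<and>
          valuation_on Conv_sc Z \<and> epi_homogeneous_on (real CARD('n)) Conv_sc Z)
     \<longleftrightarrow> (\<exists>\<zeta>\<in>Cc. \<forall>u\<in>Conv_sc. Z u = (LINT x:eff_dom u|lebesgue. \<zeta> (egrad u x)))"
proof -
  \<comment> \<open>For \<open>real ^ 'n\<close> the degree \<open>DIM('a)\<close> fixed in the
    locale is \<open>CARD('n)\<close>.\<close>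
  have "(epi_continuous_on Conv_sc Z \<and> epi_translation_invariant_on Conv_sc Z \<and>
      valuation_on Conv_sc Z \<and> epi_homogeneous_on (real CARD('n)) Conv_sc Z) \<longleftrightarrow> epi_valuation Z"
    by (auto simp: epi_valuation_def)
  also have "\<dots> \<longleftrightarrow> (\<exists>\<zeta>\<in>Cc. \<forall>u\<in>Conv_sc. Z u = grad_integral \<zeta> u)"
  proof
    assume "epi_valuation Z"
    then show "\<exists>\<zeta>\<in>Cc. \<forall>u\<in>Conv_sc. Z u = grad_integral \<zeta> u"
      using epi_valuation.zeta_Cc epi_valuation.Z_eq_grad_integral by blast
  next
    assume "\<exists>\<zeta>\<in>Cc. \<forall>u\<in>Conv_sc. Z u = grad_integral \<zeta> u"
    then obtain \<zeta> where \<zeta>: "\<zeta> \<in> Cc" "\<And>u. u \<in> Conv_sc \<Longrightarrow> Z u = grad_integral \<zeta> u" by blast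
    have "epi_valuation (grad_integral \<zeta>)"
      by unfold_locales (rule grad_integral_properties[OF \<zeta>(1)])+
    then show "epi_valuation Z" using \<zeta>(2) by (rule epi_valuation_cong)
  qed
  finally show ?thesis by (simp add: grad_integral_def)
qed

end
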